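(* Let $R$ be a non-discrete irreducible, continuous ring. Then the metric space $(\mathrm{GL}(R),d_R)$ is a length space. In particular, $\mathrm{GL}(R)$ is both path-connected and locally path-connected with respect to the rank topology.
   Context: All rings are unital. A ring $R$ is regular if for every $a \in R$ there is $b \in R$ with $aba=a$. For a regular ring $R$, the set $L(R)=\{aR : a\in R\}$, ordered by inclusion, is a complemented modular lattice. A continuous ring is a regular ring $R$ such that the lattice $L(R)$ is complete and satisfies $I\wedge\bigvee C=\bigvee\{I\wedge J : J\in C\}$ and $I\vee\bigwedge C=\bigwedge\{I\vee J : J\in C\}$ for every chain $C\subseteq L(R)$ and every $I\in L(R)$. A ring is irreducible if it is non-zero and not isomorphic to a direct product of two non-zero rings. A rank function on a regular ring $R$ is a map $\rho\colon R\to[0,1]$ with $\rho(1)=1$, $\rho(ab)\le\min\{\rho(a),\rho(b)\}$ for all $a,b \in R$, $\rho(e+f)=\rho(e)+\rho(f)$ for any idempotents $e,f$ with $ef=fe=0$, and $\rho(a)=0$ only if $a=0$. Every irreducible, continuous ring $R$ has a unique rank function, denoted $\mathrm{rk}_R$; the rank metric is $d_R(a,b)=\mathrm{rk}_R(a-b)$, and the topology it generates is the rank topology. $R$ is non-discrete if its rank topology is not discrete. $\mathrm{GL}(R)$ denotes the group of units of $R$, equipped with the restriction of $d_R$. A path in a metric space $(X,d)$ is a continuous map $\gamma\colon[0,t]\to X$ with $t\in\mathbb{R}_{\ge0}$; its length is $\ell_d(\gamma)=\sup\{\sum_{i=0}^{n-1}d(\gamma(t_i),\gamma(t_{i+1}))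 : n\in\mathbb{N}_{>0},\ 0=t_0\le\ldots\le t_n=t\}$. $(X,d)$ is a length space if for all $x,y\in X$ and $\varepsilon>0$ there is a path $\gamma$ in $(X,d)$ from $x$ to $y$ with $\ell_d(\gamma)\le d(x,y)+\varepsilon$. *)

theory Defs
  imports
    "HOL-Algebra.Complete_Lattice"
    "HOL-Algebra.QuotRing"
    "HOL-Algebra.Chinese_Remainder"
    "HOL-Analysis.Analysis"
begin

section \<open>Continuous rings\<close>

definition regular_ring :: "('a, 'm) ring_scheme \<Rightarrow> bool" where
  "regular_ring R \<longleftrightarrow> ring R \<and>
     (\<forall>a\<in>carrier R. \<exists>b\<in>carrier R. a \<otimes>\<^bsub>R\<^esub> b \<otimes>\<^bsub>R\<^esub> a = a)"

definition principal_right_ideals :: "('a, 'm) ring_scheme \<Rightarrow> 'a set set" where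
  "principal_right_ideals R = {a <#\<^bsub>R\<^esub> carrier R | a. a \<in> carrier R}"

definition ideal_lattice :: "('a, 'm) ring_scheme \<Rightarrow> 'a set gorder" where
  "ideal_lattice R =
     \<lparr>carrier = principal_right_ideals R, eq = (=), le = (\<subseteq>)\<rparr>"

definition continuous_ring :: "('a, 'm) ring_scheme \<Rightarrow> bool" where
  "continuous_ring R \<longleftrightarrow>
     regular_ring R \<and>
     Complete_Lattice.complete_lattice (ideal_lattice R) \<and>
     (\<forall>C I. subset.chain (principal_right_ideals R) C \<longrightarrow> I \<in> principal_right_ideals R \<longrightarrow>
        I \<sqinter>\<^bsub>ideal_lattice R\<^esub> (\<Squnion>\<^bsub>ideal_lattice R\<^esub> C)
          = \<Squnion>\<^bsub>ideal_lattice R\<^esub> ((\<lambda>J. I \<sqinter>\<^bsub>ideal_lattice R\<^esub> J) ` C) \<and>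
        I \<squnion>\<^bsub>ideal_lattice R\<^esub> (\<Sqinter>\<^bsub>ideal_lattice R\<^esub> C)
          = \<Sqinter>\<^bsub>ideal_lattice R\<^esub> ((\<lambda>J. I \<squnion>\<^bsub>ideal_lattice R\<^esub> J) ` C))"

text \<open>
  Letting the factors range only over rings with elements in the same type is no restriction:
  the factors of a direct product decomposition of a ring embed (not preserving the unit) into the
  ring itself, so isomorphic copies of them live on subsets of its carrier.
\<close>

definition irreducible_ring :: "('a, 'm) ring_scheme \<Rightarrow> bool" where
  "irreducible_ring R \<longleftrightarrow>
     ring R \<and> carrier R \<noteq> {\<zero>\<^bsub>R\<^esub>} \<and>
     \<not> (\<exists>(S :: 'a ring) (T :: 'a ring).
          ring S \<and> carrier S \<noteq> {\<zero>\<^bsub>S\<^esub>} \<and>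
          ring T \<and> carrier T \<noteq> {\<zero>\<^bsub>T\<^esub>} \<and>
          R \<simeq> RDirProd S T)"

section \<open>The rank metric\<close>

definition rank_function :: "('a, 'm) ring_scheme \<Rightarrow> ('a \<Rightarrow> real) \<Rightarrow> bool" where
  "rank_function R \<rho> \<longleftrightarrow>
     \<rho> \<in> carrier R \<rightarrow> {0..1} \<and>
     \<rho> \<one>\<^bsub>R\<^esub> = 1 \<and>
     (\<forall>a\<in>carrier R. \<forall>b\<in>carrier R. \<rho> (a \<otimes>\<^bsub>R\<^esub> b) \<le> min (\<rho> a) (\<rho> b)) \<and>
     (\<forall>e\<in>carrier R. \<forall>f\<in>carrier R.
        e \<otimes>\<^bsub>R\<^esub> e = e \<and> f \<otimes>\<^bsub>R\<^esub> f = f \<and> e \<otimes>\<^bsub>R\<^esub> f = \<zero>\<^bsub>R\<^esub> \<and> f \<otimes>\<^bsub>R\<^esub> e = \<zero>\<^bsub>R\<^esub> \<longrightarrow>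
        \<rho> (e \<oplus>\<^bsub>R\<^esub> f) = \<rho> e + \<rho> f) \<and>
     (\<forall>a\<in>carrier R. \<rho> a = 0 \<longrightarrow> a = \<zero>\<^bsub>R\<^esub>)"

text \<open>
  An irreducible continuous ring has exactly one rank function. The choice operator rather than
  the definite description is used because a function satisfying the predicate above has
  arbitrary values outside the carrier; only values on the carrier are ever used.
\<close>

definition ring_rk :: "('a, 'm) ring_scheme \<Rightarrow> 'a \<Rightarrow> real" where
  "ring_rk R = (SOME \<rho>. rank_function R \<rho>)"

text \<open>
  The locale \<^locale>\<open>Metric_space\<close> requires symmetry and non-negativity also
  outside the carrier, whence the default value.
\<close>

definition rank_dist :: "('a, 'm) ring_scheme \<Rightarrow> 'a \<Rightarrow> 'a \<Rightarrow> real" where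
  "rank_dist R a b =
     (if a \<in> carrier R \<and> b \<in> carrier R then ring_rk R (a \<ominus>\<^bsub>R\<^esub> b) else 0)"

definition rank_topology :: "('a, 'm) ring_scheme \<Rightarrow> 'a topology" where
  "rank_topology R = Metric_space.mtopology (carrier R) (rank_dist R)"

definition nondiscrete_ring :: "('a, 'm) ring_scheme \<Rightarrow> bool" where
  "nondiscrete_ring R \<longleftrightarrow> rank_topology R \<noteq> discrete_topology (carrier R)"

section \<open>Length spaces\<close>

definition metric_path :: "'a set \<Rightarrow> ('a \<Rightarrow> 'a \<Rightarrow> real) \<Rightarrow> real \<Rightarrow> (real \<Rightarrow> 'a) \<Rightarrow> bool" where
  "metric_path M d t \<gamma> \<longleftrightarrow>
     0 \<le> t \<and> continuous_map (top_of_set {0..t}) (Metric_space.mtopology M d) \<gamma>"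

definition metric_path_length :: "('a \<Rightarrow> 'a \<Rightarrow> real) \<Rightarrow> real \<Rightarrow> (real \<Rightarrow> 'a) \<Rightarrow> ereal" where
  "metric_path_length d t \<gamma> =
     Sup {ereal (\<Sum>i<n. d (\<gamma> (s i)) (\<gamma> (s (Suc i)))) | (n :: nat) (s :: nat \<Rightarrow> real).
            0 < n \<and> s 0 = 0 \<and> s n = t \<and> (\<forall>i<n. s i \<le> s (Suc i))}"

definition length_space :: "'a set \<Rightarrow> ('a \<Rightarrow> 'a \<Rightarrow> real) \<Rightarrow> bool" where
  "length_space M d \<longleftrightarrow>
     Metric_space M d \<and>
     (\<forall>x\<in>M. \<forall>y\<in>M. \<forall>\<epsilon>>0. \<exists>t \<gamma>.
        metric_path M d t \<gamma> \<and> \<gamma> 0 = x \<and> \<gamma> t = y \<and>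
        metric_path_length d t \<gamma> \<le> ereal (d x y + \<epsilon>))"

end

theory Submission
  imports Defs
begin

text \<open>
  Irreducibility makes any two principal right ideals comparable up to embedding, and continuity of
  the lattice excludes infinite families of independent isomorphic submodules, so that everything is
  directly finite. In the absence of atoms every idempotent splits into two equivalent halves;
  repeated halving of the unit gives a scale of idempotents against which the rank of an element is
  measured, and, by continuity of the lattice, chains of idempotents that take all ranks below a
  given one.

  For a unit \<open>g\<close>, let \<open>e\<close> be an idempotent with \<open>eR = (g - 1)R\<close>, and let \<open>f\<^sub>t\<close> be a chain of
  idempotents below \<open>e\<close> with \<open>rk f\<^sub>t = t\<close>. If all the elements \<open>1 + f\<^sub>t (g - 1)\<close> are units, then they
  form a path from \<open>1\<close> to \<open>g\<close> of length \<open>rk (g - 1)\<close>. Such a chain is found step by step: each step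
  covers at least a quarter of the rank that is left. By translation, \<open>GL(R)\<close> is a geodesic space.
\<close>

section \<open>Idempotents and principal right ideals\<close>

text \<open>For an arbitrary idempotent \<open>f\<close> below \<open>e\<close>,
  \<open>1 + f (g - 1)\<close> need not be a unit. Its kernel consists of the \<open>u\<close> in
  \<open>fR\<close> with \<open>f g u = 0\<close>, so the compression of \<open>g\<close> to
  \<open>fR\<close> has to be injective. For the matrix \<open>g\<close> with rows (0 1) and (1 1),
  where \<open>e = 1\<close>, the projection \<open>f\<close> onto the first coordinate has
  \<open>f g f = 0\<close>. Moreover all members of a chain must work at once, so the property
  wanted of \<open>f\<close> has to pass to every idempotent below \<open>f\<close>. The quarter
  comes from an alternative: either \<open>P\<close> has a quarter of the rank of \<open>e\<close>,
  or \<open>P + g P + g^{-1} P\<close>, whose rank is at most three times that of \<open>P\<close>,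
  leaves a complement with more than a quarter. Steps can be iterated because, for a unit
  \<open>k = 1 + F (g - 1)\<close> with \<open>F\<close> below \<open>e\<close>,
  \<open>g k^{-1}\<close> differs from \<open>1\<close> by an element of \<open>(e - F)R\<close>.
  The rank is obtained by a choice operator, so a rank function has to be constructed in every
  irreducible continuous ring, also in one with atoms. Only afterwards can non-discreteness of the
  topology exclude atoms.\<close>

no_notation Sum_Type.Plus (infixr \<open><+>\<close> 65)

context ring
begin

definition idem :: "'a \<Rightarrow> bool"
  where "idem e \<longleftrightarrow> e \<in> carrier R \<and> e \<otimes> e = e"

definition idem_le :: "'a \<Rightarrow> 'a \<Rightarrow> bool"
  where "idem_le e f \<longleftrightarrow> idem e \<and> idem f \<and> e \<otimes> f = e \<and> f \<otimes> e = e"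

definition orth :: "'a \<Rightarrow> 'a \<Rightarrow> bool"
  where "orth e f \<longleftrightarrow> e \<otimes> f = \<zero> \<and> f \<otimes> e = \<zero>"

text \<open>Over a regular ring this says that \<open>aR\<close> is isomorphic to a direct summand of \<open>bR\<close>.\<close>

definition dominated :: "'a \<Rightarrow> 'a \<Rightarrow> bool"
  where "dominated a b \<longleftrightarrow> (\<exists>x\<in>carrier R. \<exists>y\<in>carrier R. a = x \<otimes> b \<otimes> y)"

text \<open>For idempotent \<open>e\<close> this is \<open>eR\<close>. As the set of fixed points of
  left multiplication by \<open>e\<close>, membership becomes an equation that rewriting can
  use.\<close>

definition rideal :: "'a \<Rightarrow> 'a set"
  where "rideal e = {x \<in> carrier R. e \<otimes> x = x}"

abbreviation "PR \<equiv> principal_right_ideals R"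

definition annih :: "'a \<Rightarrow> 'a set"
  where "annih a = {x \<in> carrier R. a \<otimes> x = \<zero>}"

lemma idem_carrier [simp, intro]: "idem e \<Longrightarrow> e \<in> carrier R"
  by (simp add: idem_def)

lemma idemI: "\<lbrakk>e \<in> carrier R; e \<otimes> e = e\<rbrakk> \<Longrightarrow> idem e"
  by (simp add: idem_def)

lemma idem_mult [simp]: "idem e \<Longrightarrow> e \<otimes> e = e"
  by (simp add: idem_def)

text \<open>Products are normalised to the right, which hides \<open>a \<otimes> b\<close> in front
  of further factors; this rule makes a relation for \<open>a \<otimes> b\<close> applicable
  there.\<close>

lemma mult_absorb:
  "\<lbrakk>a \<otimes> b = c; a \<in> carrier R; b \<in> carrier R; x \<in> carrier R\<rbrakk> \<Longrightarrow> a \<otimes> (b \<otimes> x) = c \<otimes> x"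
  by (simp flip: m_assoc)

lemma idem_mult_left [simp]: "\<lbrakk>idem e; x \<in> carrier R\<rbrakk> \<Longrightarrow> e \<otimes> (e \<otimes> x) = e \<otimes> x"
  by (simp add: mult_absorb)

lemma idem_one [simp]: "idem \<one>" and idem_zero [simp]: "idem \<zero>"
  by (simp_all add: idem_def)

lemma minus_zero_iff: "\<lbrakk>x \<in> carrier R; y \<in> carrier R\<rbrakk> \<Longrightarrow> x \<ominus> y = \<zero> \<longleftrightarrow> x = y"
  by (metis minus_eq minus_equality minus_minus r_neg a_inv_closed)

lemma add_zero_iff: "\<lbrakk>x \<in> carrier R; y \<in> carrier R\<rbrakk> \<Longrightarrow> x \<oplus> y = \<zero> \<longleftrightarrow> x = \<ominus> y"
  using minus_equality r_neg l_neg by metis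

lemma add_eq_iff:
  "\<lbrakk>x \<in> carrier R; y \<in> carrier R; z \<in> carrier R\<rbrakk> \<Longrightarrow> x \<oplus> y = z \<longleftrightarrow> x = z \<ominus> y"
  by (metis a_comm a_minus_def add.inv_solve_right minus_closed)

lemma minus_add_cancel: "\<lbrakk>x \<in> carrier R; y \<in> carrier R\<rbrakk> \<Longrightarrow> (x \<ominus> y) \<oplus> y = x"
  by (simp add: add_eq_iff)

lemma add_minus_cancel: "\<lbrakk>x \<in> carrier R; y \<in> carrier R\<rbrakk> \<Longrightarrow> y \<oplus> (x \<ominus> y) = x"
  by (metis a_comm minus_add_cancel minus_closed)

lemma l_distr_minus:
  "\<lbrakk>x \<in> carrier R; y \<in> carrier R; z \<in> carrier R\<rbrakk> \<Longrightarrow> (x \<ominus> y) \<otimes> z = x \<otimes> z \<ominus> y \<otimes> z"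
  by algebra

lemma r_distr_minus:
  "\<lbrakk>x \<in> carrier R; y \<in> carrier R; z \<in> carrier R\<rbrakk> \<Longrightarrow> z \<otimes> (x \<ominus> y) = z \<otimes> x \<ominus> z \<otimes> y"
  by algebra

lemma minus_self [simp]: "x \<in> carrier R \<Longrightarrow> x \<ominus> x = \<zero>"
  by (simp add: minus_zero_iff)

lemma minus_zero_right [simp]: "x \<in> carrier R \<Longrightarrow> x \<ominus> \<zero> = x"
  by algebra

lemmas distr_simps = l_distr r_distr l_distr_minus r_distr_minus m_assoc

lemma idem_compl [simp]: "idem e \<Longrightarrow> idem (\<one> \<ominus> e)"
  by (rule idemI) (simp_all add: distr_simps)

lemma rideal_iff: "x \<in> rideal e \<longleftrightarrow> x \<in> carrier R \<and> e \<otimes> x = x"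
  by (simp add: rideal_def)

lemma prin_iff: "a \<in> carrier R \<Longrightarrow> x \<in> a <# carrier R \<longleftrightarrow> (\<exists>r\<in>carrier R. x = a \<otimes> r)"
  by (auto simp: l_coset_def)

lemma PR_iff: "P \<in> PR \<longleftrightarrow> (\<exists>a\<in>carrier R. P = a <# carrier R)"
  by (auto simp: principal_right_ideals_def)

lemma rideal_prin: "idem e \<Longrightarrow> rideal e = e <# carrier R"
proof (intro Set.set_eqI)
  fix x assume e: "idem e"
  show "x \<in> rideal e \<longleftrightarrow> x \<in> e <# carrier R"
  proof
    assume "x \<in> rideal e"
    then have "x \<in> carrier R" "x = e \<otimes> x" by (auto simp: rideal_iff)
    then show "x \<in> e <# carrier R" using e by (auto simp: prin_iff)
  qed (use e in \<open>auto simp: prin_iff rideal_iff\<close>)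
qed

lemma rideal_PR [simp, intro]: "idem e \<Longrightarrow> rideal e \<in> PR"
  by (auto simp: PR_iff rideal_prin)

lemma prin_PR [simp, intro]: "a \<in> carrier R \<Longrightarrow> a <# carrier R \<in> PR"
  by (auto simp: PR_iff)

lemma prin_self [simp, intro]: "a \<in> carrier R \<Longrightarrow> a \<in> a <# carrier R"
  by (metis one_closed prin_iff r_one)

lemma PR_subset: "P \<in> PR \<Longrightarrow> P \<subseteq> carrier R"
  by (auto simp: PR_iff prin_iff)

lemma PR_carrier: "\<lbrakk>P \<in> PR; x \<in> P\<rbrakk> \<Longrightarrow> x \<in> carrier R"
  using PR_subset by auto

lemma PR_zero [simp, intro]: "P \<in> PR \<Longrightarrow> \<zero> \<in> P"
  unfolding PR_iff by (metis prin_iff r_null zero_closed)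

lemma PR_mult [intro]: "\<lbrakk>P \<in> PR; x \<in> P; r \<in> carrier R\<rbrakk> \<Longrightarrow> x \<otimes> r \<in> P"
  unfolding PR_iff by (metis m_assoc m_closed prin_iff)

lemma PR_add [intro]: "\<lbrakk>P \<in> PR; x \<in> P; y \<in> P\<rbrakk> \<Longrightarrow> x \<oplus> y \<in> P"
  unfolding PR_iff by (metis r_distr a_closed prin_iff)

lemma PR_neg: "\<lbrakk>P \<in> PR; x \<in> P\<rbrakk> \<Longrightarrow> \<ominus> x \<in> P"
  unfolding PR_iff by (metis r_minus a_inv_closed prin_iff)

lemma PR_minus: "\<lbrakk>P \<in> PR; x \<in> P; y \<in> P\<rbrakk> \<Longrightarrow> x \<ominus> y \<in> P"
  by (simp add: PR_add PR_neg minus_eq)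

lemma PR_prin_subset: "\<lbrakk>P \<in> PR; x \<in> P\<rbrakk> \<Longrightarrow> x <# carrier R \<subseteq> P"
  using PR_carrier PR_mult prin_iff by auto

lemma zero_PR [simp]: "{\<zero>} \<in> PR"
proof -
  have "\<zero> <# carrier R = {\<zero>}"
    by (auto simp: l_coset_def)
  then show ?thesis by (metis prin_PR zero_closed)
qed

lemma carrier_PR [simp]: "carrier R \<in> PR"
proof -
  have "\<one> <# carrier R = carrier R"
    by (auto simp: l_coset_def)
  then show ?thesis by (metis prin_PR one_closed)
qed

lemma set_add_iff: "x \<in> P <+> Q \<longleftrightarrow> (\<exists>p\<in>P. \<exists>q\<in>Q. x = p \<oplus> q)"
  by (auto simp: set_add_def')

lemma set_add_left: "\<lbrakk>P \<in> PR; Q \<in> PR; x \<in> P\<rbrakk> \<Longrightarrow> x \<in> P <+> Q"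
  unfolding set_add_iff by (metis PR_zero PR_carrier r_zero)

lemma set_add_right: "\<lbrakk>P \<in> PR; Q \<in> PR; x \<in> Q\<rbrakk> \<Longrightarrow> x \<in> P <+> Q"
  unfolding set_add_iff by (metis PR_zero PR_carrier l_zero)

lemma set_add_least: "\<lbrakk>P \<subseteq> K; Q \<subseteq> K; K \<in> PR\<rbrakk> \<Longrightarrow> P <+> Q \<subseteq> K"
  by (auto simp: set_add_iff subset_iff)

lemma PR_Int_zero_iff: "\<lbrakk>P \<in> PR; Q \<in> PR\<rbrakk> \<Longrightarrow> P \<inter> Q = {\<zero>} \<longleftrightarrow> (\<forall>x\<in>P. x \<in> Q \<longrightarrow> x = \<zero>)"
  using PR_zero by blast

lemma idem_leD:
  assumes "idem_le e f"
  shows "idem e" "idem f" "e \<otimes> f = e" "f \<otimes> e = e"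
  using assms by (auto simp: idem_le_def)

lemma idem_le_refl [simp]: "idem e \<Longrightarrow> idem_le e e"
  by (simp add: idem_le_def)

lemma idem_le_zero [simp]: "idem e \<Longrightarrow> idem_le \<zero> e"
  by (simp add: idem_le_def)

lemma idem_le_one [simp]: "idem e \<Longrightarrow> idem_le e \<one>"
  by (simp add: idem_le_def)

lemma idem_le_trans:
  assumes "idem_le e f" "idem_le f g" shows "idem_le e g"
  using assms unfolding idem_le_def by (metis m_assoc idem_carrier)

lemma idem_le_antisym: "\<lbrakk>idem_le e f; idem_le f e\<rbrakk> \<Longrightarrow> e = f"
  by (simp add: idem_le_def)

lemma idem_le_minus:
  assumes "idem_le e f"
  shows "idem (f \<ominus> e)" "idem_le (f \<ominus> e) f" "orth e (f \<ominus> e)" "orth (f \<ominus> e) e" "e \<oplus> (f \<ominus> e) = f"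
proof -
  note D = idem_leD[OF assms]
  show "idem (f \<ominus> e)"
    by (rule idemI) (use D in \<open>simp_all add: distr_simps\<close>)
  then show "idem_le (f \<ominus> e) f"
    unfolding idem_le_def using D by (simp add: distr_simps)
  show "orth e (f \<ominus> e)" "orth (f \<ominus> e) e"
    unfolding orth_def using D by (simp_all add: distr_simps)
  show "e \<oplus> (f \<ominus> e) = f"
    using D by (simp add: add_minus_cancel)
qed

lemma orth_sum:
  assumes "idem e" "idem f" "orth e f"
  shows "idem (e \<oplus> f)" "idem_le e (e \<oplus> f)" "idem_le f (e \<oplus> f)"
proof -
  show "idem (e \<oplus> f)"
    by (rule idemI) (use assms in \<open>simp_all add: orth_def distr_simps\<close>)
  then show "idem_le e (e \<oplus> f)" "idem_le f (e \<oplus> f)"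
    using assms by (auto simp: idem_le_def orth_def distr_simps)
qed

lemma orth_sum_le:
  assumes "orth e f" "idem_le e g" "idem_le f g"
  shows "idem_le (e \<oplus> f) g"
  using assms orth_sum[of e f] idem_leD[OF assms(2)] idem_leD[OF assms(3)]
  by (auto simp: idem_le_def distr_simps)

lemma orth_le:
  assumes "orth e f" "idem_le e' e" "idem_le f' f"
  shows "orth e' f'"
proof -
  note D = idem_leD[OF assms(2)] idem_leD[OF assms(3)]
  have c: "e \<in> carrier R" "f \<in> carrier R" "e' \<in> carrier R" "f' \<in> carrier R"
    using D by auto
  have "e' \<otimes> f' = e' \<otimes> (e \<otimes> f) \<otimes> f'" "f' \<otimes> e' = f' \<otimes> (f \<otimes> e) \<otimes> e'"
    using D c by (metis m_assoc m_closed)+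
  then show ?thesis
    using assms(1) c by (simp add: orth_def)
qed

text \<open>An idempotent is the projection onto \<open>rideal e\<close> along
  \<open>annih e\<close>. In this form the order becomes two inclusions of principal right ideals,
  on which continuity of the lattice can act.\<close>

lemma idem_le_iff:
  assumes "idem e" "idem f"
  shows "idem_le e f \<longleftrightarrow> rideal e \<subseteq> rideal f \<and> annih f \<subseteq> annih e"
proof
  assume "idem_le e f"
  note D = idem_leD[OF this]
  have "f \<otimes> x = x" if "x \<in> carrier R" "e \<otimes> x = x" for x
    using that D by (metis idem_carrier m_assoc)
  moreover have "e \<otimes> x = \<zero>" if "x \<in> carrier R" "f \<otimes> x = \<zero>" for x
    using that D by (metis idem_carrier m_assoc r_null)
  ultimately show "rideal e \<subseteq> rideal f \<and> annih f \<subseteq> annih e"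
    by (auto simp: rideal_def annih_def)
next
  assume A: "rideal e \<subseteq> rideal f \<and> annih f \<subseteq> annih e"
  have "e \<in> rideal e"
    using assms by (simp add: rideal_def)
  then have 1: "f \<otimes> e = e"
    using A by (auto simp: rideal_def)
  have "\<one> \<ominus> f \<in> annih f"
    using assms by (simp add: annih_def distr_simps)
  then have "e \<otimes> (\<one> \<ominus> f) = \<zero>"
    using A by (auto simp: annih_def)
  then have "e = e \<otimes> f"
    using assms by (simp add: distr_simps minus_zero_iff)
  then show "idem_le e f"
    using 1 assms by (simp add: idem_le_def)
qed

section \<open>Embeddings between principal right ideals, expressed by factorization\<close>

lemma dominatedI:
  "\<lbrakk>a = x \<otimes> b \<otimes> y; x \<in> carrier R; y \<in> carrier R\<rbrakk> \<Longrightarrow> dominated a b"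
  by (auto simp: dominated_def)

lemma dominated_refl [simp]: "a \<in> carrier R \<Longrightarrow> dominated a a"
  unfolding dominated_def by (metis l_one one_closed r_one)

lemma dominated_trans:
  assumes "dominated a b" "dominated b c" "c \<in> carrier R"
  shows "dominated a c"
proof -
  obtain x y where xy: "x \<in> carrier R" "y \<in> carrier R" "a = x \<otimes> b \<otimes> y"
    using assms(1) by (auto simp: dominated_def)
  obtain z w where zw: "z \<in> carrier R" "w \<in> carrier R" "b = z \<otimes> c \<otimes> w"
    using assms(2) by (auto simp: dominated_def)
  have "a = (x \<otimes> z) \<otimes> c \<otimes> (w \<otimes> y)"
    using xy zw assms(3) by (simp add: m_assoc)
  then show ?thesis
    unfolding dominated_def using xy zw by blast
qed

lemma dominated_mult: 
  assumes "a \<in> carrier R" "b \<in> carrier R"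
  shows "dominated (a \<otimes> b) a" "dominated (a \<otimes> b) b"
proof -
  have "a \<otimes> b = \<one> \<otimes> a \<otimes> b" "a \<otimes> b = a \<otimes> b \<otimes> \<one>"
    using assms by simp_all
  then show "dominated (a \<otimes> b) a" "dominated (a \<otimes> b) b"
    unfolding dominated_def using assms by (metis one_closed)+
qed

lemma dominated_le: "idem_le e f \<Longrightarrow> dominated e f"
  by (metis dominated_mult(1) idem_leD(1,2,4) idem_carrier)

lemma dominated_zero [simp]: "a \<in> carrier R \<Longrightarrow> dominated \<zero> a"
  by (metis dominated_mult(1) r_null zero_closed)

lemma dominated_zero_right: "\<lbrakk>dominated a \<zero>\<rbrakk> \<Longrightarrow> a = \<zero>"
  by (auto simp: dominated_def)

lemma dominated_idem:
  assumes "dominated e f" "idem e" "f \<in> carrier R"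
  obtains x y where "x \<in> carrier R" "y \<in> carrier R" "e = x \<otimes> f \<otimes> y" "e \<otimes> x = x" "y \<otimes> e = y"
proof -
  obtain x y where xy: "x \<in> carrier R" "y \<in> carrier R" "e = x \<otimes> f \<otimes> y"
    using assms(1) by (auto simp: dominated_def)
  have "e = e \<otimes> e \<otimes> e"
    using assms by simp
  also have "\<dots> = (e \<otimes> x) \<otimes> f \<otimes> (y \<otimes> e)"
    using xy assms(2,3) by (metis (no_types, lifting) idem_carrier m_assoc m_closed)
  finally show thesis
    using that[of "e \<otimes> x" "y \<otimes> e"] xy assms(2) by (simp add: m_assoc)
qed

text \<open>The two factorizations are placed block-diagonally; orthogonality of \<open>p'\<close>
  and \<open>q'\<close> removes the mixed terms.\<close>

lemma dominated_sum:
  assumes "dominated p p'" "dominated q q'" "idem p" "idem q" "idem p'" "idem q'"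
    and "orth p q" "orth p' q'"
  shows "dominated (p \<oplus> q) (p' \<oplus> q')"
proof -
  have c: "p \<in> carrier R" "q \<in> carrier R" "p' \<in> carrier R" "q' \<in> carrier R"
    using assms by auto
  obtain x y where xy: "x \<in> carrier R" "y \<in> carrier R" "p = x \<otimes> p' \<otimes> y"
    using assms by (auto simp: dominated_def)
  obtain z w where zw: "z \<in> carrier R" "w \<in> carrier R" "q = z \<otimes> q' \<otimes> w"
    using assms by (auto simp: dominated_def)
  let ?x = "x \<otimes> p' \<oplus> z \<otimes> q'" and ?y = "p' \<otimes> y \<oplus> q' \<otimes> w"
  have "p' \<otimes> (q' \<otimes> u) = \<zero>" "q' \<otimes> (p' \<otimes> u) = \<zero>" if "u \<in> carrier R" for u
    using assms(8) that c by (simp_all add: mult_absorb orth_def)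
  then have "?x \<otimes> (p' \<oplus> q') \<otimes> ?y = x \<otimes> p' \<otimes> y \<oplus> z \<otimes> q' \<otimes> w"
    using xy(1,2) zw(1,2) c assms by (simp add: distr_simps)
  then show ?thesis
    using xy zw c by (intro dominatedI[of _ ?x _ ?y]) auto
qed

text \<open>Left multiplication by \<open>f \<otimes> y\<close> embeds \<open>cR\<close> in
  \<open>fR\<close>, with left inverse \<open>x \<otimes> f\<close>, and \<open>f0\<close> is the
  conjugate of \<open>c0\<close> under this embedding. As \<open>x\<close> and \<open>y\<close>
  recover \<open>c0\<close> from \<open>f0\<close> and \<open>c\<close> from \<open>f\<close>, a
  proper part of \<open>c\<close> goes to a proper part of \<open>f\<close>. With
  \<open>c0 = c\<close> an embedding is realised by an idempotent below \<open>f\<close>.\<close>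

lemma dominated_transport:
  assumes "dominated c f" "idem f" "idem_le c0 c"
  obtains f0 where "idem_le f0 f" "f0 = f \<Longrightarrow> c0 = c" "dominated c0 f0" "dominated f0 c0"
proof -
  note D = idem_leD[OF assms(3)]
  have cc: "c \<in> carrier R" "c0 \<in> carrier R" "f \<in> carrier R" using D assms by auto
  obtain x y where xy: "x \<in> carrier R" "y \<in> carrier R" "c = x \<otimes> f \<otimes> y" "c \<otimes> x = x" "y \<otimes> c = y"
    using dominated_idem[OF assms(1) D(2)] assms(2) by auto
  define f0 where "f0 = f \<otimes> y \<otimes> c0 \<otimes> x \<otimes> f"
  have cxy: "x \<otimes> (f \<otimes> (y \<otimes> u)) = c \<otimes> u" if "u \<in> carrier R" for u
    using that xy cc by (metis m_assoc m_closed)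
  have cc0: "c \<otimes> (c0 \<otimes> u) = c0 \<otimes> u" "c0 \<otimes> (c \<otimes> u) = c0 \<otimes> u" if "u \<in> carrier R" for u
    using that D cc by (simp_all add: mult_absorb)
  have f0c: "f0 \<in> carrier R"
    using cc xy(1,2) by (simp add: f0_def)
  have "f0 \<otimes> f0 = f0"
    unfolding f0_def using cc xy(1,2) D assms(2) by (simp add: m_assoc cxy cc0)
  with f0c have i: "idem f0"
    by (rule idemI)
  have "f0 \<otimes> f = f0" "f \<otimes> f0 = f0"
    unfolding f0_def using cc xy(1,2) assms(2) by (simp_all add: m_assoc)
  then have le: "idem_le f0 f"
    using i assms(2) by (simp add: idem_le_def)
  have eq: "x \<otimes> f0 \<otimes> y = c0"
    unfolding f0_def using cc xy(1,2) assms(2) D cxy[of \<one>] cxy[of "c0 \<otimes> c"] 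
    by (simp add: m_assoc cxy cc0)
  have "f0 = f \<Longrightarrow> c0 = c"
    using eq xy(3) by auto
  moreover have "dominated c0 f0"
    using eq xy by (intro dominatedI[of _ x _ y]) auto
  moreover have "dominated f0 c0"
    using xy cc by (intro dominatedI[of _ "f \<otimes> y" _ "x \<otimes> f"]) (auto simp: f0_def m_assoc)
  ultimately show thesis
    using that le by blast
qed

end

section \<open>Regular rings\<close>

locale vn_regular_ring = ring +
  assumes regular: "a \<in> carrier R \<Longrightarrow> \<exists>b\<in>carrier R. a \<otimes> b \<otimes> a = a"
begin

lemma add_minus_swap:
  "\<lbrakk>x \<in> carrier R; y \<in> carrier R; z \<in> carrier R\<rbrakk> \<Longrightarrow> x \<oplus> (y \<ominus> z) = (x \<ominus> z) \<oplus> y"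
  by (simp add: minus_eq a_ac)

lemma left_unit_idem:
  assumes "a \<in> carrier R"
  obtains e b where "idem e" "b \<in> carrier R" "e = a \<otimes> b" "e \<otimes> a = a"
proof -
  obtain b where b: "b \<in> carrier R" "a \<otimes> b \<otimes> a = a"
    using regular[OF assms] by blast
  have "idem (a \<otimes> b)"
    by (rule idemI) (use assms b in \<open>simp_all flip: m_assoc\<close>)
  with b that show thesis by blast
qed

lemma right_unit_idem:
  assumes "a \<in> carrier R"
  obtains f b where "idem f" "b \<in> carrier R" "f = b \<otimes> a" "a \<otimes> f = a"
proof -
  obtain b where b: "b \<in> carrier R" "a \<otimes> b \<otimes> a = a"
    using regular[OF assms] by blast
  have "idem (b \<otimes> a)"
    by (rule idemI) (use assms b in \<open>simp_all add: m_assoc\<close>)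
  with b assms that[of "b \<otimes> a" b] show thesis by (simp add: m_assoc)
qed

lemma prin_rideal:
  assumes "a \<in> carrier R"
  obtains e b where "idem e" "a <# carrier R = rideal e" "b \<in> carrier R" "e = a \<otimes> b" "e \<otimes> a = a"
proof -
  obtain e b where e: "idem e" "b \<in> carrier R" "e = a \<otimes> b" "e \<otimes> a = a"
    using left_unit_idem[OF assms] by blast
  have "a <# carrier R \<subseteq> rideal e"
    using e assms by (auto simp: prin_iff rideal_iff mult_absorb)
  moreover have "rideal e \<subseteq> a <# carrier R"
  proof
    fix x assume "x \<in> rideal e"
    then have "x \<in> carrier R" "x = a \<otimes> (b \<otimes> x)"
      using e assms by (auto simp: rideal_iff m_assoc)
    then show "x \<in> a <# carrier R"
      using e assms by (metis prin_iff m_closed)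
  qed
  ultimately show thesis
    using e that by blast
qed

section \<open>Closure properties of the set of principal right ideals\<close>

lemma PR_rideal:
  assumes "P \<in> PR" obtains e where "idem e" "P = rideal e"
  using assms prin_rideal unfolding PR_iff by metis

text \<open>With \<open>f = b \<otimes> a\<close> and \<open>a \<otimes> f = a\<close>, the elements
  \<open>a\<close> and \<open>f\<close> have the same annihilator, and that of an idempotent is
  generated by its complement.\<close>

lemma annih_PR [simp, intro]:
  assumes "a \<in> carrier R" shows "annih a \<in> PR"
proof -
  obtain f b where f: "idem f" "b \<in> carrier R" "f = b \<otimes> a" "a \<otimes> f = a"
    using right_unit_idem[OF assms] by blast
  have "annih a = rideal (\<one> \<ominus> f)"
  proof (intro equalityI subsetI)
    fix x assume "x \<in> annih a"
    then have "x \<in> carrier R" "f \<otimes> x = \<zero>"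
      using f assms by (auto simp: annih_def m_assoc)
    then show "x \<in> rideal (\<one> \<ominus> f)"
      using f(1) by (simp add: rideal_iff distr_simps)
  next
    fix x assume "x \<in> rideal (\<one> \<ominus> f)"
    then have x: "x \<in> carrier R" "x \<ominus> f \<otimes> x = x"
      using f(1) by (auto simp: rideal_iff distr_simps)
    then have "a \<otimes> x = a \<otimes> (x \<ominus> f \<otimes> x)"
      by argo
    also have "\<dots> = a \<otimes> x \<ominus> a \<otimes> (f \<otimes> x)"
      by (rule r_distr_minus) (use x f(1) assms in auto)
    also have "\<dots> = \<zero>"
      using x f(1,4) assms by (simp add: mult_absorb)
    finally show "x \<in> annih a"
      using x by (simp add: annih_def)
  qed
  then show ?thesis
    using f(1) by simp
qed

text \<open>\<open>a \<otimes> x\<close> lies in \<open>pR\<close> exactly if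
  \<open>(1 - p) a x = 0\<close>, so a preimage is an annihilator.\<close>

lemma PR_vimage:
  assumes "P \<in> PR" "a \<in> carrier R"
  shows "{x \<in> carrier R. a \<otimes> x \<in> P} \<in> PR"
proof -
  obtain p where p: "idem p" "P = rideal p"
    using PR_rideal[OF assms(1)] .
  have "{x \<in> carrier R. a \<otimes> x \<in> P} = annih (a \<ominus> p \<otimes> a)"
    using p assms(2) by (auto simp: rideal_iff annih_def distr_simps minus_zero_iff)
  then show ?thesis
    using p assms by simp
qed

lemma PR_image:
  assumes "P \<in> PR" "a \<in> carrier R"
  shows "(\<lambda>x. a \<otimes> x) ` P \<in> PR"
proof -
  obtain p where p: "p \<in> carrier R" "P = p <# carrier R"
    using assms by (auto simp: PR_iff)
  have "(\<lambda>x. a \<otimes> x) ` P = (a \<otimes> p) <# carrier R"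
    using p assms(2) by (auto simp: l_coset_def image_iff m_assoc)
  then show ?thesis
    using p assms by simp
qed

text \<open>The intersection with \<open>pR\<close> is the image under \<open>p\<close> of the
  preimage under \<open>p\<close>, which reduces it to the two preceding closure properties.\<close>

lemma PR_Int [simp, intro]:
  assumes "P \<in> PR" "Q \<in> PR" shows "P \<inter> Q \<in> PR"
proof -
  obtain p where p: "idem p" "P = rideal p"
    using PR_rideal[OF assms(1)] .
  have "P \<inter> Q = (\<lambda>x. p \<otimes> x) ` {x \<in> carrier R. p \<otimes> x \<in> Q}"
  proof (intro equalityI subsetI)
    fix x assume "x \<in> P \<inter> Q"
    then have "x = p \<otimes> x" "x \<in> {x \<in> carrier R. p \<otimes> x \<in> Q}"
      using p by (auto simp: rideal_iff)
    then show "x \<in> (\<lambda>x. p \<otimes> x) ` {x \<in> carrier R. p \<otimes> x \<in> Q}"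
      by blast
  qed (use p in \<open>auto simp: rideal_iff\<close>)
  then show ?thesis
    using PR_image PR_vimage p(1) assms(2) by simp
qed

text \<open>Subtracting \<open>e \<otimes> b\<close> from \<open>b\<close> leaves \<open>c\<close>
  with \<open>e \<otimes> c = \<zero>\<close>. The idempotent \<open>f\<close> generating
  \<open>cR\<close> is then orthogonal to \<open>e\<close> on one side; \<open>g = f - f e\<close>
  repairs the other side and still generates \<open>cR\<close>. That \<open>g\<close> factors
  through \<open>b\<close> later yields subadditivity of the rank.\<close>

lemma set_add_prin_idem:
  assumes "idem e" "b \<in> carrier R"
  obtains g where "idem g" "orth e g" "rideal e <+> (b <# carrier R) = rideal (e \<oplus> g)" "dominated g b"
proof -
  define c where "c = b \<ominus> e \<otimes> b"
  have c: "c \<in> carrier R" "e \<otimes> c = \<zero>"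
    using assms by (simp_all add: c_def distr_simps)
  obtain f d where f: "idem f" "d \<in> carrier R" "f = c \<otimes> d" "f \<otimes> c = c"
    using left_unit_idem[OF c(1)] by blast
  define g where "g = f \<ominus> f \<otimes> e"
  have ef: "e \<otimes> f = \<zero>"
    using f c assms by (simp flip: m_assoc)
  have ef': "e \<otimes> (f \<otimes> x) = \<zero>" if "x \<in> carrier R" for x
    using ef that f(1) assms(1) by (simp add: mult_absorb)
  have gc: "g \<in> carrier R"
    using f(1) assms by (simp add: g_def)
  have g: "idem g"
    by (rule idemI) (use gc f(1) assms ef ef' in \<open>simp_all add: g_def distr_simps\<close>)
  have o: "orth e g"
    unfolding orth_def using f(1) assms ef ef' by (simp add: g_def distr_simps)
  have gcc: "g \<otimes> c = c"
    using f(1,4) assms c by (simp add: g_def distr_simps)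
  have e_g: "e \<otimes> g = \<zero>" "g \<otimes> e = \<zero>"
    using o by (auto simp: orth_def)
  have eq: "rideal e <+> (b <# carrier R) = rideal (e \<oplus> g)"
  proof (intro equalityI subsetI)
    fix x assume "x \<in> rideal e <+> (b <# carrier R)"
    then obtain y r where y: "y \<in> carrier R" "e \<otimes> y = y" "r \<in> carrier R" "x = y \<oplus> b \<otimes> r"
      using assms by (auto simp: set_add_iff rideal_iff prin_iff)
    have "b = e \<otimes> b \<oplus> c"
      using assms by (simp add: c_def add_minus_cancel)
    moreover have "(e \<oplus> g) \<otimes> (e \<otimes> b \<oplus> c) = e \<otimes> b \<oplus> c"
      using assms gc c gcc e_g by (simp add: distr_simps mult_absorb)
    ultimately have "(e \<oplus> g) \<otimes> b = b" by simp
    then have 1: "(e \<oplus> g) \<otimes> (b \<otimes> r) = b \<otimes> r"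
      using assms gc y by (simp add: mult_absorb)
    have "g \<otimes> y = g \<otimes> (e \<otimes> y)"
      using y by simp
    also have "\<dots> = \<zero>"
      using y(1) e_g(2) assms(1) gc mult_absorb[OF e_g(2), of y] by simp
    finally have "(e \<oplus> g) \<otimes> y = y"
      using y gc assms by (simp add: l_distr)
    then show "x \<in> rideal (e \<oplus> g)"
      using 1 y assms gc by (simp add: rideal_iff r_distr)
  next
    fix x assume "x \<in> rideal (e \<oplus> g)"
    then have x: "x \<in> carrier R" "x = e \<otimes> x \<oplus> g \<otimes> x"
      using assms gc by (auto simp: rideal_iff l_distr)
    let ?s = "d \<otimes> (\<one> \<ominus> e) \<otimes> x"
    have "g = c \<otimes> (d \<otimes> (\<one> \<ominus> e))"
      using f c assms by (simp add: g_def distr_simps)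
    then have gx: "g \<otimes> x = c \<otimes> ?s"
      using x(1) f c assms by (simp add: m_assoc)
    have s: "?s \<in> carrier R"
      using x(1) f(2) assms by simp
    have "g \<otimes> x = b \<otimes> ?s \<ominus> e \<otimes> (b \<otimes> ?s)"
      unfolding gx c_def using s assms by (simp add: l_distr_minus m_assoc)
    then have "x = (e \<otimes> x \<ominus> e \<otimes> (b \<otimes> ?s)) \<oplus> b \<otimes> ?s"
    proof -
      assume h: "g \<otimes> x = b \<otimes> ?s \<ominus> e \<otimes> (b \<otimes> ?s)"
      have "x = e \<otimes> x \<oplus> (b \<otimes> ?s \<ominus> e \<otimes> (b \<otimes> ?s))"
        using x(2) h by simp
      also have "\<dots> = (e \<otimes> x \<ominus> e \<otimes> (b \<otimes> ?s)) \<oplus> b \<otimes> ?s"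
        by (rule add_minus_swap) (use s x(1) assms in auto)
      finally show ?thesis .
    qed
    moreover have "e \<otimes> x \<ominus> e \<otimes> (b \<otimes> ?s) \<in> rideal e"
      using s x(1) assms by (simp add: rideal_iff r_distr_minus)
    moreover have "b \<otimes> ?s \<in> b <# carrier R"
      using s assms by (auto simp: prin_iff)
    ultimately show "x \<in> rideal e <+> (b <# carrier R)"
      unfolding set_add_iff by blast
  qed
  have "g = (\<one> \<ominus> e) \<otimes> b \<otimes> (d \<otimes> (\<one> \<ominus> e))"
    using f c assms by (simp add: g_def c_def distr_simps)
  then have "dominated g b"
    using f(2) assms by (intro dominatedI[of _ "\<one> \<ominus> e" _ "d \<otimes> (\<one> \<ominus> e)"]) auto
  then show thesis
    using that g o eq by blast
qed

lemma PR_set_add [simp, intro]: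
  assumes "P \<in> PR" "Q \<in> PR" shows "P <+> Q \<in> PR"
proof -
  obtain p where p: "idem p" "P = rideal p"
    using PR_rideal[OF assms(1)] .
  obtain b where b: "b \<in> carrier R" "Q = b <# carrier R"
    using assms by (auto simp: PR_iff)
  obtain g where "idem g" "orth p g" "rideal p <+> (b <# carrier R) = rideal (p \<oplus> g)"
    using set_add_prin_idem[OF p(1) b(1)] by blast
  then show ?thesis
    using p b orth_sum(1) rideal_PR by simp
qed

lemma relative_complement:
  assumes "P \<in> PR" "Q \<in> PR" "P \<subseteq> Q"
  obtains K where "K \<in> PR" "K \<subseteq> Q" "P \<inter> K = {\<zero>}" "P <+> K = Q"
proof -
  obtain p where p: "idem p" "P = rideal p"
    using PR_rideal[OF assms(1)] .
  let ?K = "Q \<inter> annih p"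
  have K: "?K \<in> PR"
    using assms p by simp
  have 1: "P \<inter> ?K = {\<zero>}"
  proof -
    have "x = \<zero>" if "x \<in> P" "x \<in> ?K" for x
      using that p by (simp add: rideal_iff annih_def)
    then show ?thesis
      using PR_zero K assms by blast
  qed
  have "q \<in> P <+> ?K" if "q \<in> Q" for q
  proof -
    have q: "q \<in> carrier R"
      using that assms PR_carrier by blast
    then have pq: "p \<otimes> q \<in> P"
      using p by (simp add: rideal_iff)
    then have "q \<ominus> p \<otimes> q \<in> ?K"
      using that q p assms PR_minus by (auto simp: annih_def r_distr_minus)
    moreover have "q = p \<otimes> q \<oplus> (q \<ominus> p \<otimes> q)"
      using q p by (simp add: add_minus_cancel)
    ultimately show ?thesis
      unfolding set_add_iff using pq by blast
  qed
  then have "P <+> ?K = Q"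
    using set_add_least[of P Q ?K] assms by blast
  then show thesis
    using that K 1 by blast
qed

text \<open>\<open>P + Q\<close> is completed by \<open>K\<close> to the whole ring and the unit is
  written as \<open>p + l\<close> with \<open>l\<close> in \<open>Q + K\<close>. Then
  \<open>p\<close> is the projection onto \<open>P\<close> along \<open>Q + K\<close>.\<close>

lemma disjoint_idem:
  assumes "P \<in> PR" "Q \<in> PR" "P \<inter> Q = {\<zero>}"
  obtains e where "idem e" "rideal e = P" "\<And>q. q \<in> Q \<Longrightarrow> e \<otimes> q = \<zero>"
proof -
  have PQ: "P <+> Q \<in> PR" using assms by simp
  obtain K where K: "K \<in> PR" "(P <+> Q) \<inter> K = {\<zero>}" "(P <+> Q) <+> K = carrier R"
    using relative_complement[OF PQ carrier_PR PR_subset[OF PQ]] by metis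
  let ?L = "Q <+> K"
  have L: "?L \<in> PR" using assms K by simp
  have dis: "x = \<zero>" if "x \<in> P" "x \<in> ?L" for x
  proof -
    obtain q k where qk: "q \<in> Q" "k \<in> K" "x = q \<oplus> k"
      using \<open>x \<in> ?L\<close> by (auto simp: set_add_iff)
    have c: "x \<in> carrier R" "q \<in> carrier R" "k \<in> carrier R"
      using that(1) qk assms K PR_carrier by blast+
    have k: "k = x \<ominus> q"
      using qk(3) c by (metis a_comm add_eq_iff)
    have "k \<in> P <+> Q"
      unfolding k
      by (rule PR_minus[OF PQ set_add_left[OF assms(1,2) that(1)] set_add_right[OF assms(1,2) qk(1)]])
    then have "k = \<zero>"
      using K qk by blast
    then have "x = q"
      using qk(3) c by simp
    then show ?thesis
      using qk that assms by blast
  qed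
  have "\<one> \<in> (P <+> Q) <+> K"
    using K by simp
  then obtain p q k where pqk: "p \<in> P" "q \<in> Q" "k \<in> K" "\<one> = p \<oplus> q \<oplus> k"
    by (auto simp: set_add_iff)
  have pc: "p \<in> carrier R" "q \<in> carrier R" "k \<in> carrier R"
    using pqk assms K PR_carrier by blast+
  define l where "l = q \<oplus> k"
  have l: "l \<in> ?L" "l \<in> carrier R" "\<one> = p \<oplus> l"
    using pqk pc by (auto simp: l_def set_add_iff a_assoc)
  have split: "x = p \<otimes> x \<oplus> l \<otimes> x" if "x \<in> carrier R" for x
    using that l pc by (metis l_distr l_one)
  have P: "p \<otimes> x = x" if "x \<in> P" for x
  proof -
    have x: "x \<in> carrier R"
      using that assms PR_carrier by blast
    have "l \<otimes> x = x \<ominus> p \<otimes> x"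
      using split[OF x] x l pc by (metis a_comm add_eq_iff m_closed)
    moreover have "x \<ominus> p \<otimes> x \<in> P"
      using that pqk(1) x PR_minus PR_mult assms(1) by metis
    moreover have "l \<otimes> x \<in> ?L"
      using l x L PR_mult by blast
    ultimately have "x \<ominus> p \<otimes> x = \<zero>"
      using dis by simp
    then show ?thesis
      using x pc by (simp add: minus_zero_iff)
  qed
  have ip: "idem p"
    using idemI[OF pc(1) P[OF pqk(1)]] .
  have "rideal p = P"
    using P PR_mult[OF assms(1) pqk(1)] PR_subset[OF assms(1)] by (auto simp: rideal_iff) metis
  moreover have "p \<otimes> x = \<zero>" if "x \<in> Q" for x
  proof -
    have x: "x \<in> carrier R"
      using that assms PR_carrier by blast
    have xL: "x \<in> ?L"
      using that set_add_left assms K by blast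
    have "p \<otimes> x = x \<ominus> l \<otimes> x"
      using split[OF x] x l pc by (metis add_eq_iff m_closed)
    also have "\<dots> \<in> ?L"
      using xL l x L PR_mult PR_minus by blast
    finally show ?thesis
      using dis PR_mult[OF assms(1) pqk(1) x] by blast
  qed
  ultimately show thesis
    using that ip by blast
qed

text \<open>The projection \<open>g\<close> onto \<open>P\<close> satisfies
  \<open>e \<otimes> g = g\<close>. Multiplying it by \<open>e\<close> on the right puts it below
  \<open>e\<close> and, as \<open>e\<close> fixes \<open>P\<close> and \<open>Q\<close>, changes
  neither its range nor its effect on \<open>Q\<close>.\<close>

lemma disjoint_idem_le:
  assumes "P \<in> PR" "Q \<in> PR" "P \<inter> Q = {\<zero>}" "idem e" "P \<subseteq> rideal e" "Q \<subseteq> rideal e"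
  obtains f where "idem_le f e" "rideal f = P" "\<And>q. q \<in> Q \<Longrightarrow> f \<otimes> q = \<zero>"
proof -
  obtain g where g: "idem g" "rideal g = P" "\<And>q. q \<in> Q \<Longrightarrow> g \<otimes> q = \<zero>"
    using disjoint_idem[OF assms(1-3)] by blast
  have "g \<in> P"
    using g by (auto simp: rideal_iff)
  then have eg: "e \<otimes> g = g"
    using assms(5) by (auto simp: rideal_iff)
  have i: "idem (g \<otimes> e)"
    by (rule idemI) (use g assms(4) eg in \<open>simp_all add: m_assoc mult_absorb\<close>)
  have "idem_le (g \<otimes> e) e"
    using i assms(4) g(1) eg by (simp add: idem_le_def m_assoc mult_absorb)
  moreover have "rideal (g \<otimes> e) = P"
  proof (intro equalityI subsetI)
    fix x assume "x \<in> P"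
    then have "x \<in> carrier R" "e \<otimes> x = x" "g \<otimes> x = x"
      using assms(5) g(2) by (auto simp: rideal_iff)
    then show "x \<in> rideal (g \<otimes> e)"
      using g(1) assms(4) by (simp add: rideal_iff m_assoc)
  next
    fix x assume "x \<in> rideal (g \<otimes> e)"
    then have x: "x \<in> carrier R" "x = g \<otimes> (e \<otimes> x)"
      using g(1) assms(4) by (auto simp: rideal_iff m_assoc)
    have "g \<otimes> (g \<otimes> (e \<otimes> x)) = g \<otimes> (e \<otimes> x)"
      using x(1) g(1) assms(4) by simp
    then have "g \<otimes> x = x"
      using x(2) by argo
    then show "x \<in> P"
      using x g(2) by (auto simp: rideal_iff)
  qed
  moreover have "g \<otimes> e \<otimes> q = \<zero>" if "q \<in> Q" for q
  proof -
    have "q \<in> carrier R" "e \<otimes> q = q"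
      using that assms(6) by (auto simp: rideal_iff)
    then show ?thesis
      using g that assms(4) by (simp add: m_assoc)
  qed
  ultimately show thesis
    using that by blast
qed

lemma rideal_zero_iff: "idem e \<Longrightarrow> rideal e = {\<zero>} \<longleftrightarrow> e = \<zero>"
proof
  assume "idem e" "rideal e = {\<zero>}"
  moreover have "e \<in> rideal e"
    using \<open>idem e\<close> by (simp add: rideal_iff)
  ultimately show "e = \<zero>" by blast
qed (auto simp: rideal_iff)

lemma PR_nonzero:
  assumes "P \<in> PR" "P \<noteq> {\<zero>}"
  obtains x where "x \<in> P" "x \<in> carrier R" "x \<noteq> \<zero>"
  using assms PR_carrier PR_zero by blast

text \<open>\<open>P \<inter> Q\<close> has a complement in \<open>Q\<close>, and a nonzero element
  of that complement would have a nonzero multiple in \<open>P \<inter> Q\<close> as well. Thus it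
  suffices to catch one nonzero multiple of each nonzero element.\<close>

lemma essential_PR:
  assumes "P \<in> PR" "Q \<in> PR"
    and "\<And>x. \<lbrakk>x \<in> Q; x \<noteq> \<zero>\<rbrakk> \<Longrightarrow> \<exists>s\<in>carrier R. x \<otimes> s \<noteq> \<zero> \<and> x \<otimes> s \<in> P"
  shows "Q \<subseteq> P"
proof -
  have V: "P \<inter> Q \<in> PR" "P \<inter> Q \<subseteq> Q"
    using assms by auto
  obtain K where K: "K \<in> PR" "K \<subseteq> Q" "(P \<inter> Q) \<inter> K = {\<zero>}" "(P \<inter> Q) <+> K = Q"
    using relative_complement[OF V(1) assms(2) V(2)] by metis
  have "K = {\<zero>}"
  proof (rule ccontr)
    assume "K \<noteq> {\<zero>}"
    then obtain x where x: "x \<in> K" "x \<noteq> \<zero>"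
      using PR_nonzero K(1) by metis
    then obtain s where s: "s \<in> carrier R" "x \<otimes> s \<noteq> \<zero>" "x \<otimes> s \<in> P"
      using assms(3) K(2) by blast
    have "x \<otimes> s \<in> K"
      using x s K PR_mult by blast
    then show False
      using s K by blast
  qed
  then show ?thesis
    using K(4) V(1) PR_carrier by (auto simp: set_add_iff)
qed

end

section \<open>Continuous rings\<close>

locale cont_ring = vn_regular_ring +
  assumes continuous: "continuous_ring R"
begin

section \<open>Joins, intersections and the two continuity laws\<close>

sublocale L: complete_lattice "ideal_lattice R"
  using continuous by (simp add: continuous_ring_def)

lemma L_simps [simp]:
  "carrier (ideal_lattice R) = PR" "gorder.le (ideal_lattice R) = (\<subseteq>)"
  "eq_object.eq (ideal_lattice R) = (=)"
  by (simp_all add: ideal_lattice_def)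

text \<open>The join is taken among principal right ideals. For infinite \<open>C\<close> it can
  exceed the sum of the members, so its elements are controlled only through the continuity
  laws.\<close>

definition psup :: "'a set set \<Rightarrow> 'a set"
  where "psup C = \<Squnion>\<^bsub>ideal_lattice R\<^esub> C"

lemma psup_PR [simp, intro]: "C \<subseteq> PR \<Longrightarrow> psup C \<in> PR"
  unfolding psup_def using L.sup_closed[of C] by simp

lemma psup_upper: "\<lbrakk>C \<subseteq> PR; J \<in> C\<rbrakk> \<Longrightarrow> J \<subseteq> psup C"
  unfolding psup_def using L.sup_upper[of C J] by simp

lemma psup_least: "\<lbrakk>C \<subseteq> PR; K \<in> PR; \<And>J. J \<in> C \<Longrightarrow> J \<subseteq> K\<rbrakk> \<Longrightarrow> psup C \<subseteq> K"
  unfolding psup_def using L.sup_least[of C K] by (simp add: Upper_def)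

lemma meet_eq:
  assumes "P \<in> PR" "Q \<in> PR"
  shows "P \<sqinter>\<^bsub>ideal_lattice R\<^esub> Q = P \<inter> Q"
proof (rule equalityI)
  show "P \<sqinter>\<^bsub>ideal_lattice R\<^esub> Q \<subseteq> P \<inter> Q"
    using L.meet_left[of P Q] L.meet_right[of P Q] assms by simp
  show "P \<inter> Q \<subseteq> P \<sqinter>\<^bsub>ideal_lattice R\<^esub> Q"
    using L.meet_le[of "P \<inter> Q" P Q] assms by simp
qed

lemma join_eq:
  assumes "P \<in> PR" "Q \<in> PR"
  shows "P \<squnion>\<^bsub>ideal_lattice R\<^esub> Q = P <+> Q"
proof (rule equalityI)
  show "P \<squnion>\<^bsub>ideal_lattice R\<^esub> Q \<subseteq> P <+> Q"
    using L.join_le[of P "P <+> Q" Q] assms set_add_left[OF assms] set_add_right[OF assms] by auto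
  show "P <+> Q \<subseteq> P \<squnion>\<^bsub>ideal_lattice R\<^esub> Q"
    using L.join_left[of P Q] L.join_right[of P Q] L.join_closed[of P Q] assms
    by (intro set_add_least) simp_all
qed

text \<open>For \<open>x\<close> in every member, \<open>xR\<close> is a principal lower bound and
  so lies below the infimum. Nonemptiness excludes the intersection \<open>UNIV\<close>.\<close>

lemma Inf_eq:
  assumes "C \<subseteq> PR" "C \<noteq> {}"
  shows "\<Sqinter>\<^bsub>ideal_lattice R\<^esub> C = \<Inter>C"
proof (intro equalityI subsetI)
  fix x assume "x \<in> \<Sqinter>\<^bsub>ideal_lattice R\<^esub> C"
  then show "x \<in> \<Inter>C"
    using L.inf_lower[of C] assms by auto
next
  fix x assume x: "x \<in> \<Inter>C"
  then have xc: "x \<in> carrier R"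
    using assms PR_carrier by auto
  have "x <# carrier R \<subseteq> J" if "J \<in> C" for J
    using PR_prin_subset that x assms by auto
  then have "x <# carrier R \<subseteq> \<Sqinter>\<^bsub>ideal_lattice R\<^esub> C"
    using L.inf_greatest[of C "x <# carrier R"] assms xc by (simp add: Lower_def)
  then show "x \<in> \<Sqinter>\<^bsub>ideal_lattice R\<^esub> C"
    using xc by blast
qed

lemma Inter_PR [simp, intro]:
  assumes "C \<subseteq> PR" "C \<noteq> {}"
  shows "\<Inter>C \<in> PR"
  using L.inf_closed[of C] assms Inf_eq by simp

lemma chain_PR: "subset.chain PR C \<Longrightarrow> C \<subseteq> PR"
  by (simp add: subset.chain_def)

text \<open>Upper continuity: \<open>I \<inter> psup C\<close> is the join of the ideals
  \<open>I \<inter> J\<close>, all of them zero.\<close>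

lemma disjoint_psup:
  assumes "subset.chain PR C" "I \<in> PR" "\<And>J. J \<in> C \<Longrightarrow> I \<inter> J = {\<zero>}"
  shows "I \<inter> psup C = {\<zero>}"
proof -
  note C = chain_PR[OF assms(1)]
  have "I \<sqinter>\<^bsub>ideal_lattice R\<^esub> psup C = psup ((\<lambda>J. I \<sqinter>\<^bsub>ideal_lattice R\<^esub> J) ` C)"
    unfolding psup_def using continuous assms(1,2) by (auto simp: continuous_ring_def)
  also have "(\<lambda>J. I \<sqinter>\<^bsub>ideal_lattice R\<^esub> J) ` C = (\<lambda>J. {\<zero>}) ` C"
    using meet_eq[OF assms(2)] assms(3) C by (intro image_cong) auto
  also have "psup \<dots> \<subseteq> {\<zero>}"
    by (rule psup_least) auto
  finally have "I \<inter> psup C \<subseteq> {\<zero>}"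
    using meet_eq[OF assms(2) psup_PR[OF C]] by simp
  then show ?thesis
    using PR_zero[OF assms(2)] PR_zero[OF psup_PR[OF C]] by blast
qed

lemma disjoint_psup_psup:
  assumes "subset.chain PR C" "subset.chain PR D"
    and "\<And>I J. \<lbrakk>I \<in> C; J \<in> D\<rbrakk> \<Longrightarrow> I \<inter> J = {\<zero>}"
  shows "psup C \<inter> psup D = {\<zero>}"
proof (rule disjoint_psup[OF assms(2)])
  show "psup C \<in> PR"
    using chain_PR[OF assms(1)] by blast
  fix J assume J: "J \<in> D"
  then have "J \<inter> psup C = {\<zero>}"
    by (intro disjoint_psup[OF assms(1)]) (use assms(3) chain_PR[OF assms(2)] in \<open>auto simp: Int_commute\<close>)
  then show "psup C \<inter> J = {\<zero>}" by blast
qed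

text \<open>Lower continuity: \<open>I\<close> plus the intersection of the chain is the
  intersection of the sums \<open>I + J\<close>.\<close>

lemma subset_add_Inter:
  assumes "subset.chain PR C" "C \<noteq> {}" "I \<in> PR" "K \<in> PR" "\<And>J. J \<in> C \<Longrightarrow> K \<subseteq> I <+> J"
  shows "K \<subseteq> I <+> \<Inter>C"
proof -
  note C = chain_PR[OF assms(1)]
  have "I <+> \<Inter>C = I \<squnion>\<^bsub>ideal_lattice R\<^esub> (\<Sqinter>\<^bsub>ideal_lattice R\<^esub> C)"
    using join_eq Inf_eq C assms(2,3) by simp
  also have "\<dots> = \<Sqinter>\<^bsub>ideal_lattice R\<^esub> ((\<lambda>J. I \<squnion>\<^bsub>ideal_lattice R\<^esub> J) ` C)"
    using continuous assms(1,3) by (auto simp: continuous_ring_def)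
  also have "(\<lambda>J. I \<squnion>\<^bsub>ideal_lattice R\<^esub> J) ` C = (\<lambda>J. I <+> J) ` C"
    using join_eq[OF assms(3)] C by (intro image_cong) auto
  also have "\<Sqinter>\<^bsub>ideal_lattice R\<^esub> \<dots> = \<Inter>((\<lambda>J. I <+> J) ` C)"
    using C assms(2,3) by (intro Inf_eq) auto
  finally show ?thesis
    using assms(5) by auto
qed

section \<open>Infinite families of independent copies, and direct finiteness\<close>

primrec psum :: "(nat \<Rightarrow> 'a) \<Rightarrow> nat \<Rightarrow> 'a set" where
  "psum y 0 = {\<zero>}"
| "psum y (Suc n) = psum y n <+> (y n <# carrier R)"

lemma psum_PR [simp]: "(\<And>n. y n \<in> carrier R) \<Longrightarrow> psum y n \<in> PR"
  by (induction n) auto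

lemma psum_chain:
  assumes y: "\<And>n. y n \<in> carrier R"
  shows "subset.chain PR (range (psum y))"
proof -
  have "psum y m \<subseteq> psum y n" if "m \<le> n" for m n
    by (rule lift_Suc_mono_le[OF _ that]) (use set_add_left y in auto)
  then have "psum y m \<subseteq> psum y n \<or> psum y n \<subseteq> psum y m" for m n
    by (meson nat_le_linear)
  then show ?thesis
    using y by (auto simp: subset_chain_def)
qed

lemma psum_gen:
  assumes y: "\<And>n. y n \<in> carrier R"
  shows "y n \<in> psup (range (psum y))"
proof -
  have "y n \<in> psum y (Suc n)"
    using set_add_right[of "psum y n" "y n <# carrier R" "y n"] y by auto
  moreover have "psum y (Suc n) \<subseteq> psup (range (psum y))"
    using psum_PR[of y, OF y] by (intro psup_upper rangeI) auto
  ultimately show ?thesis by blast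
qed

text \<open>
  Let \<open>B\<close> be the join of
  the copies \<open>y n R\<close>, and \<open>C\<close> the join of the \<open>(y n - y (n + 1)) R\<close>. Upper continuity gives
  that \<open>C\<close> does not meet \<open>y 0 R\<close>; lower continuity, applied to the tails \<open>D n\<close>, which have
  intersection zero and satisfy \<open>C + D n = B\<close>, gives \<open>C = B\<close>.
\<close>

lemma no_infinite_copies_idem:
  fixes x y :: "nat \<Rightarrow> 'a"
  assumes "idem e" and x: "\<And>n. x n \<in> carrier R" and y: "\<And>n. y n \<in> carrier R"
    and xy: "\<And>i j. x i \<otimes> y j = (if i = j then e else \<zero>)" and ye: "\<And>n. y n \<otimes> e = y n"
  shows "e = \<zero>"
proof -
  define z where "z n = y n \<ominus> y (Suc n)" for n
  have z: "z n \<in> carrier R" for n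
    using y by (simp add: z_def)
  let ?B = "psup (range (psum y))" and ?C = "psup (range (psum z))"
  have B: "?B \<in> PR" and C: "?C \<in> PR"
    using y z by auto
  have kill: "x i \<otimes> s = \<zero>" if "s \<in> psum y n" "n \<le> i" for s n i
    using that
  proof (induction n arbitrary: s)
    case 0
    then show ?case using x by simp
  next
    case (Suc n)
    then obtain t r where t: "t \<in> psum y n" "r \<in> carrier R" "s = t \<oplus> y n \<otimes> r"
      using y by (auto simp: set_add_iff prin_iff)
    have "t \<in> carrier R"
      using t(1) y PR_carrier psum_PR by blast
    moreover have "x i \<otimes> t = \<zero>"
      using Suc t by simp
    ultimately show ?case
      using t x y xy Suc.prems by (simp add: r_distr mult_absorb)
  qed
  \<comment> \<open>The \<open>x i\<close> act as coordinates on the finite sums.\<close>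
  have separate: "s = \<zero>" if "s \<in> psum y n" "\<And>i. x i \<otimes> s = \<zero>" for s n
    using that
  proof (induction n arbitrary: s)
    case (Suc n)
    then obtain t r where t: "t \<in> psum y n" "r \<in> carrier R" "s = t \<oplus> y n \<otimes> r"
      using y by (auto simp: set_add_iff prin_iff)
    have tc: "t \<in> carrier R"
      using t(1) y PR_carrier psum_PR by blast
    have "\<zero> = x n \<otimes> s"
      using Suc.prems by simp
    also have "\<dots> = e \<otimes> r"
      using t tc x y xy kill[OF t(1)] assms(1) by (simp add: r_distr mult_absorb)
    finally have "y n \<otimes> (e \<otimes> r) = \<zero>"
      using y[of n] by (metis r_null)
    then have "y n \<otimes> r = \<zero>"
      using ye t y assms(1) by (simp add: mult_absorb)
    then have "s = t"
      using t tc by simp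
    then show ?case
      using Suc t by blast
  qed simp
  \<comment> \<open>\<open>\<phi> n\<close> is the sum of \<open>x 0\<close> to \<open>x n\<close>.
    It sends every \<open>y j\<close> with \<open>j \<le> n\<close> to \<open>e\<close>, hence it
    annihilates the differences that generate \<open>psum z n\<close>, while \<open>y 0\<close> goes
    to \<open>e\<close>.\<close>
  define \<phi> where "\<phi> = rec_nat (x 0) (\<lambda>(n::nat) f. f \<oplus> x (Suc n))"
  have \<phi>0: "\<phi> 0 = x 0" and \<phi>S: "\<phi> (Suc n) = \<phi> n \<oplus> x (Suc n)" for n
    by (simp_all add: \<phi>_def)
  have \<phi>: "\<phi> n \<in> carrier R" for n
    by (induction n) (use x in \<open>simp_all add: \<phi>0 \<phi>S\<close>)
  have \<phi>y: "\<phi> n \<otimes> y j = (if j \<le> n then e else \<zero>)" for n j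
    by (induction n) (use x y \<phi> xy assms(1) in \<open>auto simp: \<phi>0 \<phi>S l_distr\<close>)
  have zy: "psum z n \<subseteq> psum y (Suc n)" for n
  proof (induction n)
    case 0
    then show ?case using y by (simp add: set_add_iff) (metis PR_zero PR_iff l_zero zero_closed)
  next
    case (Suc n)
    have "psum z n \<subseteq> psum y (Suc (Suc n))"
      using Suc set_add_left[of "psum y (Suc n)"] y psum_PR[of y, OF y] by (auto simp del: psum.simps simp: psum.simps(2)[of y "Suc n"])
    moreover have "z n \<in> psum y (Suc (Suc n))"
    proof -
      have P: "psum y k \<in> PR" for k
        using y by simp
      have "y n \<in> psum y (Suc n)"
        using set_add_right[OF P] y by auto
      then have "y n \<in> psum y (Suc (Suc n))"
        using set_add_left[OF P[of "Suc n"]] y by (simp del: psum.simps add: psum.simps(2)[of y "Suc n"])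
      moreover have "y (Suc n) \<in> psum y (Suc (Suc n))"
        using set_add_right[OF P[of "Suc n"]] y by (simp del: psum.simps add: psum.simps(2)[of y "Suc n"])
      ultimately show ?thesis
        unfolding z_def by (rule PR_minus[OF P])
    qed
    ultimately show ?case
      using PR_prin_subset y by (simp only: psum.simps(2)[of z]) (intro set_add_least, auto simp del: psum.simps)
  qed
  have \<phi>c: "\<phi> n \<otimes> c = \<zero>" if "c \<in> psum z n" for c n
    using that
  proof (induction n arbitrary: c)
    case 0
    then show ?case using \<phi> by simp
  next
    case (Suc n)
    then obtain t r where t: "t \<in> psum z n" "r \<in> carrier R" "c = t \<oplus> z n \<otimes> r"
      using z by (auto simp: set_add_iff prin_iff)
    have tc: "t \<in> carrier R"
      using t(1) z PR_carrier psum_PR by blast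
    have "\<phi> (Suc n) \<otimes> t = \<zero>"
      using Suc.IH[OF t(1)] kill[of t "Suc n" "Suc n"] zy t(1) tc \<phi> x by (auto simp: \<phi>S l_distr)
    moreover have "\<phi> (Suc n) \<otimes> z n = \<zero>"
      using \<phi> y \<phi>y assms(1) by (simp add: z_def r_distr_minus)
    ultimately show ?case
      using t tc \<phi> z by (simp add: r_distr mult_absorb)
  qed
  have "(y 0 <# carrier R) \<inter> ?C = {\<zero>}"
  proof (rule disjoint_psup[OF psum_chain])
    fix J assume "J \<in> range (psum z)"
    then obtain n where J: "J = psum z n" by blast
    have "a = \<zero>" if a: "a \<in> y 0 <# carrier R" "a \<in> J" for a
    proof -
      obtain r where r: "r \<in> carrier R" "a = y 0 \<otimes> r"
        using a(1) y by (auto simp: prin_iff)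
      have "\<zero> = \<phi> n \<otimes> (y 0 \<otimes> r)"
        using \<phi>c a(2) J r by auto
      also have "\<dots> = e \<otimes> r"
        using \<phi> y \<phi>y r by (simp add: mult_absorb)
      finally have "y 0 \<otimes> (e \<otimes> r) = \<zero>"
        using y[of 0] by (metis r_null)
      then show ?thesis
        using ye r y assms(1) by (simp add: mult_absorb)
    qed
    then show "(y 0 <# carrier R) \<inter> J = {\<zero>}"
      unfolding J using z y by (subst PR_Int_zero_iff) auto
  qed (use y z in auto)
  moreover have "y 0 \<in> ?C"
  proof -
    \<comment> \<open>Cutting the tail out of \<open>?B\<close> by the coordinates below
      \<open>n\<close> makes it principal, and an element of all tails has only zero coordinates, so
      \<open>separate\<close> applies to it.\<close>
    define D where "D n = {v \<in> ?B. \<forall>i<n. x i \<otimes> v = \<zero>}" for n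
    have DS: "D (Suc n) = D n \<inter> annih (x n)" for n
      using PR_carrier[OF B] by (auto simp: D_def annih_def less_Suc_eq)
    have D: "D n \<in> PR" for n
    proof (induction n)
      case 0
      then show ?case using B by (simp add: D_def)
    qed (use x in \<open>simp add: DS\<close>)
    have "D n \<subseteq> D m" if "m \<le> n" for m n
      using that by (auto simp: D_def)
    then have "D m \<subseteq> D n \<or> D n \<subseteq> D m" for m n
      by (meson nat_le_linear)
    then have chain: "subset.chain PR (range D)"
      using D by (simp add: subset_chain_def image_subset_iff)
    have yB: "y n \<in> ?B" for n
      using psum_gen y by blast
    have yD: "y n \<in> D n" for n
      using yB xy by (simp add: D_def)
    have zC: "z n \<in> ?C" for n
      using psum_gen z by blast
    \<comment> \<open>Downwards from \<open>y n\<close>, which lies in \<open>D n\<close>: each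
      \<open>y k\<close> is \<open>y (k + 1) + z k\<close>.\<close>
    have yCD: "y i \<in> ?C <+> D n" for i n
    proof (cases "i \<le> n")
      case True
      then show ?thesis
      proof (induction rule: inc_induct)
        case base
        then show ?case using set_add_right[OF C D yD] .
      next
        case (step k)
        have "z k \<in> ?C <+> D n"
          using set_add_left[OF C D zC] .
        then have "y (Suc k) \<oplus> z k \<in> ?C <+> D n"
          using PR_add[OF PR_set_add[OF C D]] step by blast
        moreover have "y (Suc k) \<oplus> z k = y k"
          using y by (simp add: z_def add_minus_cancel)
        ultimately show ?case by simp
      qed
    next
      case False
      then have "y i \<in> D n"
        using yB xy by (auto simp: D_def)
      then show ?thesis using set_add_right[OF C D] by blast
    qed
    have "psum y m \<subseteq> ?C <+> D n" for m n
    proof (induction m)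
      case 0
      then show ?case using PR_zero[OF PR_set_add[OF C D]] by simp
    next
      case (Suc m)
      then show ?case
        unfolding psum.simps
        by (intro set_add_least PR_prin_subset[OF PR_set_add[OF C D] yCD] PR_set_add[OF C D])
    qed
    then have "?B \<subseteq> ?C <+> D n" for n
      using y C D by (intro psup_least) auto
    then have "?B \<subseteq> ?C <+> \<Inter>(range D)"
      by (intro subset_add_Inter[OF chain _ C B]) auto
    moreover have "\<Inter>(range D) \<inter> ?B = {\<zero>}"
    proof (rule disjoint_psup[OF psum_chain])
      show I: "\<Inter>(range D) \<in> PR"
        using D by blast
      fix J assume "J \<in> range (psum y)"
      then obtain n where J: "J = psum y n" by blast
      have "a = \<zero>" if "a \<in> \<Inter>(range D)" "a \<in> J" for a
      proof (rule separate)
        show "a \<in> psum y n" using that J by simp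
        fix i show "x i \<otimes> a = \<zero>"
          using that(1) by (auto simp: D_def)
      qed
      then show "\<Inter>(range D) \<inter> J = {\<zero>}"
        using I J y by (subst PR_Int_zero_iff) auto
    qed (use y in auto)
    then have "\<Inter>(range D) = {\<zero>}"
      by (auto simp: D_def)
    ultimately have "?B \<subseteq> ?C <+> {\<zero>}" by simp
    then show ?thesis
      using yB[of 0] PR_carrier[OF C] by (auto simp: set_add_iff)
  qed
  ultimately have "y 0 = \<zero>"
    using y by blast
  then show ?thesis
    using xy[of 0 0] x by simp
qed

text \<open>Multiplying each \<open>y n\<close> by \<open>b \<otimes> e\<close> on the right turns
  the relations for \<open>a\<close> into those for the idempotent
  \<open>e = a \<otimes> b\<close>.\<close>

lemma no_infinite_copies:
  fixes x y :: "nat \<Rightarrow> 'a"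
  assumes a: "a \<in> carrier R" and x: "\<And>n. x n \<in> carrier R" and y: "\<And>n. y n \<in> carrier R"
    and xy: "\<And>i j. x i \<otimes> y j = (if i = j then a else \<zero>)"
  shows "a = \<zero>"
proof -
  obtain e b where e: "idem e" "b \<in> carrier R" "e = a \<otimes> b" "e \<otimes> a = a"
    using left_unit_idem[OF a] by blast
  have "e = \<zero>"
  proof (rule no_infinite_copies_idem[where x = x and y = "\<lambda>n. y n \<otimes> (b \<otimes> e)"])
    fix i j
    have "x i \<otimes> (y j \<otimes> (b \<otimes> e)) = (if i = j then a else \<zero>) \<otimes> (b \<otimes> e)"
      using x y xy e(1,2) a by (simp add: mult_absorb)
    moreover have "a \<otimes> (b \<otimes> e) = e"
      using e(1) mult_absorb[OF e(3)[symmetric] a e(2), of e] by simp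
    ultimately show "x i \<otimes> (y j \<otimes> (b \<otimes> e)) = (if i = j then e else \<zero>)"
      using e(1,2) by simp
  qed (use e x y in \<open>auto simp: m_assoc\<close>)
  then show ?thesis
    using e(4) a by simp
qed

text \<open>Jacobson's argument: for \<open>a = 1 - q p\<close> the elements
  \<open>q^i a p^j\<close> multiply like matrix units, so a nonzero \<open>a\<close> would produce
  infinitely many independent copies of \<open>aR\<close>.\<close>

lemma direct_finite:
  assumes "p \<in> carrier R" "q \<in> carrier R" "p \<otimes> q = \<one>"
  shows "q \<otimes> p = \<one>"
proof -
  define a where "a = \<one> \<ominus> q \<otimes> p"
  have a: "a \<in> carrier R" "a \<otimes> q = \<zero>" "p \<otimes> a = \<zero>" "a \<otimes> a = a"
    using assms by (simp_all add: a_def distr_simps mult_absorb)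
  have pq: "p [^] i \<otimes> q [^] (i + k) = q [^] k" "p [^] (i + k) \<otimes> q [^] i = p [^] k" for i k :: nat
  proof -
    show "p [^] i \<otimes> q [^] (i + k) = q [^] k"
    proof (induction i)
      case (Suc i)
      have "q [^] (Suc i + k) = q \<otimes> q [^] (i + k)"
        using nat_pow_Suc2[OF assms(2)] by simp
      then have "p [^] Suc i \<otimes> q [^] (Suc i + k) = p [^] i \<otimes> (p \<otimes> q) \<otimes> q [^] (i + k)"
        using assms(1,2) by (simp add: m_assoc del: add_Suc)
      then show ?case using Suc assms by simp
    qed (use assms in simp)
    show "p [^] (i + k) \<otimes> q [^] i = p [^] k"
    proof (induction i)
      case (Suc i)
      have "q [^] Suc i = q \<otimes> q [^] i"
        using nat_pow_Suc2[OF assms(2)] by simp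
      then have "p [^] (Suc i + k) \<otimes> q [^] Suc i = p [^] (i + k) \<otimes> (p \<otimes> q) \<otimes> q [^] i"
        using assms(1,2) by (simp add: m_assoc del: nat_pow_Suc add: nat_pow_Suc[of p "i + k"])
      then show ?case using Suc assms by simp
    qed (use assms in simp)
  qed
  have "a = \<zero>"
  proof (rule no_infinite_copies[where x = "\<lambda>n::nat. a \<otimes> p [^] n" and y = "\<lambda>n::nat. q [^] n \<otimes> a"])
    fix i j :: nat
    have 1: "a \<otimes> p [^] i \<otimes> (q [^] j \<otimes> a) = a \<otimes> (p [^] i \<otimes> q [^] j) \<otimes> a"
      using a assms by (simp add: m_assoc)
    consider "i = j" | k where "j = i + Suc k" | k where "i = j + Suc k"
      by (metis add_Suc_right less_imp_Suc_add linorder_neqE_nat)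
    then show "a \<otimes> p [^] i \<otimes> (q [^] j \<otimes> a) = (if i = j then a else \<zero>)"
    proof cases
      case 1
      then show ?thesis using \<open>a \<otimes> p [^] i \<otimes> (q [^] j \<otimes> a) = _\<close> pq(1)[of i 0] a by simp
    next
      case (2 k)
      have "q [^] Suc k = q \<otimes> q [^] k"
        using nat_pow_Suc2[OF assms(2)] by simp
      then have "a \<otimes> (q [^] Suc k) \<otimes> a = a \<otimes> q \<otimes> q [^] k \<otimes> a"
        using a(1) assms by (simp add: m_assoc del: nat_pow_Suc)
      then show ?thesis
        using 1 2 pq(1)[of i "Suc k"] a assms by simp
    next
      case (3 k)
      have "a \<otimes> (p [^] Suc k) \<otimes> a = a \<otimes> p [^] k \<otimes> (p \<otimes> a)"
        using a(1) assms by (simp add: m_assoc)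
      then show ?thesis
        using 1 3 pq(2)[of j "Suc k"] a assms by simp
    qed
  qed (use a assms in auto)
  then show ?thesis
    using assms by (simp add: a_def minus_zero_iff)
qed

lemma UnitsI_left: 
  assumes "p \<in> carrier R" "q \<in> carrier R" "p \<otimes> q = \<one>"
  shows "p \<in> Units R" "q \<in> Units R"
  using assms direct_finite[OF assms] by (auto simp: Units_def)

text \<open>If \<open>f = b a\<close> and \<open>a f = a\<close>, then \<open>a\<close> annihilates
  \<open>1 - f\<close>. Injectivity makes \<open>b\<close> a left inverse, and direct finiteness
  makes it two-sided.\<close>

lemma injective_Units:
  assumes "a \<in> carrier R" "\<And>u. \<lbrakk>u \<in> carrier R; a \<otimes> u = \<zero>\<rbrakk> \<Longrightarrow> u = \<zero>"
  shows "a \<in> Units R"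
proof -
  obtain f b where f: "idem f" "b \<in> carrier R" "f = b \<otimes> a" "a \<otimes> f = a"
    using right_unit_idem[OF assms(1)] by blast
  have "\<one> \<ominus> f = \<zero>"
    by (rule assms(2)) (use f(1,4) assms(1) in \<open>simp_all add: r_distr_minus\<close>)
  then have "b \<otimes> a = \<one>"
    using f by (simp add: minus_zero_iff)
  then show ?thesis
    using UnitsI_left f(2) assms(1) by blast
qed

text \<open>Finiteness of idempotents reduces to that of the ring by adding the complement.\<close>

lemma idem_le_dominated_eq:
  assumes "idem_le e f" "dominated f e"
  shows "e = f"
proof -
  note D = idem_leD[OF assms(1)]
  have "orth f (\<one> \<ominus> f)"
    using D by (simp add: orth_def distr_simps)
  moreover have "orth e (\<one> \<ominus> f)"
    using D by (simp add: orth_def distr_simps)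
  ultimately have "dominated (f \<oplus> (\<one> \<ominus> f)) (e \<oplus> (\<one> \<ominus> f))"
    using D assms(2) by (intro dominated_sum) auto
  then have d: "dominated \<one> (e \<oplus> (\<one> \<ominus> f))"
    using D by (simp add: add_minus_cancel)
  define g where "g = e \<oplus> (\<one> \<ominus> f)"
  have g: "g \<in> carrier R" "g \<otimes> (f \<ominus> e) = \<zero>"
    using D by (simp_all add: g_def distr_simps)
  obtain x y where xy: "x \<in> carrier R" "y \<in> carrier R" "\<one> = x \<otimes> g \<otimes> y"
    using d by (auto simp: dominated_def g_def)
  have "y \<otimes> (x \<otimes> g) = \<one>"
    using direct_finite[of "x \<otimes> g" y] xy g by simp
  then have "f \<ominus> e = y \<otimes> (x \<otimes> g) \<otimes> (f \<ominus> e)"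
    using D by simp
  also have "\<dots> = \<zero>"
    using xy g D by (simp add: m_assoc)
  finally show ?thesis
    using D by (simp add: minus_zero_iff)
qed

end

section \<open>Irreducibility and comparability\<close>

context ring
begin

text \<open>For central \<open>g\<close> this is the ring factor \<open>gR\<close> with unit
  \<open>g\<close>. It keeps the element type, as the decompositions excluded by
  \<open>irreducible_ring\<close> require.\<close>

definition corner :: "'a \<Rightarrow> 'a ring"
  where "corner g = \<lparr>carrier = rideal g, monoid.mult = (\<otimes>), one = g, zero = \<zero>, add = (\<oplus>)\<rparr>"

lemma corner_ring:
  assumes g: "idem g" and central: "\<And>x. x \<in> carrier R \<Longrightarrow> g \<otimes> x = x \<otimes> g"
  shows "ring (corner g)"
proof (rule ringI)
  show "abelian_group (corner g)"
  proof (rule abelian_groupI)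
    fix x assume "x \<in> carrier (corner g)"
    then have x: "x \<in> carrier R" "g \<otimes> x = x"
      by (auto simp: corner_def rideal_iff)
    show "\<exists>y\<in>carrier (corner g). y \<oplus>\<^bsub>corner g\<^esub> x = \<zero>\<^bsub>corner g\<^esub>"
      by (rule bexI[of _ "\<ominus> x"]) (use x g in \<open>auto simp: corner_def rideal_iff r_minus l_neg\<close>)
  qed (use g in \<open>auto simp: corner_def rideal_iff r_distr a_ac\<close>)
  show "Group.monoid (corner g)"
  proof (rule monoidI)
    fix x assume "x \<in> carrier (corner g)"
    then have "x \<in> carrier R" "g \<otimes> x = x"
      by (auto simp: corner_def rideal_iff)
    then show "x \<otimes>\<^bsub>corner g\<^esub> \<one>\<^bsub>corner g\<^esub> = x"
      using central by (simp add: corner_def)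
  qed (use g mult_absorb[of g] in \<open>auto simp: corner_def rideal_iff m_assoc\<close>)
qed (auto simp: corner_def rideal_iff l_distr r_distr)

lemma central_idem_decomposition:
  assumes g: "idem g" and central: "\<And>x. x \<in> carrier R \<Longrightarrow> g \<otimes> x = x \<otimes> g"
  shows "R \<simeq> RDirProd (corner g) (corner (\<one> \<ominus> g))"
proof -
  let ?h = "\<lambda>x. (g \<otimes> x, (\<one> \<ominus> g) \<otimes> x)"
  have gg: "g \<in> carrier R" using g by simp
  have mul: "g \<otimes> (x \<otimes> y) = g \<otimes> x \<otimes> (g \<otimes> y)" if "x \<in> carrier R" "y \<in> carrier R" for x y
  proof -
    have "g \<otimes> x \<otimes> (g \<otimes> y) = g \<otimes> (x \<otimes> g) \<otimes> y"
      using that gg by (simp add: m_assoc)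
    also have "\<dots> = g \<otimes> (g \<otimes> x) \<otimes> y"
      using central that by simp
    finally show ?thesis
      using that g by (simp add: m_assoc)
  qed
  have orth: "g \<otimes> ((\<one> \<ominus> g) \<otimes> y) = \<zero>" "(\<one> \<ominus> g) \<otimes> (g \<otimes> y) = \<zero>" if "y \<in> carrier R" for y
    using that g by (simp_all add: distr_simps)
  have mul': "(\<one> \<ominus> g) \<otimes> (x \<otimes> y) = (\<one> \<ominus> g) \<otimes> x \<otimes> ((\<one> \<ominus> g) \<otimes> y)"
    if "x \<in> carrier R" "y \<in> carrier R" for x y
  proof -
    have "(\<one> \<ominus> g) \<otimes> x = x \<otimes> (\<one> \<ominus> g)"
      using central[OF that(1)] that gg by (simp add: distr_simps)
    then have "(\<one> \<ominus> g) \<otimes> x \<otimes> ((\<one> \<ominus> g) \<otimes> y) = x \<otimes> ((\<one> \<ominus> g) \<otimes> ((\<one> \<ominus> g) \<otimes> y))"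
      using that gg by (simp add: m_assoc)
    also have "\<dots> = x \<otimes> (\<one> \<ominus> g) \<otimes> y"
      using that g by (simp add: m_assoc)
    finally show ?thesis
      using \<open>(\<one> \<ominus> g) \<otimes> x = x \<otimes> (\<one> \<ominus> g)\<close> that gg by (metis m_assoc minus_closed one_closed)
  qed
  have "?h \<in> ring_hom R (RDirProd (corner g) (corner (\<one> \<ominus> g)))"
  proof (rule ring_hom_memI)
    fix x assume "x \<in> carrier R"
    then show "?h x \<in> carrier (RDirProd (corner g) (corner (\<one> \<ominus> g)))"
      using g by (simp add: RDirProd_carrier corner_def rideal_iff)
  next
    fix x y assume "x \<in> carrier R" "y \<in> carrier R"
    then show "?h (x \<otimes> y) = ?h x \<otimes>\<^bsub>RDirProd (corner g) (corner (\<one> \<ominus> g))\<^esub> ?h y"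
      using mul mul' by (simp add: RDirProd_def DirProd_def monoid.defs corner_def)
  next
    fix x y assume "x \<in> carrier R" "y \<in> carrier R"
    then show "?h (x \<oplus> y) = ?h x \<oplus>\<^bsub>RDirProd (corner g) (corner (\<one> \<ominus> g))\<^esub> ?h y"
      using gg by (simp add: RDirProd_def DirProd_def monoid.defs corner_def r_distr)
  qed (use gg in \<open>simp add: RDirProd_def DirProd_def monoid.defs corner_def\<close>)
  moreover have "bij_betw ?h (carrier R) (carrier (RDirProd (corner g) (corner (\<one> \<ominus> g))))"
  proof (rule bij_betwI[where g = "\<lambda>(x, y). x \<oplus> y"])
    show "?h \<in> carrier R \<rightarrow> carrier (RDirProd (corner g) (corner (\<one> \<ominus> g)))"
      using g by (simp add: RDirProd_carrier corner_def rideal_iff)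
    show "(\<lambda>(x, y). x \<oplus> y) \<in> carrier (RDirProd (corner g) (corner (\<one> \<ominus> g))) \<rightarrow> carrier R"
      by (auto simp: RDirProd_carrier corner_def rideal_iff)
    show "(case ?h x of (x, y) \<Rightarrow> x \<oplus> y) = x" if "x \<in> carrier R" for x
      using that gg by (simp add: l_distr_minus add_minus_cancel)
  next
    fix z assume "z \<in> carrier (RDirProd (corner g) (corner (\<one> \<ominus> g)))"
    then obtain x y where z: "z = (x, y)" "x \<in> carrier R" "y \<in> carrier R"
      "g \<otimes> x = x" "(\<one> \<ominus> g) \<otimes> y = y"
      by (auto simp: RDirProd_carrier corner_def rideal_iff)
    have "g \<otimes> y = \<zero>" "(\<one> \<ominus> g) \<otimes> x = \<zero>"
      using orth[of y] orth[of x] z by simp_all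
    then show "?h (case z of (x, y) \<Rightarrow> x \<oplus> y) = z"
      using z gg by (simp add: r_distr)
  qed
  ultimately show ?thesis
    unfolding is_ring_iso_def ring_iso_def by blast
qed

end

locale irreducible_cont_ring = cont_ring +
  assumes irreducible: "irreducible_ring R"
begin

lemma one_nonzero: "\<one> \<noteq> \<zero>"
  using irreducible one_zeroD by (auto simp: irreducible_ring_def)

lemma central_idem_trivial:
  assumes g: "idem g" and central: "\<And>x. x \<in> carrier R \<Longrightarrow> g \<otimes> x = x \<otimes> g"
  shows "g = \<zero> \<or> g = \<one>"
proof (rule ccontr)
  assume A: "\<not> (g = \<zero> \<or> g = \<one>)"
  let ?g' = "\<one> \<ominus> g"
  have g': "idem ?g'" "?g' \<noteq> \<zero>"
    using g A by (auto simp: minus_zero_iff)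
  have "ring (corner g)" "ring (corner ?g')"
    using corner_ring[OF g central] corner_ring[OF g'(1)] central g by (simp_all add: distr_simps)
  moreover have "carrier (corner g) \<noteq> {\<zero>\<^bsub>corner g\<^esub>}" "carrier (corner ?g') \<noteq> {\<zero>\<^bsub>corner ?g'\<^esub>}"
    using rideal_zero_iff g g' A by (simp_all add: corner_def)
  ultimately show False
    using irreducible central_idem_decomposition[OF g central] unfolding irreducible_ring_def by blast
qed

text \<open>The right annihilator of the ideal generated by \<open>e\<close> is generated by a central idempotent.\<close>

lemma prime:
  assumes e: "e \<in> carrier R" "f \<in> carrier R" and ef: "\<And>r. r \<in> carrier R \<Longrightarrow> e \<otimes> r \<otimes> f = \<zero>"
  shows "e = \<zero> \<or> f = \<zero>"
proof -
  define I where "I = \<Inter>((\<lambda>r. annih (e \<otimes> r)) ` carrier R)"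
  \<comment> \<open>Completeness of the lattice makes this infinite intersection of annihilators
    principal.\<close>
  have "I \<in> PR"
    unfolding I_def using e by (intro Inter_PR) auto
  then obtain g where g: "idem g" "I = rideal g"
    using PR_rideal by blast
  have I_iff: "x \<in> I \<longleftrightarrow> x \<in> carrier R \<and> (\<forall>r\<in>carrier R. e \<otimes> r \<otimes> x = \<zero>)" for x
    unfolding I_def annih_def using one_closed by auto
  have gI: "g \<in> I"
    using g by (simp add: rideal_iff)
  \<comment> \<open>\<open>I\<close> is a left ideal too, so \<open>s \<otimes> g\<close> stays in
    \<open>gR\<close>.\<close>
  have lft: "g \<otimes> (s \<otimes> g) = s \<otimes> g" if s: "s \<in> carrier R" for s
  proof -
    have "s \<otimes> g \<in> I"
      unfolding I_iff
    proof (intro conjI ballI)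
      fix r assume r: "r \<in> carrier R"
      have "e \<otimes> (r \<otimes> s) \<otimes> g = \<zero>"
        using gI r s I_iff by blast
      then show "e \<otimes> r \<otimes> (s \<otimes> g) = \<zero>"
        using r s e g by (simp add: m_assoc)
    qed (use s g in simp)
    then show ?thesis
      using g(2) by (simp add: rideal_iff)
  qed
  have central: "g \<otimes> s = s \<otimes> g" if s: "s \<in> carrier R" for s
  proof -
    \<comment> \<open>By \<open>lft\<close>, \<open>(1 - g) t g = 0\<close> for every
      \<open>t\<close>, so \<open>x t x = 0\<close>. Regularity then forces \<open>x = 0\<close>,
      that is \<open>g s = g s g = s g\<close>.\<close>
    define x where "x = g \<otimes> s \<otimes> (\<one> \<ominus> g)"
    have x: "x \<in> carrier R"
      using s g by (simp add: x_def)
    obtain t where t: "t \<in> carrier R" "x \<otimes> t \<otimes> x = x"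
      using regular[OF x] by blast
    have "(\<one> \<ominus> g) \<otimes> (t \<otimes> g) = \<zero>"
      using lft[OF t(1)] t g by (simp add: distr_simps)
    then have "(\<one> \<ominus> g) \<otimes> (t \<otimes> (g \<otimes> u)) = \<zero>" if "u \<in> carrier R" for u
      using t(1) g(1) that by (metis idem_carrier l_null m_assoc m_closed minus_closed one_closed)
    then have "x \<otimes> t \<otimes> x = \<zero>"
      using s t(1) g(1) by (simp add: x_def m_assoc)
    then have "g \<otimes> s \<ominus> g \<otimes> (s \<otimes> g) = \<zero>"
      using t(2) s g(1) by (simp add: x_def distr_simps)
    then show ?thesis
      using s g lft[OF s] by (simp add: minus_zero_iff)
  qed
  have fI: "f \<in> I"
    using e ef by (simp add: I_iff)
  from central_idem_trivial[OF g(1) central] show ?thesis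
  proof
    assume "g = \<zero>"
    then show ?thesis using fI g e by (simp add: rideal_iff)
  next
    assume "g = \<one>"
    then have "e \<otimes> \<one> \<otimes> \<one> = \<zero>"
      using gI I_iff by blast
    then show ?thesis using e by simp
  qed
qed

text \<open>Equal annihilators mean that sending \<open>p r\<close> to \<open>q r\<close> is an
  isomorphism from \<open>pR\<close> to \<open>qR\<close>. Primeness supplies a nonzero
  \<open>p = e r f\<close>. With \<open>h\<close> an idempotent generating the left ideal
  \<open>Rp\<close>, \<open>q = f h\<close> has the same annihilator because
  \<open>p f = p\<close>.\<close>

lemma equivalent_elements:
  assumes "P \<in> PR" "Q \<in> PR" "P \<noteq> {\<zero>}" "Q \<noteq> {\<zero>}"
  obtains p q where "p \<in> P" "q \<in> Q" "p \<noteq> \<zero>" "q \<noteq> \<zero>"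
    "\<And>r. r \<in> carrier R \<Longrightarrow> p \<otimes> r = \<zero> \<longleftrightarrow> q \<otimes> r = \<zero>"
proof -
  obtain e where e: "idem e" "P = rideal e"
    using PR_rideal[OF assms(1)] .
  obtain f where f: "idem f" "Q = rideal f"
    using PR_rideal[OF assms(2)] .
  have "e \<noteq> \<zero>" "f \<noteq> \<zero>"
    using assms e f rideal_zero_iff by auto
  then obtain r where r: "r \<in> carrier R" "e \<otimes> r \<otimes> f \<noteq> \<zero>"
    using prime[of e f] e f by blast
  define p where "p = e \<otimes> r \<otimes> f"
  have p: "p \<in> carrier R" "p \<noteq> \<zero>" "p \<otimes> f = p" "e \<otimes> p = p"
    using e f r by (simp_all add: p_def m_assoc)
  obtain h b where h: "idem h" "b \<in> carrier R" "h = b \<otimes> p" "p \<otimes> h = p"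
    using right_unit_idem[OF p(1)] by blast
  have iff: "p \<otimes> s = \<zero> \<longleftrightarrow> f \<otimes> h \<otimes> s = \<zero>" if s: "s \<in> carrier R" for s
  proof
    assume "p \<otimes> s = \<zero>"
    then show "f \<otimes> h \<otimes> s = \<zero>"
      using h(2) p(1) f s by (simp add: h(3) m_assoc)
  next
    assume "f \<otimes> h \<otimes> s = \<zero>"
    then have "p \<otimes> (f \<otimes> (h \<otimes> s)) = \<zero>"
      using p f h(1) s by (simp add: m_assoc)
    then show "p \<otimes> s = \<zero>"
      using p(1,3) h(1,4) f s by (simp add: mult_absorb)
  qed
  show thesis
  proof (rule that[of p "f \<otimes> h"])
    show "f \<otimes> h \<noteq> \<zero>"
      using iff[of \<one>] p f h(1) by simp
  qed (use e f p h(1) iff in \<open>auto simp: rideal_iff\<close>)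
qed

text \<open>
  A principal right ideal \<open>C\<close> with \<open>C \<inter> P = C \<inter> Q = {0}\<close> is the graph of an
  isomorphism between subideals of \<open>P\<close> and \<open>Q\<close>.
\<close>

lemma graph_dominated:
  assumes "idem e" "idem f" "C \<in> PR" "C \<inter> rideal e = {\<zero>}" "rideal e \<subseteq> C <+> rideal f"
  shows "dominated e f"
proof -
  obtain g where g: "idem g" "rideal g = rideal e" "\<And>c. c \<in> C \<Longrightarrow> g \<otimes> c = \<zero>"
    using disjoint_idem[of "rideal e" C] assms(1,3,4) by (auto simp: Int_commute)
  have "e \<in> rideal e"
    using assms by (simp add: rideal_iff)
  then have "e \<in> rideal g" "e \<in> C <+> rideal f"
    using g assms by auto
  then obtain c y where cy: "c \<in> C" "y \<in> carrier R" "f \<otimes> y = y" "e = c \<oplus> y"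
    by (auto simp: set_add_iff rideal_iff)
  have "g \<otimes> e = e"
    using \<open>e \<in> rideal g\<close> by (simp add: rideal_iff)
  moreover have "g \<otimes> (c \<oplus> y) = g \<otimes> y"
    using cy(1,2) g(1,3) PR_carrier[OF assms(3)] by (simp add: r_distr)
  moreover have "g \<otimes> f \<otimes> y = g \<otimes> y"
    using m_assoc[of g f y] g(1) cy(2,3) assms(2) by simp
  ultimately have "e = g \<otimes> f \<otimes> y"
    using cy(4) by simp
  then show ?thesis
    using g(1) cy(2) by (intro dominatedI[of e g f y]) auto
qed

text \<open>If \<open>c + (p + q) r\<close> lies in \<open>P\<close>, then \<open>q r\<close> lies
  in \<open>C + P\<close>. The last two hypotheses make \<open>q r\<close> and \<open>p r\<close>
  vanish, and \<open>c\<close> is left in \<open>C \<inter> P\<close>.\<close>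

lemma graph_extend:
  assumes "C \<in> PR" "P \<in> PR" "C \<inter> P = {\<zero>}" "p \<in> P" "q \<in> carrier R"
    and q: "\<And>r. \<lbrakk>r \<in> carrier R; q \<otimes> r \<in> C <+> P\<rbrakk> \<Longrightarrow> q \<otimes> r = \<zero>"
    and qp: "\<And>r. \<lbrakk>r \<in> carrier R; q \<otimes> r = \<zero>\<rbrakk> \<Longrightarrow> p \<otimes> r = \<zero>"
  shows "(C <+> ((p \<oplus> q) <# carrier R)) \<inter> P = {\<zero>}"
proof -
  have p: "p \<in> carrier R"
    using assms PR_carrier by blast
  have "x = \<zero>" if xC: "x \<in> C <+> ((p \<oplus> q) <# carrier R)" and xP: "x \<in> P" for x
  proof -
    obtain c r where cr: "c \<in> C" "r \<in> carrier R" "x = c \<oplus> (p \<oplus> q) \<otimes> r"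
      using xC p assms(5) by (auto simp: set_add_iff prin_iff)
    have c: "c \<in> carrier R" "x \<in> carrier R"
      using cr(1) xP assms PR_carrier by blast+
    have "q \<otimes> r = \<ominus> c \<oplus> (x \<ominus> p \<otimes> r)"
      unfolding cr(3) using c(1) p assms(5) cr(2)
      by (simp add: l_distr minus_eq r_neg1 a_assoc) (simp add: a_lcomm[of "p \<otimes> r"] r_neg)
    moreover have "x \<ominus> p \<otimes> r \<in> P" "\<ominus> c \<in> C"
      using PR_minus[OF assms(2) xP PR_mult[OF assms(2,4) cr(2)]] PR_neg[OF assms(1) cr(1)] by auto
    ultimately have "q \<otimes> r \<in> C <+> P"
      unfolding set_add_iff by blast
    then have 0: "q \<otimes> r = \<zero>" "p \<otimes> r = \<zero>"
      using q qp cr by auto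
    then have "x = c"
      using cr p assms(5) c by (simp add: l_distr)
    then show ?thesis
      using xP cr assms(3) by blast
  qed
  then show ?thesis
    using p by (subst PR_Int_zero_iff) (simp_all add: assms(1,2,5))
qed

text \<open>Zorn's lemma gives a maximal \<open>C\<close> that meets both ideals trivially, in other
  words a maximal partial isomorphism in graph form. If it exhausted neither ideal, complements of
  the parts already covered would contain equivalent elements \<open>p\<close> and \<open>q\<close>,
  and adjoining \<open>p + q\<close> would enlarge \<open>C\<close>. An exhausted ideal embeds in
  the other by \<open>graph_dominated\<close>.\<close>

theorem comparability:
  assumes "idem e" "idem f"
  shows "dominated e f \<or> dominated f e"
proof -
  let ?P = "rideal e" and ?Q = "rideal f"
  have PQ: "?P \<in> PR" "?Q \<in> PR"
    using assms by auto
  define A where "A = {C \<in> PR. C \<inter> ?P = {\<zero>} \<and> C \<inter> ?Q = {\<zero>}}"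
  have "\<exists>M\<in>A. \<forall>X\<in>A. M \<subseteq> X \<longrightarrow> X = M"
  proof (rule subset_Zorn)
    fix \<C> assume c: "subset.chain A \<C>"
    then have ch: "subset.chain PR \<C>"
      by (auto simp: subset_chain_def A_def)
    have "?P \<inter> psup \<C> = {\<zero>}" "?Q \<inter> psup \<C> = {\<zero>}"
      by (rule disjoint_psup[OF ch]; use PQ c in \<open>auto simp: A_def subset_chain_def\<close>)+
    then have "psup \<C> \<in> A"
      using chain_PR[OF ch] by (auto simp: A_def)
    then show "\<exists>U\<in>A. \<forall>X\<in>\<C>. X \<subseteq> U"
      using psup_upper[OF chain_PR[OF ch]] by blast
  qed
  then obtain C where C: "C \<in> PR" "C \<inter> ?P = {\<zero>}" "C \<inter> ?Q = {\<zero>}"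
    and max: "\<And>X. \<lbrakk>X \<in> PR; X \<inter> ?P = {\<zero>}; X \<inter> ?Q = {\<zero>}; C \<subseteq> X\<rbrakk> \<Longrightarrow> X = C"
    unfolding A_def by (smt (verit) mem_Collect_eq)
  have "?P \<subseteq> C <+> ?Q \<or> ?Q \<subseteq> C <+> ?P"
  proof (rule ccontr)
    assume neg: "\<not> ?thesis"
    have I: "(C <+> ?Q) \<inter> ?P \<in> PR" "(C <+> ?P) \<inter> ?Q \<in> PR"
      using C PQ by auto
    obtain K where K: "K \<in> PR" "K \<subseteq> ?P" "(C <+> ?Q) \<inter> ?P \<inter> K = {\<zero>}" "(C <+> ?Q) \<inter> ?P <+> K = ?P"
      using relative_complement[OF I(1) PQ(1)] by blast
    obtain L where L: "L \<in> PR" "L \<subseteq> ?Q" "(C <+> ?P) \<inter> ?Q \<inter> L = {\<zero>}" "(C <+> ?P) \<inter> ?Q <+> L = ?Q"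
      using relative_complement[OF I(2) PQ(2)] by blast
    have "K \<noteq> {\<zero>}"
    proof
      assume "K = {\<zero>}"
      then have "?P \<subseteq> (C <+> ?Q) \<inter> ?P"
        using K(4) set_add_least[of "(C <+> ?Q) \<inter> ?P" "(C <+> ?Q) \<inter> ?P" K] I(1) PR_zero[OF I(1)] by simp
      then show False using neg by blast
    qed
    moreover have "L \<noteq> {\<zero>}"
    proof
      assume "L = {\<zero>}"
      then have "?Q \<subseteq> (C <+> ?P) \<inter> ?Q"
        using L(4) set_add_least[of "(C <+> ?P) \<inter> ?Q" "(C <+> ?P) \<inter> ?Q" L] I(2) PR_zero[OF I(2)] by simp
      then show False using neg by blast
    qed
    ultimately obtain p q where pq: "p \<in> K" "q \<in> L" "p \<noteq> \<zero>" "q \<noteq> \<zero>"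
      "\<And>r. r \<in> carrier R \<Longrightarrow> p \<otimes> r = \<zero> \<longleftrightarrow> q \<otimes> r = \<zero>"
      using equivalent_elements[OF K(1) L(1)] by metis
    have pqc: "p \<in> carrier R" "q \<in> carrier R" "p \<in> ?P" "q \<in> ?Q"
      using pq(1,2) K(1,2) L(1,2) PR_carrier by blast+
    let ?C = "C <+> ((p \<oplus> q) <# carrier R)"
    have "?C \<inter> ?P = {\<zero>}"
    proof (rule graph_extend[OF C(1) PQ(1) C(2) pqc(3,2)])
      fix r assume r: "r \<in> carrier R" "q \<otimes> r \<in> C <+> ?P"
      then have "q \<otimes> r \<in> L" "q \<otimes> r \<in> ?Q"
        using PR_mult[OF L(1) pq(2)] L(2) by blast+
      then show "q \<otimes> r = \<zero>" using r L(3) by blast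
    qed (use pq in blast)
    moreover have "(C <+> ((q \<oplus> p) <# carrier R)) \<inter> ?Q = {\<zero>}"
    proof (rule graph_extend[OF C(1) PQ(2) C(3) pqc(4,1)])
      fix r assume r: "r \<in> carrier R" "p \<otimes> r \<in> C <+> ?Q"
      then have "p \<otimes> r \<in> K" "p \<otimes> r \<in> ?P"
        using PR_mult[OF K(1) pq(1)] K(2) by blast+
      then show "p \<otimes> r = \<zero>" using r K(3) by blast
    qed (use pq in blast)
    ultimately have "?C = C"
      using max[of ?C] C(1) pqc set_add_left[OF C(1), of "(p \<oplus> q) <# carrier R"] by (simp add: a_comm subsetI)
    then have pqC: "p \<oplus> q \<in> C"
      using set_add_right[OF C(1), of "(p \<oplus> q) <# carrier R" "p \<oplus> q"] pqc by auto
    have "p = (p \<oplus> q) \<oplus> \<ominus> q"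
      using pqc by algebra
    moreover have "\<ominus> q \<in> ?Q"
      using pqc PR_neg PQ by blast
    ultimately have "p \<in> C <+> ?Q"
      unfolding set_add_iff using pqC by blast
    then show False
      using pq K pqc by blast
  qed
  then show ?thesis
    using graph_dominated[of e f C] graph_dominated[of f e C] C assms by blast
qed

end

section \<open>Halving\<close>

context cont_ring
begin

lemma psup_Zorn_chain:
  assumes "C \<in> Chains (relation_of lq A)" "\<And>t. t \<in> A \<Longrightarrow> F t \<in> PR"
    and "\<And>t u. lq t u \<Longrightarrow> F t \<subseteq> F u"
  shows "subset.chain PR (F ` C)"
  using assms unfolding subset_chain_def Chains_def relation_of_def by blast

text \<open>\<open>C\<close> is the graph of an isomorphism from \<open>P\<close> onto \<open>Q\<close>.\<close>

definition matched :: "'a set \<Rightarrow> ('a set \<times> 'a set \<times> 'a set) set"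
  where "matched E = {(P, Q, C). P \<in> PR \<and> Q \<in> PR \<and> C \<in> PR \<and> P \<subseteq> E \<and> Q \<subseteq> E \<and>
    P \<inter> Q = {\<zero>} \<and> C \<inter> P = {\<zero>} \<and> C \<inter> Q = {\<zero>} \<and>
    C \<subseteq> P <+> Q \<and> P \<subseteq> C <+> Q \<and> Q \<subseteq> C <+> P}"

lemma set_add_mono: "\<lbrakk>P \<subseteq> P'; Q \<subseteq> Q'\<rbrakk> \<Longrightarrow> P <+> Q \<subseteq> P' <+> Q'"
  by (rule subsetI, unfold set_add_iff, blast)

text \<open>Zorn's lemma for triples ordered componentwise. Trivial intersections survive joins of
  chains by upper continuity, as any two members lie below a common one; the inclusions survive by
  monotonicity of sums.\<close>

lemma maximal_matched:
  assumes E: "E \<in> PR"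
  obtains P Q C where "(P, Q, C) \<in> matched E"
    "\<And>P' Q' C'. \<lbrakk>(P', Q', C') \<in> matched E; P \<subseteq> P'; Q \<subseteq> Q'; C \<subseteq> C'\<rbrakk> \<Longrightarrow> P' = P"
proof -
  define lq :: "'a set \<times> 'a set \<times> 'a set \<Rightarrow> 'a set \<times> 'a set \<times> 'a set \<Rightarrow> bool"
    where "lq t u \<longleftrightarrow> fst t \<subseteq> fst u \<and> fst (snd t) \<subseteq> fst (snd u) \<and> snd (snd t) \<subseteq> snd (snd u)" for t u
  have po: "partial_order_on (matched E) (relation_of lq (matched E))"
    by (rule partial_order_on_relation_ofI) (auto simp: lq_def)
  have "\<exists>m\<in>matched E. \<forall>a\<in>matched E. lq m a \<longrightarrow> a = m"
  proof (rule predicate_Zorn[OF po])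
    fix T assume T: "T \<in> Chains (relation_of lq (matched E))"
    then have TA: "t \<in> matched E" if "t \<in> T" for t
      using that unfolding Chains_def relation_of_def by auto
    have total: "lq t u \<or> lq u t" if "t \<in> T" "u \<in> T" for t u
      using T that unfolding Chains_def relation_of_def by auto
    let ?F = "fst :: 'a set \<times> 'a set \<times> 'a set \<Rightarrow> 'a set" and ?G = "\<lambda>t::'a set \<times> 'a set \<times> 'a set. fst (snd t)" and ?H = "\<lambda>t::'a set \<times> 'a set \<times> 'a set. snd (snd t)"
    have m: "?F t \<in> PR" "?G t \<in> PR" "?H t \<in> PR" "?F t \<subseteq> E" "?G t \<subseteq> E"
      "?F t \<inter> ?G t = {\<zero>}" "?H t \<inter> ?F t = {\<zero>}" "?H t \<inter> ?G t = {\<zero>}"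
      "?H t \<subseteq> ?F t <+> ?G t" "?F t \<subseteq> ?H t <+> ?G t" "?G t \<subseteq> ?H t <+> ?F t"
      if "t \<in> matched E" for t
      using that unfolding matched_def by (simp_all add: case_prod_unfold)
    note m' = m[OF TA]
    have cF: "subset.chain PR (?F ` T)"
      by (rule psup_Zorn_chain[OF T m(1)]) (auto simp: lq_def)
    have cG: "subset.chain PR (?G ` T)"
      by (rule psup_Zorn_chain[OF T m(2)]) (auto simp: lq_def)
    have cH: "subset.chain PR (?H ` T)"
      by (rule psup_Zorn_chain[OF T m(3)]) (auto simp: lq_def)
    let ?P = "psup (?F ` T)" and ?Q = "psup (?G ` T)" and ?C = "psup (?H ` T)"
    have PR: "?P \<in> PR" "?Q \<in> PR" "?C \<in> PR"
      using chain_PR[OF cF] chain_PR[OF cG] chain_PR[OF cH] by blast+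
    have up: "?F t \<subseteq> ?P" "?G t \<subseteq> ?Q" "?H t \<subseteq> ?C" if "t \<in> T" for t
      by (intro psup_upper[OF chain_PR] cF cG cH imageI that)+
    have dis: "M \<inter> N = {\<zero>}"
      if MN: "M \<in> A ` T" "N \<in> B ` T" and that: "\<And>t u. lq t u \<Longrightarrow> A t \<subseteq> A u" "\<And>t u. lq t u \<Longrightarrow> B t \<subseteq> B u"
        "\<And>t. t \<in> T \<Longrightarrow> A t \<inter> B t = {\<zero>}" "\<And>t. t \<in> T \<Longrightarrow> A t \<in> PR" "\<And>t. t \<in> T \<Longrightarrow> B t \<in> PR"
      for A B and M N :: "'a set"
    proof -
      obtain t u where tu: "t \<in> T" "u \<in> T" "M = A t" "N = B u"
        using MN by blast
      obtain v where v: "v \<in> T" "lq t v" "lq u v"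
        using total[OF tu(1,2)] tu lq_def by blast
      then have "M \<inter> N \<subseteq> {\<zero>}"
        using tu that(1)[OF v(2)] that(2)[OF v(3)] that(3)[OF v(1)] by blast
      moreover have "\<zero> \<in> M" "\<zero> \<in> N"
        using tu that(4,5) by auto
      ultimately show ?thesis by blast
    qed
    have "?P \<inter> ?Q = {\<zero>}"
      by (rule disjoint_psup_psup[OF cF cG], erule (1) dis) (simp_all add: lq_def m'(1,2,6))
    moreover have "?C \<inter> ?P = {\<zero>}"
      by (rule disjoint_psup_psup[OF cH cF], erule (1) dis) (simp_all add: lq_def m'(1,3,7))
    moreover have "?C \<inter> ?Q = {\<zero>}"
      by (rule disjoint_psup_psup[OF cH cG], erule (1) dis) (simp_all add: lq_def m'(2,3,8))
    moreover have "?C \<subseteq> ?P <+> ?Q"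
      by (rule psup_least[OF chain_PR[OF cH] PR_set_add[OF PR(1,2)]])
        (erule imageE, hypsubst, rule order_trans[OF m'(9) set_add_mono[OF up(1) up(2)]])
    moreover have "?P \<subseteq> ?C <+> ?Q"
      by (rule psup_least[OF chain_PR[OF cF] PR_set_add[OF PR(3,2)]])
        (erule imageE, hypsubst, rule order_trans[OF m'(10) set_add_mono[OF up(3) up(2)]])
    moreover have "?Q \<subseteq> ?C <+> ?P"
      by (rule psup_least[OF chain_PR[OF cG] PR_set_add[OF PR(3,1)]])
        (erule imageE, hypsubst, rule order_trans[OF m'(11) set_add_mono[OF up(3) up(1)]])
    moreover have "?P \<subseteq> E" "?Q \<subseteq> E"
      by (rule psup_least[OF chain_PR[OF cF] E], erule imageE, simp add: m'(4))
        (rule psup_least[OF chain_PR[OF cG] E], erule imageE, simp add: m'(5))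
    ultimately have "(?P, ?Q, ?C) \<in> matched E"
      using PR by (simp add: matched_def)
    then show "\<exists>u\<in>matched E. \<forall>a\<in>T. lq a u"
      using up by (intro bexI[of _ "(?P, ?Q, ?C)"]) (auto simp: lq_def)
  qed
  then obtain P Q C where PQC: "(P, Q, C) \<in> matched E" "\<And>a. \<lbrakk>a \<in> matched E; lq (P, Q, C) a\<rbrakk> \<Longrightarrow> a = (P, Q, C)"
    by fast
  show thesis
  proof (rule that[OF PQC(1)])
    fix P' Q' C' assume "(P', Q', C') \<in> matched E" "P \<subseteq> P'" "Q \<subseteq> Q'" "C \<subseteq> C'"
    then have "(P', Q', C') = (P, Q, C)"
      by (intro PQC(2)) (auto simp: lq_def)
    then show "P' = P" by simp
  qed
qed

end

context irreducible_cont_ring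
begin

text \<open>\<open>K\<close> is independent of \<open>P + Q\<close>, and \<open>pR\<close> and
  \<open>qR\<close> are independent of each other. The matching therefore extends by pairing
  \<open>p\<close> with \<open>q\<close>, which adds \<open>p + q\<close> to the graph.\<close>

lemma extend_matched:
  assumes E: "E \<in> PR" and M: "(P, Q, C) \<in> matched E" and K: "K \<in> PR" "K \<subseteq> E" "(P <+> Q) \<inter> K = {\<zero>}"
    and pq: "p \<in> K" "q \<in> K" "(p <# carrier R) \<inter> (q <# carrier R) = {\<zero>}"
    and iff: "\<And>r. r \<in> carrier R \<Longrightarrow> p \<otimes> r = \<zero> \<longleftrightarrow> q \<otimes> r = \<zero>"
  shows "(P <+> (p <# carrier R), Q <+> (q <# carrier R), C <+> ((p \<oplus> q) <# carrier R)) \<in> matched E"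
proof -
  have m: "P \<in> PR" "Q \<in> PR" "C \<in> PR" "P \<subseteq> E" "Q \<subseteq> E" "P \<inter> Q = {\<zero>}" "C \<inter> P = {\<zero>}"
    "C \<inter> Q = {\<zero>}" "C \<subseteq> P <+> Q" "P \<subseteq> C <+> Q" "Q \<subseteq> C <+> P"
    using M by (auto simp: matched_def)
  have pc: "p \<in> carrier R" "q \<in> carrier R"
    using pq K PR_carrier by blast+
  let ?p = "p <# carrier R" and ?q = "q <# carrier R" and ?pq = "(p \<oplus> q) <# carrier R"
  have R: "?p \<in> PR" "?q \<in> PR" "?pq \<in> PR" "P <+> Q \<in> PR"
    using pc m by simp_all
  note R' = PR_set_add[OF m(1) R(1)] PR_set_add[OF m(2) R(2)] PR_set_add[OF m(3) R(3)]
  have pK: "p \<otimes> r \<in> K" "q \<otimes> r \<in> K" if "r \<in> carrier R" for r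
    using PR_mult[OF K(1)] pq that by blast+
  have pR: "p \<otimes> r \<in> ?p" "q \<otimes> r \<in> ?q" if "r \<in> carrier R" for r
    using that pc by (auto simp: prin_iff)
  have PQ: "x \<in> P <+> Q" if "x \<in> P \<or> x \<in> Q" for x
    using that set_add_left[OF m(1,2)] set_add_right[OF m(1,2)] by blast
  \<comment> \<open>Directness of the sum of \<open>P + Q\<close>, \<open>pR\<close> and
    \<open>qR\<close>; all disjointness claims below are read off from it.\<close>
  have key: "p \<otimes> r = \<zero> \<and> q \<otimes> s = \<zero> \<and> x = y"
    if "r \<in> carrier R" "s \<in> carrier R" "x \<in> P <+> Q" "y \<in> P <+> Q" "x \<oplus> p \<otimes> r = y \<oplus> q \<otimes> s" for r s x y
  proof -
    have xy: "x \<in> carrier R" "y \<in> carrier R"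
      using that(3,4) PR_carrier[OF R(4)] by blast+
    have "x \<ominus> y = q \<otimes> s \<ominus> p \<otimes> r"
    proof -
      have "x = y \<oplus> q \<otimes> s \<ominus> p \<otimes> r"
        using that xy pc by (metis add_eq_iff m_closed a_closed)
      then show ?thesis
        using that(1,2) xy pc by (simp add: minus_eq a_ac r_neg1 r_neg2)
    qed
    moreover have "x \<ominus> y \<in> P <+> Q"
      by (rule PR_minus[OF R(4) that(3,4)])
    moreover have "q \<otimes> s \<ominus> p \<otimes> r \<in> K"
      by (rule PR_minus[OF K(1) pK(2)[OF that(2)] pK(1)[OF that(1)]])
    ultimately have "x \<ominus> y = \<zero>" "q \<otimes> s \<ominus> p \<otimes> r = \<zero>"
      using K(3) by auto
    then have "x = y" "q \<otimes> s = p \<otimes> r"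
      using xy pc that(1,2) by (simp_all add: minus_zero_iff)
    then show ?thesis
      using pR(1)[OF that(1)] pR(2)[OF that(2)] pq(3) by auto
  qed
  have zPQ: "\<zero> \<in> P <+> Q"
    using PR_zero[OF R(4)] .
  have 1: "(P <+> ?p) \<inter> (Q <+> ?q) = {\<zero>}"
  proof -
    have "x = \<zero>" if x: "x \<in> P <+> ?p" "x \<in> Q <+> ?q" for x
    proof -
      obtain a r where a: "a \<in> P" "r \<in> carrier R" "x = a \<oplus> p \<otimes> r"
        using x(1) pc by (auto simp: set_add_iff prin_iff)
      obtain b s where b: "b \<in> Q" "s \<in> carrier R" "x = b \<oplus> q \<otimes> s"
        using x(2) pc by (auto simp: set_add_iff prin_iff)
      have "p \<otimes> r = \<zero> \<and> q \<otimes> s = \<zero> \<and> a = b"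
        by (rule key) (use a b PQ in auto)
      then have "a \<in> P \<inter> Q" "x = a"
        using a b(1) PR_carrier[OF m(1) a(1)] by simp_all
      then show ?thesis using m(6) by blast
    qed
    then show ?thesis using R' by (subst PR_Int_zero_iff) auto
  qed
  have CPp: "C \<inter> (P <+> ?p) = {\<zero>}"
  proof -
    have "x = \<zero>" if x: "x \<in> C" "x \<in> P <+> ?p" for x
    proof -
      obtain a r where a: "a \<in> P" "r \<in> carrier R" "x = a \<oplus> p \<otimes> r"
        using x(2) pc by (auto simp: set_add_iff prin_iff)
      have "p \<otimes> r = \<zero> \<and> q \<otimes> \<zero> = \<zero> \<and> a = x"
        by (rule key) (use a x(1) m(9) PQ pc PR_carrier[OF m(3) x(1)] in auto)
      then show ?thesis using a(1) x(1) m(7) by blast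
    qed
    then show ?thesis using R' m by (subst PR_Int_zero_iff) auto
  qed
  have CQq: "C \<inter> (Q <+> ?q) = {\<zero>}"
  proof -
    have "x = \<zero>" if x: "x \<in> C" "x \<in> Q <+> ?q" for x
    proof -
      obtain a r where a: "a \<in> Q" "r \<in> carrier R" "x = a \<oplus> q \<otimes> r"
        using x(2) pc by (auto simp: set_add_iff prin_iff)
      have "p \<otimes> \<zero> = \<zero> \<and> q \<otimes> r = \<zero> \<and> x = a"
        by (rule key) (use a x(1) m(9) PQ pc PR_carrier[OF m(3) x(1)] in auto)
      then show ?thesis using a(1) x(1) m(8) by blast
    qed
    then show ?thesis using R' m by (subst PR_Int_zero_iff) auto
  qed
  have 2: "(C <+> ?pq) \<inter> (P <+> ?p) = {\<zero>}"
  proof (rule graph_extend[OF m(3) R'(1) CPp])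
    show "p \<in> P <+> ?p"
      by (rule set_add_right[OF m(1) R(1)]) (use pc in auto)
    fix r assume r: "r \<in> carrier R" "q \<otimes> r \<in> C <+> (P <+> ?p)"
    then obtain c a s where a: "c \<in> C" "a \<in> P" "s \<in> carrier R" "q \<otimes> r = c \<oplus> (a \<oplus> p \<otimes> s)"
      using pc by (auto simp: set_add_iff prin_iff)
    have ca: "c \<oplus> a \<in> P <+> Q"
      by (rule PR_add[OF R(4)]) (use a m(9) PQ in auto)
    have "p \<otimes> s = \<zero> \<and> q \<otimes> r = \<zero> \<and> c \<oplus> a = \<zero>"
      by (rule key[OF a(3) r(1) ca zPQ])
        (use a r pc PR_carrier[OF m(3) a(1)] PR_carrier[OF m(1) a(2)] in \<open>simp add: a_assoc\<close>)
    then show "q \<otimes> r = \<zero>" by simp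
  qed (use pc iff in auto)
  have 3: "(C <+> ((q \<oplus> p) <# carrier R)) \<inter> (Q <+> ?q) = {\<zero>}"
  proof (rule graph_extend[OF m(3) R'(2) CQq])
    show "q \<in> Q <+> ?q"
      by (rule set_add_right[OF m(2) R(2)]) (use pc in auto)
    fix r assume r: "r \<in> carrier R" "p \<otimes> r \<in> C <+> (Q <+> ?q)"
    then obtain c a s where a: "c \<in> C" "a \<in> Q" "s \<in> carrier R" "p \<otimes> r = c \<oplus> (a \<oplus> q \<otimes> s)"
      using pc by (auto simp: set_add_iff prin_iff)
    have ca: "c \<oplus> a \<in> P <+> Q"
      by (rule PR_add[OF R(4)]) (use a m(9) PQ in auto)
    have "p \<otimes> r = \<zero> \<and> q \<otimes> s = \<zero> \<and> \<zero> = c \<oplus> a"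
      by (rule key[OF r(1) a(3) zPQ ca])
        (use a r pc PR_carrier[OF m(3) a(1)] PR_carrier[OF m(2) a(2)] in \<open>simp add: a_assoc\<close>)
    then show "p \<otimes> r = \<zero>" by simp
  qed (use pc iff in auto)
  have self: "p \<in> P <+> ?p" "q \<in> Q <+> ?q" "p \<oplus> q \<in> C <+> ?pq"
    using set_add_right[OF m(1) R(1)] set_add_right[OF m(2) R(2)] set_add_right[OF m(3) R(3)] pc
    by auto
  have inc: "P \<subseteq> P <+> ?p" "Q \<subseteq> Q <+> ?q" "C \<subseteq> C <+> ?pq"
    using set_add_left[OF m(1) R(1)] set_add_left[OF m(2) R(2)] set_add_left[OF m(3) R(3)] by auto
  note S = PR_set_add[OF R'(1,2)] PR_set_add[OF R'(3,2)] PR_set_add[OF R'(3,1)]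
  have 4: "C <+> ?pq \<subseteq> (P <+> ?p) <+> (Q <+> ?q)"
  proof (intro set_add_least PR_prin_subset S)
    show "C \<subseteq> (P <+> ?p) <+> (Q <+> ?q)"
      using m(9) set_add_mono[OF inc(1,2)] by blast
    show "p \<oplus> q \<in> (P <+> ?p) <+> (Q <+> ?q)"
      using self(1,2) unfolding set_add_iff[of "p \<oplus> q" "P <+> ?p"] by blast
  qed
  have 5: "P <+> ?p \<subseteq> (C <+> ?pq) <+> (Q <+> ?q)"
  proof (intro set_add_least PR_prin_subset S)
    show "P \<subseteq> (C <+> ?pq) <+> (Q <+> ?q)"
      using m(10) set_add_mono[OF inc(3,2)] by blast
    have "p = (p \<oplus> q) \<oplus> \<ominus> q"
      using pc by (simp add: a_assoc r_neg)
    then show "p \<in> (C <+> ?pq) <+> (Q <+> ?q)"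
      using self(3) PR_neg[OF R'(2) self(2)] unfolding set_add_iff[of p "C <+> ?pq"] by blast
  qed
  have 6: "Q <+> ?q \<subseteq> (C <+> ?pq) <+> (P <+> ?p)"
  proof (intro set_add_least PR_prin_subset S)
    show "Q \<subseteq> (C <+> ?pq) <+> (P <+> ?p)"
      using m(11) set_add_mono[OF inc(3,1)] by blast
    have "q = (p \<oplus> q) \<oplus> \<ominus> p"
      using pc by (simp add: a_comm[of p q] a_assoc r_neg)
    then show "q \<in> (C <+> ?pq) <+> (P <+> ?p)"
      using self(3) PR_neg[OF R'(1) self(1)] unfolding set_add_iff[of q "C <+> ?pq"] by blast
  qed
  have 7: "P <+> ?p \<subseteq> E" "Q <+> ?q \<subseteq> E"
    using set_add_least[OF m(4) PR_prin_subset[OF E] E] set_add_least[OF m(5) PR_prin_subset[OF E] E] K(2) pq(1,2)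
    by blast+
  show ?thesis
    unfolding matched_def using R' 1 2 3 4 5 6 7 pc by (simp add: a_comm)
qed

definition atomless :: bool
  where "atomless \<longleftrightarrow> (\<forall>e. idem e \<and> e \<noteq> \<zero> \<longrightarrow> (\<exists>f. idem_le f e \<and> f \<noteq> \<zero> \<and> f \<noteq> e))"

text \<open>Given a maximal matching inside \<open>eR\<close>, a nonzero complement of
  \<open>P + Q\<close> would split, in the absence of atoms, into two nonzero orthogonal parts;
  equivalent elements of these would extend the matching. So \<open>eR\<close> is the direct sum of
  \<open>P\<close> and \<open>Q\<close>, and the projection onto \<open>P\<close> along
  \<open>Q\<close> is a half of \<open>e\<close>.\<close>

lemma halving:
  assumes atomless "idem e"
  obtains f where "idem_le f e" "dominated f (e \<ominus> f)" "dominated (e \<ominus> f) f"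
proof -
  have E: "rideal e \<in> PR"
    using assms by auto
  obtain P Q C where M: "(P, Q, C) \<in> matched (rideal e)"
    and max: "\<And>P' Q' C'. \<lbrakk>(P', Q', C') \<in> matched (rideal e); P \<subseteq> P'; Q \<subseteq> Q'; C \<subseteq> C'\<rbrakk> \<Longrightarrow> P' = P"
    using maximal_matched[OF E] by blast
  have m: "P \<in> PR" "Q \<in> PR" "C \<in> PR" "P \<subseteq> rideal e" "Q \<subseteq> rideal e" "P \<inter> Q = {\<zero>}" "C \<inter> P = {\<zero>}"
    "C \<inter> Q = {\<zero>}" "C \<subseteq> P <+> Q" "P \<subseteq> C <+> Q" "Q \<subseteq> C <+> P"
    using M by (auto simp: matched_def)
  have PQ: "P <+> Q \<in> PR" "P <+> Q \<subseteq> rideal e"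
    using m set_add_least[OF m(4,5) E] by auto
  obtain K where K: "K \<in> PR" "K \<subseteq> rideal e" "(P <+> Q) \<inter> K = {\<zero>}" "(P <+> Q) <+> K = rideal e"
    using relative_complement[OF PQ(1) E PQ(2)] by blast
  obtain k where k: "idem k" "K = rideal k"
    using PR_rideal[OF K(1)] .
  have "k = \<zero>"
  proof (rule ccontr)
    assume "k \<noteq> \<zero>"
    then obtain f where f: "idem_le f k" "f \<noteq> \<zero>" "f \<noteq> k"
      using assms(1) k unfolding atomless_def by blast
    note D = idem_leD[OF f(1)] idem_le_minus[OF f(1)]
    have nz: "rideal f \<noteq> {\<zero>}" "rideal (k \<ominus> f) \<noteq> {\<zero>}"
      using f D(1,2,5) rideal_zero_iff by (auto simp: minus_zero_iff)
    obtain p q where pq: "p \<in> rideal f" "q \<in> rideal (k \<ominus> f)" "p \<noteq> \<zero>" "q \<noteq> \<zero>"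
      "\<And>r. r \<in> carrier R \<Longrightarrow> p \<otimes> r = \<zero> \<longleftrightarrow> q \<otimes> r = \<zero>"
      using equivalent_elements[OF rideal_PR[OF D(1)] rideal_PR[OF D(5)] nz] by metis
    have le: "rideal f \<subseteq> K" "rideal (k \<ominus> f) \<subseteq> K"
      using f(1) D k idem_le_iff[OF D(1,2)] idem_le_iff[OF D(5,2)] by auto
    have dis: "rideal f \<inter> rideal (k \<ominus> f) = {\<zero>}"
    proof -
      have "x = \<zero>" if "f \<otimes> x = x" "(k \<ominus> f) \<otimes> x = x" "x \<in> carrier R" for x
      proof -
        have "f \<otimes> ((k \<ominus> f) \<otimes> x) = \<zero>"
          using D(1,2,5,7) that(3) by (simp add: orth_def mult_absorb)
        then show ?thesis using that by simp
      qed
      then show ?thesis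
        using D(1,5) by (auto simp: rideal_iff)
    qed
    have pc: "p \<in> carrier R" "q \<in> carrier R"
      using pq by (auto simp: rideal_iff)
    have "(p <# carrier R) \<inter> (q <# carrier R) \<subseteq> rideal f \<inter> rideal (k \<ominus> f)"
      using PR_prin_subset[OF rideal_PR[OF D(1)] pq(1)] PR_prin_subset[OF rideal_PR[OF D(5)] pq(2)] by blast
    then have dis': "(p <# carrier R) \<inter> (q <# carrier R) = {\<zero>}"
      using dis PR_zero[OF prin_PR[OF pc(1)]] PR_zero[OF prin_PR[OF pc(2)]] by blast
    have "P <+> (p <# carrier R) = P"
    proof (rule max[OF extend_matched[OF E M K(1-3) _ _ dis' pq(5)]])
      show "P \<subseteq> P <+> (p <# carrier R)" "Q \<subseteq> Q <+> (q <# carrier R)" "C \<subseteq> C <+> ((p \<oplus> q) <# carrier R)"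
        using set_add_left[OF m(1) prin_PR[OF pc(1)]] set_add_left[OF m(2) prin_PR[OF pc(2)]]
          set_add_left[OF m(3) prin_PR, of "p \<oplus> q"] pc by auto
    qed (use pq(1,2) le in auto)
    then have "p \<in> P"
      using set_add_right[OF m(1) prin_PR[OF pc(1)] prin_self[OF pc(1)]] by simp
    then show False
      using pq(1,3) le K(3) set_add_left[OF m(1,2)] by blast
  qed
  then have "K \<subseteq> P <+> Q"
    using k rideal_zero_iff[of k] PR_zero[OF PQ(1)] by simp
  then have PQe: "P <+> Q = rideal e"
    using set_add_least[OF order_refl _ PQ(1)] K(4) PQ(2) by blast
  obtain f where f: "idem_le f e" "rideal f = P" "\<And>q. q \<in> Q \<Longrightarrow> f \<otimes> q = \<zero>"
    using disjoint_idem_le[OF m(1,2,6) assms(2) m(4,5)] by blast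
  note D = idem_leD[OF f(1)] idem_le_minus[OF f(1)]
  have Q: "rideal (e \<ominus> f) = Q"
  proof (intro equalityI subsetI)
    fix x assume "x \<in> Q"
    then have "x \<in> carrier R" "e \<otimes> x = x" "f \<otimes> x = \<zero>"
      using f m(5) by (auto simp: rideal_iff)
    then show "x \<in> rideal (e \<ominus> f)"
      using D(1,2) by (simp add: rideal_iff l_distr_minus)
  next
    fix x assume x: "x \<in> rideal (e \<ominus> f)"
    then have "x \<in> P <+> Q"
      using D idem_le_iff[OF D(5,2)] PQe by auto
    then obtain p q where pq: "p \<in> P" "q \<in> Q" "x = p \<oplus> q"
      by (auto simp: set_add_iff)
    have c: "p \<in> carrier R" "f \<otimes> p = p" "q \<in> carrier R"
      using pq f(2) PR_carrier[OF m(2)] by (auto simp: rideal_iff)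
    have xc: "x \<in> carrier R" "(e \<ominus> f) \<otimes> x = x"
      using x by (auto simp: rideal_iff)
    have "f \<otimes> ((e \<ominus> f) \<otimes> x) = \<zero>"
      using D xc(1) by (simp add: orth_def mult_absorb)
    then have "f \<otimes> x = \<zero>"
      using xc(2) by simp
    moreover have "f \<otimes> x = p"
      unfolding pq(3) using c D(1) f(3)[OF pq(2)] by (simp add: r_distr)
    ultimately have "p = \<zero>" by simp
    then show "x \<in> Q"
      using pq(2,3) c(3) by simp
  qed
  have "dominated f (e \<ominus> f)"
    by (rule graph_dominated[of _ _ C]) (use D m Q f in auto)
  moreover have "dominated (e \<ominus> f) f"
    by (rule graph_dominated[of _ _ C]) (use D m Q f in auto)
  ultimately show thesis
    using that f(1) by blast
qed

end

section \<open>Existence of a rank function\<close>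

context ring
begin

text \<open>Mutual embedding stands in for isomorphism of \<open>aR\<close> and \<open>bR\<close>:
  it is compatible with orthogonal sums and already forces equal rank.\<close>

definition equiv :: "'a \<Rightarrow> 'a \<Rightarrow> bool"
  where "equiv a b \<longleftrightarrow> dominated a b \<and> dominated b a"

lemma equiv_refl [simp]: "a \<in> carrier R \<Longrightarrow> equiv a a"
  by (simp add: equiv_def)

lemma equiv_sym: "equiv a b \<Longrightarrow> equiv b a"
  by (simp add: equiv_def)

lemma equiv_trans:
  "\<lbrakk>equiv a b; equiv b c; a \<in> carrier R; c \<in> carrier R\<rbrakk> \<Longrightarrow> equiv a c"
  unfolding equiv_def using dominated_trans by blast

lemma equiv_sum:
  assumes "equiv p p'" "equiv q q'" "idem p" "idem q" "idem p'" "idem q'" "orth p q" "orth p' q'"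
  shows "equiv (p \<oplus> q) (p' \<oplus> q')"
  using assms dominated_sum unfolding equiv_def by blast

section \<open>Scales of equivalent steps, and counting on them\<close>

lemma idem_le_minus_split:
  assumes "idem_le a b" "idem_le b c"
  shows "orth (b \<ominus> a) (c \<ominus> b)" "(b \<ominus> a) \<oplus> (c \<ominus> b) = c \<ominus> a"
proof -
  have "orth b (c \<ominus> b)"
    using idem_le_minus[OF assms(2)] by blast
  then show "orth (b \<ominus> a) (c \<ominus> b)"
    using orth_le idem_le_minus[OF assms(1)] idem_le_minus[OF assms(2)] idem_le_refl by blast
  show "(b \<ominus> a) \<oplus> (c \<ominus> b) = c \<ominus> a"
  proof -
    have c: "a \<in> carrier R" "b \<in> carrier R" "c \<in> carrier R"
      using idem_leD[OF assms(1)] idem_leD[OF assms(2)] by auto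
    then have "(c \<ominus> b) \<oplus> (b \<ominus> a) = c \<ominus> a"
      by (simp add: minus_eq a_assoc r_neg1)
    then show ?thesis
      using c by (simp add: a_comm)
  qed
qed

text \<open>A ruler from \<open>\<zero>\<close> to \<open>f\<close>: \<open>c k\<close> stands for
  \<open>k\<close> steps of the size of \<open>h\<close>.\<close>

definition scale :: "(nat \<Rightarrow> 'a) \<Rightarrow> nat \<Rightarrow> 'a \<Rightarrow> 'a \<Rightarrow> bool"
  where "scale c M h f \<longleftrightarrow> idem h \<and> c 0 = \<zero> \<and> c M = f \<and>
    (\<forall>k<M. idem_le (c k) (c (Suc k)) \<and> equiv (c (Suc k) \<ominus> c k) h)"

text \<open>The size of \<open>a\<close> in steps of the scale, rounded down. On a scale the maximum
  exists because \<open>c 0 = \<zero>\<close> always qualifies.\<close>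

definition count :: "(nat \<Rightarrow> 'a) \<Rightarrow> nat \<Rightarrow> 'a \<Rightarrow> nat"
  where "count c M a = Max {k. k \<le> M \<and> dominated (c k) a}"

lemma scale_le:
  assumes "scale c M h f" "idem f" "j \<le> k" "k \<le> M"
  shows "idem_le (c j) (c k)"
  using assms(3,4)
proof (induction k)
  case 0
  then show ?case using assms(1) by (simp add: scale_def)
next
  case (Suc k)
  have "idem_le (c k) (c (Suc k))"
    using Suc assms(1) by (simp add: scale_def)
  then show ?case
    using Suc idem_le_trans idem_leD(2) idem_le_refl by (metis Suc_leD le_Suc_eq)
qed

lemma scale_idem:
  assumes "scale c M h f" "idem f" "k \<le> M"
  shows "idem (c k)"
  using scale_le[OF assms(1,2) order_refl assms(3)] idem_leD by blast

text \<open>Equivalent orthogonal steps add up, so a block of steps can be moved along the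
  scale.\<close>

lemma scale_shift:
  assumes "scale c M h f" "idem f" "i + l \<le> M" "j + l \<le> M"
  shows "equiv (c (i + l) \<ominus> c i) (c (j + l) \<ominus> c j)"
  using assms(3,4)
proof (induction l)
  case 0
  then show ?case
    using scale_idem[OF assms(1,2)] by simp
next
  case (Suc l)
  have le: "idem_le (c i) (c (i + l))" "idem_le (c j) (c (j + l))"
    "idem_le (c (i + l)) (c (Suc (i + l)))" "idem_le (c (j + l)) (c (Suc (j + l)))"
    using Suc scale_le[OF assms(1,2)] by auto
  have h: "equiv (c (Suc (i + l)) \<ominus> c (i + l)) h" "equiv (c (Suc (j + l)) \<ominus> c (j + l)) h"
    using Suc assms(1) by (auto simp: scale_def)
  have "equiv (c (Suc (i + l)) \<ominus> c (i + l)) (c (Suc (j + l)) \<ominus> c (j + l))"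
    using equiv_trans[OF h(1) equiv_sym[OF h(2)]] idem_le_minus(1)[OF le(3)] idem_le_minus(1)[OF le(4)]
    by blast
  moreover have "equiv (c (i + l) \<ominus> c i) (c (j + l) \<ominus> c j)"
    using Suc by simp
  ultimately have "equiv ((c (i + l) \<ominus> c i) \<oplus> (c (Suc (i + l)) \<ominus> c (i + l)))
    ((c (j + l) \<ominus> c j) \<oplus> (c (Suc (j + l)) \<ominus> c (j + l)))"
    using idem_le_minus(1) idem_le_minus_split(1) le by (intro equiv_sum)
  then show ?case
    using idem_le_minus_split(2) le by simp
qed

lemma scale_shift_zero:
  assumes "scale c M h f" "idem f" "j + l \<le> M"
  shows "equiv (c l) (c (j + l) \<ominus> c j)"
  using scale_shift[OF assms(1,2), of 0 l j] assms scale_idem[OF assms(1,2), of l]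
  by (simp add: scale_def)

lemma count_props:
  assumes "scale c M h f" "a \<in> carrier R"
  shows "count c M a \<le> M" "dominated (c (count c M a)) a"
    "\<And>k. \<lbrakk>k \<le> M; dominated (c k) a\<rbrakk> \<Longrightarrow> k \<le> count c M a"
proof -
  let ?S = "{k. k \<le> M \<and> dominated (c k) a}"
  have S: "finite ?S" "0 \<in> ?S"
    using assms by (auto simp: scale_def intro: finite_subset[of _ "{..M}"])
  then have "count c M a \<in> ?S"
    unfolding count_def using Max_in by blast
  then show "count c M a \<le> M" "dominated (c (count c M a)) a" by auto
  show "k \<le> count c M a" if "k \<le> M" "dominated (c k) a" for k
    unfolding count_def using S that by (intro Max_ge) auto
qed

end

context cont_ring
begin

text \<open>The factorizations of \<open>a\<close> through the \<open>g n\<close> supply the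
  \<open>x n\<close> and \<open>y n\<close> of \<open>no_infinite_copies\<close>; orthogonality
  makes the mixed products vanish.\<close>

lemma no_infinite_orth:
  fixes g :: "nat \<Rightarrow> 'a"
  assumes "a \<in> carrier R" and g: "\<And>n. idem (g n)" and orth: "\<And>i j. i < j \<Longrightarrow> orth (g i) (g j)"
    and dom: "\<And>n. dominated a (g n)"
  shows "a = \<zero>"
proof -
  have "\<exists>x y. x \<in> carrier R \<and> y \<in> carrier R \<and> a = x \<otimes> g n \<otimes> y" for n
    using dom[of n] by (auto simp: dominated_def)
  then obtain x y where xy: "\<And>n. x n \<in> carrier R" "\<And>n. y n \<in> carrier R" "\<And>n. a = x n \<otimes> g n \<otimes> y n"
    by metis
  have gc: "g n \<in> carrier R" for n using g by blast
  show ?thesis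
  proof (rule no_infinite_copies[where x = "\<lambda>n. x n \<otimes> g n" and y = "\<lambda>n. g n \<otimes> y n"])
    fix i j
    have "g i \<otimes> g j = (if i = j then g i else \<zero>)"
      using orth[of i j] orth[of j i] g by (auto simp: orth_def) (metis linorder_neqE_nat)
    then have "x i \<otimes> (g i \<otimes> g j) \<otimes> y j = (if i = j then a else \<zero>)"
      using xy gc by simp
    then show "x i \<otimes> g i \<otimes> (g j \<otimes> y j) = (if i = j then a else \<zero>)"
      using xy(1,2) gc by (simp add: m_assoc)
  qed (use assms(1) xy gc in auto)
qed

text \<open>By direct finiteness \<open>c k\<close> and \<open>c l\<close> would coincide, so the
  step after \<open>c k\<close> would vanish although it is equivalent to \<open>h\<close>.\<close>

lemma scale_strict:
  assumes c: "scale c M h f" "idem f" "h \<noteq> \<zero>" "k < l" "l \<le> M"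
  shows "\<not> dominated (c l) (c k)"
proof
  assume "dominated (c l) (c k)"
  then have eq: "c k = c l"
    using idem_le_dominated_eq[OF scale_le[OF c(1,2)]] c(4,5) by simp
  have "idem_le (c k) (c (Suc k))" "idem_le (c (Suc k)) (c k)"
    using scale_le[OF c(1,2), of k "Suc k"] scale_le[OF c(1,2), of "Suc k" l] c(4,5) eq by auto
  then have "c (Suc k) = c k" "c k \<in> carrier R"
    using idem_le_antisym idem_leD(1) by auto
  moreover have "equiv (c (Suc k) \<ominus> c k) h"
    using c by (simp add: scale_def)
  ultimately have "dominated h \<zero>"
    by (simp add: equiv_def)
  then show False
    using dominated_zero_right c(3) by blast
qed

lemma count_one:
  assumes "scale c M h \<one>"
  shows "count c M \<one> = M"
proof -
  have "c M = \<one>" "c 0 = \<zero>"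
    using assms by (auto simp: scale_def)
  then show ?thesis
    using count_props[OF assms one_closed] by (metis dominated_refl one_closed order_antisym order_refl)
qed

lemma count_mono:
  assumes "scale c M h f" "idem f" "dominated a b" "a \<in> carrier R" "b \<in> carrier R"
  shows "count c M a \<le> count c M b"
proof -
  show ?thesis
    using count_props(3)[OF assms(1) assms(5) count_props(1)[OF assms(1) assms(4)]]
      dominated_trans[OF count_props(2)[OF assms(1) assms(4)] assms(3,5)] by blast
qed

lemma count_superadditive:
  assumes c: "scale c M h \<one>" "h \<noteq> \<zero>" and ef: "idem e" "idem f" "orth e f"
  shows "count c M e + count c M f \<le> count c M (e \<oplus> f)"
proof -
  have c0: "c 0 = \<zero>" "c M = \<one>" using c by (auto simp: scale_def)
  define k l where "k = count c M e" and "l = count c M f"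
  have k: "k \<le> M" "dominated (c k) e" and l: "l \<le> M" "dominated (c l) f"
    using count_props[OF c(1)] ef by (auto simp: k_def l_def)
  note le = scale_le[OF c(1) idem_one] and id = scale_idem[OF c(1) idem_one]
  have efc: "e \<oplus> f \<in> carrier R" using ef by simp
  have part: "dominated (c (k + m)) (e \<oplus> f')"
    if "k + m \<le> M" "dominated (c m) f'" "idem f'" "orth e f'" for m f'
  proof -
    have kle: "idem_le (c k) (c (k + m))"
      using le that(1) by simp
    have "dominated (c (k + m) \<ominus> c k) f'"
      using scale_shift_zero[OF c(1) idem_one that(1)] that(2,3) dominated_trans
      unfolding equiv_def by blast
    then have "dominated (c k \<oplus> (c (k + m) \<ominus> c k)) (e \<oplus> f')"
      using k(2) idem_le_minus[OF kle] idem_leD(1)[OF kle] ef(1) that(3,4)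
      by (intro dominated_sum)
    then show ?thesis
      using idem_le_minus(5)[OF kle] by simp
  qed
  \<comment> \<open>The two counts cannot overrun the scale. Otherwise \<open>M - k < l\<close>
    steps already fit into a proper part \<open>f0\<close> of \<open>f\<close>, so
    \<open>\<one>\<close> embeds in \<open>e + f0\<close>; by finiteness
    \<open>e + f0 = \<one>\<close>, which leaves no room for the rest of \<open>f\<close>.\<close>
  have "k + l \<le> M"
  proof (rule ccontr)
    assume "\<not> k + l \<le> M"
    then have m: "M - k < l" "k + (M - k) \<le> M" "k + (M - k) = M"
      using k by auto
    have "idem_le (c (M - k)) (c l)" "c (M - k) \<noteq> c l"
      using le l m scale_strict[OF c(1) idem_one c(2) m(1) l(1)] id[of l]
      by (auto dest: dominated_refl[OF idem_carrier])
    then obtain f0 where f0: "idem_le f0 f" "f0 \<noteq> f" "dominated (c (M - k)) f0"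
      using dominated_transport[OF l(2) ef(2)] by metis
    have o: "orth e f0"
      using orth_le[OF ef(3) idem_le_refl[OF ef(1)] f0(1)] .
    have "dominated \<one> (e \<oplus> f0)"
      using part[OF m(2) f0(3) idem_leD(1)[OF f0(1)] o] m(3) c0(2) by simp
    then have 1: "e \<oplus> f0 = \<one>"
      using idem_le_dominated_eq idem_le_one orth_sum(1)[OF ef(1) idem_leD(1)[OF f0(1)] o] by blast
    have "(e \<oplus> f0) \<otimes> (f \<ominus> f0) = \<zero>"
      using ef o idem_leD[OF f0(1)] by (simp add: distr_simps orth_def)
    then have "f \<ominus> f0 = \<zero>"
      unfolding 1 using ef idem_leD[OF f0(1)] by simp
    then show False
      using f0 ef idem_leD(1)[OF f0(1)] by (auto simp: minus_zero_iff)
  qed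
  then show ?thesis
    using count_props(3)[OF c(1) efc] part[OF _ l(2) ef(2,3)] by (simp add: k_def l_def)
qed

lemma scale_dominated_sum:
  assumes c: "scale c M h g" "idem g" and ef: "idem e" "idem f" "orth e f"
    and d: "dominated e (c k)" "dominated f (c l)" "k + l \<le> M"
  shows "dominated (e \<oplus> f) (c (k + l))"
proof -
  have kle: "idem_le (c k) (c (k + l))"
    using scale_le[OF c] d by simp
  have "dominated f (c (k + l) \<ominus> c k)"
    using scale_shift_zero[OF c d(3)] d(2) dominated_trans idem_le_minus(1)[OF kle]
    unfolding equiv_def by blast
  then have "dominated (e \<oplus> f) (c k \<oplus> (c (k + l) \<ominus> c k))"
    using d(1) idem_le_minus[OF kle] idem_leD(1)[OF kle] ef
    by (intro dominated_sum)
  then show ?thesis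
    using idem_le_minus(5)[OF kle] by simp
qed

end

context irreducible_cont_ring
begin

lemma count_subadditive:
  assumes c: "scale c M h \<one>" "h \<noteq> \<zero>" and ef: "idem e" "idem f" "orth e f"
  shows "count c M (e \<oplus> f) \<le> count c M e + count c M f + 2"
proof (rule ccontr)
  have c0: "c 0 = \<zero>" "c M = \<one>" using c by (auto simp: scale_def)
  note id = scale_idem[OF c(1) idem_one]
  have efc: "e \<oplus> f \<in> carrier R" using ef by simp
  \<comment> \<open>One step more than the count no longer fits, so by comparability
    \<open>e\<close> and \<open>f\<close> embed in \<open>c k\<close> and \<open>c l\<close>. The
    two roundings account for the 2.\<close>
  define k l where "k = Suc (count c M e)" and "l = Suc (count c M f)"
  assume "\<not> ?thesis"
  then have big: "k + l < count c M (e \<oplus> f)" by (simp add: k_def l_def)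
  then have kl: "k + l < M"
    using count_props(1)[OF c(1) efc] by simp
  have "\<not> dominated (c k) e" "\<not> dominated (c l) f"
    using count_props(3)[OF c(1), of e k] count_props(3)[OF c(1), of f l] kl ef
    by (auto simp: k_def l_def)
  then have "dominated e (c k)" "dominated f (c l)"
    using comparability[of e "c k"] comparability[of f "c l"] id ef kl by auto
  then have "dominated (e \<oplus> f) (c (k + l))"
    using scale_dominated_sum[OF c(1) idem_one ef] kl by simp
  then have "dominated (c (count c M (e \<oplus> f))) (c (k + l))"
    using dominated_trans[OF count_props(2)[OF c(1) efc] _ idem_carrier[OF id]] kl by simp
  then show False
    using scale_strict[OF c(1) idem_one c(2) big count_props(1)[OF c(1) efc]] by blast
qed

section \<open>Rank by exact counting in the presence of an atom\<close>

definition atom :: "'a \<Rightarrow> bool"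
  where "atom h \<longleftrightarrow> idem h \<and> h \<noteq> \<zero> \<and> (\<forall>g. idem_le g h \<longrightarrow> g = \<zero> \<or> g = h)"

lemma atomless_iff: "atomless \<longleftrightarrow> \<not> (\<exists>h. atom h)"
  by (auto simp: atomless_def atom_def)

text \<open>By comparability the alternative is that \<open>e\<close> embeds in the atom, and a
  nonzero image there is the whole atom.\<close>

lemma atom_dominated:
  assumes h: "atom h" and e: "idem e" "e \<noteq> \<zero>"
  shows "dominated h e"
proof (rule ccontr)
  assume "\<not> dominated h e"
  then have "dominated e h"
    using comparability[of h e] h e by (auto simp: atom_def)
  then obtain g where g: "idem_le g h" "dominated e g" "dominated g e"
    using dominated_transport[of e h e] h e by (metis atom_def idem_le_refl)
  then have "g = h"
    using h e dominated_zero_right by (auto simp: atom_def)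
  then show False using g \<open>\<not> dominated h e\<close> by simp
qed

text \<open>Copies of \<open>h\<close> are split off from the complement of what is already covered.
  The process reaches \<open>\<one>\<close> because infinitely many orthogonal copies of
  \<open>h\<close> are impossible.\<close>

lemma atom_scale:
  assumes h: "atom h"
  obtains c M where "scale c M h \<one>"
proof -
  have hi: "idem h" "h \<noteq> \<zero>" using h by (auto simp: atom_def)
  have ex: "\<exists>g. e \<noteq> \<one> \<longrightarrow> idem_le g (\<one> \<ominus> e) \<and> equiv g h" if "idem e" for e
  proof (cases "e = \<one>")
    case False
    then have "\<one> \<ominus> e \<noteq> \<zero>"
      using that by (auto simp: minus_zero_iff)
    then have d: "dominated h (\<one> \<ominus> e)"
      using atom_dominated[OF h idem_compl[OF that]] by simp
    note i = idem_compl[OF that]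
    obtain g where "idem_le g (\<one> \<ominus> e)" "dominated h g" "dominated g h"
      using dominated_transport[OF d i idem_le_refl[OF hi(1)]] by blast
    then show ?thesis by (auto simp: equiv_def)
  qed auto
  define G where "G e = (SOME g. e \<noteq> \<one> \<longrightarrow> idem_le g (\<one> \<ominus> e) \<and> equiv g h)" for e
  have G: "idem_le (G e) (\<one> \<ominus> e)" "equiv (G e) h" if "idem e" "e \<noteq> \<one>" for e
    using someI_ex[OF ex[OF that(1)]] that(2) by (auto simp: G_def)
  define c where "c = rec_nat \<zero> (\<lambda>(n::nat) e. if e = \<one> then \<one> else e \<oplus> G e)"
  have c0: "c 0 = \<zero>" and cS: "c (Suc n) = (if c n = \<one> then \<one> else c n \<oplus> G (c n))" for n
    by (simp_all add: c_def)
  have step: "idem (e \<oplus> G e)" "idem_le e (e \<oplus> G e)" "(e \<oplus> G e) \<ominus> e = G e" "idem (G e)" "orth e (G e)"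
    if "idem e" "e \<noteq> \<one>" for e
  proof -
    have o: "orth e (G e)"
      using orth_le[OF idem_le_minus(3)[OF idem_le_one[OF that(1)]] idem_le_refl[OF that(1)] G(1)[OF that]] .
    have g: "idem (G e)"
      using idem_leD(1)[OF G(1)[OF that]] .
    show "idem (e \<oplus> G e)" "idem_le e (e \<oplus> G e)" "idem (G e)" "orth e (G e)"
      using orth_sum[OF that(1) g o] g o by auto
    show "(e \<oplus> G e) \<ominus> e = G e"
      using that g by (metis a_comm add_eq_iff a_closed idem_carrier)
  qed
  have c: "idem (c n)" for n
    by (induction n) (use step in \<open>auto simp: c0 cS\<close>)
  have cle: "idem_le (c n) (c (Suc n))" for n
    using step(2)[OF c] c by (auto simp: cS)
  have cmono: "idem_le (c m) (c n)" if "m \<le> n" for m n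
    using that
  proof (induction n)
    case (Suc n)
    then show ?case using cle idem_le_trans c idem_le_refl by (metis le_Suc_eq)
  qed (use c0 in simp)
  have "\<exists>n. c n = \<one>"
  proof (rule ccontr)
    assume "\<nexists>n. c n = \<one>"
    then have ne: "c n \<noteq> \<one>" for n by blast
    have "h = \<zero>"
    proof (rule no_infinite_orth[where g = "\<lambda>n. G (c n)"])
      fix i j :: nat assume "i < j"
      then have "idem_le (c (Suc i)) (c j)"
        using cmono by simp
      moreover have "idem_le (G (c i)) (c (Suc i))"
        using orth_sum(3)[OF c step(4)[OF c ne] step(5)[OF c ne]] ne by (simp add: cS)
      ultimately show "orth (G (c i)) (G (c j))"
        using orth_le[OF step(5)[OF c ne] idem_le_trans idem_le_refl[OF step(4)[OF c ne]]] by blast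
    qed (use hi step(4)[OF c ne] G(2)[OF c ne] in \<open>auto simp: equiv_def\<close>)
    then show False using hi by simp
  qed
  then obtain M where M: "c M = \<one>" "\<And>n. n < M \<Longrightarrow> c n \<noteq> \<one>"
    using exists_least_iff[of "\<lambda>n. c n = \<one>"] by blast
  have "scale c M h \<one>"
    unfolding scale_def using hi(1) c0 M step(2)[OF c] G(2)[OF c] step(3)[OF c] by (auto simp: cS)
  then show thesis using that by blast
qed

text \<open>Counting in atoms loses nothing: a nonzero remainder of \<open>e\<close> would contain a
  copy of the atom, and one more step would fit.\<close>

lemma atom_count_dominated:
  assumes h: "atom h" and c: "scale c M h \<one>" and e: "idem e"
  shows "dominated e (c (count c M e))"
proof (rule ccontr)
  let ?k = "count c M e"
  have c0: "c 0 = \<zero>" "c M = \<one>" and hi: "idem h" using c by (auto simp: scale_def)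
  note count = count_props[OF c idem_carrier[OF e]]
  assume neg: "\<not> dominated e (c ?k)"
  then have k: "?k < M"
    using dominated_le[OF idem_le_one[OF e]] c0 count(1) by (metis le_neq_implies_less)
  note ci = scale_idem[OF c idem_one count(1)]
  obtain g where g: "idem_le g e" "dominated (c ?k) g" "dominated g (c ?k)"
    using dominated_transport[OF count(2) e idem_le_refl[OF ci]] by blast
  then have "g \<noteq> e" using neg by blast
  then have "e \<ominus> g \<noteq> \<zero>"
    using idem_leD[OF g(1)] by (auto simp: minus_zero_iff)
  note gm = idem_le_minus[OF g(1)]
  have "dominated h (e \<ominus> g)"
    using atom_dominated[OF h gm(1)] \<open>e \<ominus> g \<noteq> \<zero>\<close> by blast
  moreover have "equiv (c (Suc ?k) \<ominus> c ?k) h"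
    using c k by (simp add: scale_def)
  ultimately have d: "dominated (c (Suc ?k) \<ominus> c ?k) (e \<ominus> g)"
    using dominated_trans gm(1) unfolding equiv_def by blast
  have kle: "idem_le (c ?k) (c (Suc ?k))"
    using scale_le[OF c idem_one] k by simp
  have "dominated (c ?k \<oplus> (c (Suc ?k) \<ominus> c ?k)) (g \<oplus> (e \<ominus> g))"
    using g(2) d ci idem_le_minus[OF kle] gm idem_leD(1)[OF g(1)] by (intro dominated_sum)
  then have "dominated (c (Suc ?k)) e"
    using gm(5) idem_le_minus(5)[OF kle] by simp
  then show False
    using count(3)[of "Suc ?k"] k by simp
qed

lemma atom_rank_function:
  assumes h: "atom h"
  shows "\<exists>\<rho>. rank_function R \<rho>"
proof -
  have hi: "idem h" "h \<noteq> \<zero>" using h by (auto simp: atom_def)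
  obtain c M where c: "scale c M h \<one>"
    using atom_scale[OF h] by blast
  have c0: "c 0 = \<zero>" "c M = \<one>" using c by (auto simp: scale_def)
  have M: "M > 0"
    using c0 one_nonzero by (cases M) auto
  define \<rho> where "\<rho> a = count c M a / real M" for a
  have "rank_function R \<rho>"
    unfolding rank_function_def
  proof (intro conjI ballI impI)
    show "\<rho> \<in> carrier R \<rightarrow> {0..1}"
      using count_props(1)[OF c] M by (auto simp: \<rho>_def)
    show "\<rho> \<one> = 1"
      using count_one[OF c] M by (simp add: \<rho>_def)
  next
    fix a b assume "a \<in> carrier R" "b \<in> carrier R"
    then show "\<rho> (a \<otimes> b) \<le> min (\<rho> a) (\<rho> b)"
      using count_mono[OF c idem_one] dominated_mult M by (simp add: \<rho>_def divide_right_mono)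
  next
    fix e f assume ef: "e \<in> carrier R" "f \<in> carrier R" and
      "e \<otimes> e = e \<and> f \<otimes> f = f \<and> e \<otimes> f = \<zero> \<and> f \<otimes> e = \<zero>"
    then have i: "idem e" "idem f" "orth e f"
      by (auto simp: orth_def intro: idemI)
    let ?k = "count c M e" and ?l = "count c M f" and ?m = "count c M (e \<oplus> f)"
    have sup: "?k + ?l \<le> ?m"
      using count_superadditive[OF c hi(2) i] .
    have m: "?m \<le> M" "dominated (c ?m) (e \<oplus> f)"
      using count_props[OF c, of "e \<oplus> f"] ef by auto
    have "dominated (e \<oplus> f) (c (?k + ?l))"
      using scale_dominated_sum[OF c idem_one i] atom_count_dominated[OF h c] i sup m by simp
    then have "dominated (c ?m) (c (?k + ?l))"
      using dominated_trans[OF m(2)] scale_idem[OF c idem_one, of "?k + ?l"] sup m by auto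
    then have "\<not> ?k + ?l < ?m"
      using scale_strict[OF c idem_one hi(2)] m by blast
    then have "?m = ?k + ?l" using sup by simp
    then show "\<rho> (e \<oplus> f) = \<rho> e + \<rho> f"
      by (simp add: \<rho>_def add_divide_distrib)
  next
    fix a assume a: "a \<in> carrier R" "\<rho> a = 0"
    obtain e b where e: "idem e" "b \<in> carrier R" "e = a \<otimes> b" "e \<otimes> a = a"
      using left_unit_idem[OF a(1)] by blast
    have "count c M e \<le> count c M a"
      using count_mono[OF c idem_one _ _ a(1)] dominated_mult(1)[OF a(1) e(2)] e by simp
    then have "count c M e = 0"
      using a M by (simp add: \<rho>_def)
    then have "e = \<zero>"
      using atom_count_dominated[OF h c e(1)] c0 dominated_zero_right by simp
    then show "a = \<zero>"
      using e(4) a by simp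
  qed
  then show ?thesis by blast
qed

section \<open>Dyadic subdivision, and the rank as a limit of counts\<close>

lemma halves_equiv:
  assumes "idem_le a e" "idem_le b f" "equiv e f" "equiv a (e \<ominus> a)" "equiv b (f \<ominus> b)"
  shows "equiv a b"
proof -
  \<comment> \<open>With a copy \<open>g\<close> of \<open>a\<close> below \<open>b\<close>, the two
    halves of \<open>e\<close> embed in \<open>g\<close> and \<open>f - b\<close>. So
    \<open>f\<close> embeds in its own part \<open>g + (f - b)\<close>; direct finiteness gives
    equality and hence \<open>g = b\<close>.\<close>
  have *: "dominated b a"
    if H: "idem_le a e" "idem_le b f" "equiv e f" "equiv a (e \<ominus> a)" "equiv b (f \<ominus> b)" "dominated a b"
    for a b e f
  proof -
    note A = idem_leD[OF H(1)] idem_le_minus[OF H(1)]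
    note B = idem_leD[OF H(2)] idem_le_minus[OF H(2)]
    obtain g where g: "idem_le g b" "dominated a g" "dominated g a"
      using dominated_transport[OF H(6) B(1) idem_le_refl[OF A(1)]] by blast
    note gi = idem_leD[OF g(1)]
    have o: "orth g (f \<ominus> b)"
      using orth_le[OF B(7) g(1) idem_le_refl[OF B(5)]] .
    have "dominated (e \<ominus> a) (f \<ominus> b)"
      using H(4-6) dominated_trans B(1,5) A(1) unfolding equiv_def by (meson idem_carrier)
    then have "dominated (a \<oplus> (e \<ominus> a)) (g \<oplus> (f \<ominus> b))"
      using g(2) A B gi o by (intro dominated_sum)
    then have "dominated f (g \<oplus> (f \<ominus> b))"
      using A(9) H(3) dominated_trans gi(1) B(5) unfolding equiv_def by simp blast
    moreover have "idem_le (g \<oplus> (f \<ominus> b)) f"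
      using orth_sum_le[OF o idem_le_trans[OF g(1) H(2)] B(6)] .
    ultimately have "g \<oplus> (f \<ominus> b) = f"
      using idem_le_dominated_eq by blast
    then have "g = f \<ominus> (f \<ominus> b)"
      using gi(1) B(5) B(2) by (simp add: add_eq_iff)
    also have "\<dots> = b"
      using B(1,2) by (simp add: minus_eq minus_add r_neg2)
    finally show ?thesis using g by simp
  qed
  have "dominated a b \<or> dominated b a"
    using comparability assms idem_leD(1) by blast
  then show ?thesis
    using *[OF assms] *[OF assms(2,1) equiv_sym[OF assms(3)] assms(5,4)] by (auto simp: equiv_def)
qed

definition half :: "'a \<Rightarrow> 'a"
  where "half e = (SOME f. idem_le f e \<and> equiv f (e \<ominus> f))"

text \<open>Iterated bisection of \<open>f\<close>: level \<open>n\<close> has the marks 0 to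
  \<open>2 ^ n\<close>, and its even marks are those of level \<open>n - 1\<close>.\<close>

primrec dyadic :: "'a \<Rightarrow> nat \<Rightarrow> nat \<Rightarrow> 'a" where
  "dyadic f 0 k = (if k = 0 then \<zero> else f)"
| "dyadic f (Suc n) k =
    (if even k then dyadic f n (k div 2)
     else dyadic f n (k div 2) \<oplus> half (dyadic f n (Suc (k div 2)) \<ominus> dyadic f n (k div 2)))"

lemma half:
  assumes atomless "idem e"
  shows "idem_le (half e) e" "equiv (half e) (e \<ominus> half e)"
proof -
  have "\<exists>f. idem_le f e \<and> equiv f (e \<ominus> f)"
    using halving[OF assms] unfolding equiv_def by metis
  then have "idem_le (half e) e \<and> equiv (half e) (e \<ominus> half e)"
    unfolding half_def by (rule someI_ex)
  then show "idem_le (half e) e" "equiv (half e) (e \<ominus> half e)" by auto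
qed

lemma dyadic_zero [simp]: "dyadic f n 0 = \<zero>"
  by (induction n) auto

lemma dyadic_top [simp]: "dyadic f n (2 ^ n) = f"
  by (induction n) auto

lemma dyadic_double: "dyadic f (Suc n) (2 * k) = dyadic f n k"
  by simp

lemma dyadic_refine:
  assumes at: atomless and le: "idem_le (dyadic f n k) (dyadic f n (Suc k))"
  shows "idem_le (dyadic f (Suc n) (2 * k)) (dyadic f (Suc n) (Suc (2 * k)))"
    "idem_le (dyadic f (Suc n) (Suc (2 * k))) (dyadic f (Suc n) (Suc (Suc (2 * k))))"
    "dyadic f (Suc n) (Suc (2 * k)) \<ominus> dyadic f (Suc n) (2 * k) = half (dyadic f n (Suc k) \<ominus> dyadic f n k)"
    "equiv (dyadic f (Suc n) (Suc (Suc (2 * k))) \<ominus> dyadic f (Suc n) (Suc (2 * k)))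
       (half (dyadic f n (Suc k) \<ominus> dyadic f n k))"
proof -
  let ?a = "dyadic f n k" and ?b = "dyadic f n (Suc k)"
  let ?h = "half (?b \<ominus> ?a)"
  have eq: "dyadic f (Suc n) (2 * k) = ?a" "dyadic f (Suc n) (Suc (2 * k)) = ?a \<oplus> ?h"
    "dyadic f (Suc n) (Suc (Suc (2 * k))) = ?b"
    by simp_all
  note D = idem_leD[OF le] idem_le_minus[OF le]
  note H = half[OF at D(5)]
  note h = idem_leD[OF H(1)]
  have o: "orth ?a ?h"
    using orth_le[OF D(7) idem_le_refl[OF D(1)] H(1)] .
  show "idem_le (dyadic f (Suc n) (2 * k)) (dyadic f (Suc n) (Suc (2 * k)))"
    unfolding eq using orth_sum[OF D(1) h(1) o] by blast
  show "idem_le (dyadic f (Suc n) (Suc (2 * k))) (dyadic f (Suc n) (Suc (Suc (2 * k))))"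
    unfolding eq using orth_sum_le[OF o le idem_le_trans[OF H(1) D(6)]] .
  show "dyadic f (Suc n) (Suc (2 * k)) \<ominus> dyadic f (Suc n) (2 * k) = ?h"
    unfolding eq using D(1) h(1) by (metis a_comm add_eq_iff a_closed idem_carrier)
  have "?b \<ominus> (?a \<oplus> ?h) = (?b \<ominus> ?a) \<ominus> ?h"
    using D(1,2) h(1) by (simp add: minus_eq minus_add a_assoc)
  then show "equiv (dyadic f (Suc n) (Suc (Suc (2 * k))) \<ominus> dyadic f (Suc n) (Suc (2 * k))) ?h"
    unfolding eq using equiv_sym[OF H(2)] by simp
qed

text \<open>The unit of level \<open>n\<close> is its first mark. Halves of equivalent gaps are
  equivalent by \<open>halves_equiv\<close>, so refining keeps all gaps of a level
  equivalent.\<close>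

lemma dyadic_scale:
  assumes at: atomless and f: "idem f"
  shows "scale (dyadic f n) (2 ^ n) (dyadic f n 1) f"
proof (induction n)
  case 0
  then show ?case using f by (simp add: scale_def)
next
  case (Suc n)
  let ?c = "dyadic f n" and ?d = "dyadic f (Suc n)"
  let ?D = "\<lambda>k. ?c (Suc k) \<ominus> ?c k"
  have le: "idem_le (?c k) (?c (Suc k))" "equiv (?D k) (?c 1)" if "k < 2 ^ n" for k
    using Suc that by (auto simp: scale_def)
  note R = dyadic_refine[OF at le(1)]
  have D0: "?D 0 = ?c 1" "idem (?c 1)"
    using Suc by (auto simp: scale_def)
  have id: "idem (?D k)" if "k < 2 ^ n" for k
    using idem_le_minus(1)[OF le(1)[OF that]] .
  have hd: "half (?c 1) = ?d 1"
    using half(1)[OF at D0(2)] D0 idem_leD(1) by (simp add: idem_carrier)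
  have hD: "idem (half (?D k))" "equiv (half (?D k)) (?d 1)" if "k < 2 ^ n" for k
  proof -
    show "idem (half (?D k))"
      using half(1)[OF at id[OF that]] idem_leD(1) by blast
    show "equiv (half (?D k)) (?d 1)"
      unfolding hd[symmetric] using halves_equiv half[OF at id[OF that]] half[OF at D0(2)] le(2)[OF that] by blast
  qed
  have d1: "idem (?d 1)"
    using half(1)[OF at D0(2)] hd idem_leD(1) by metis
  have "idem_le (?d k) (?d (Suc k)) \<and> equiv (?d (Suc k) \<ominus> ?d k) (?d 1)" if k: "k < 2 ^ Suc n" for k
  proof (cases "even k")
    case True
    then obtain j where j: "k = 2 * j" by blast
    then have "j < 2 ^ n" using k by simp
    then show ?thesis
      unfolding j using R(1,3)[of j] hD(2)[of j] by (simp del: dyadic.simps)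
  next
    case False
    then obtain j where j: "k = Suc (2 * j)" by (metis oddE Suc_eq_plus1)
    then have jn: "j < 2 ^ n" using k by simp
    have "equiv (?d (Suc k) \<ominus> ?d k) (?d 1)"
      unfolding j using equiv_trans[OF R(4)[OF jn] hD(2)[OF jn]] idem_le_minus(1)[OF R(2)[OF jn]] d1
      by blast
    then show ?thesis
      unfolding j using R(2)[OF jn] by blast
  qed
  then show ?case
    unfolding scale_def using d1 dyadic_top[of f "Suc n"] by (simp del: dyadic.simps(2) power_Suc)
qed

lemma dyadic_nonzero:
  assumes at: atomless and f: "idem f" "f \<noteq> \<zero>"
  shows "dyadic f n 1 \<noteq> \<zero>"
proof (induction n)
  case (Suc n)
  have i: "idem (dyadic f n 1)"
    using dyadic_scale[OF at f(1)] by (auto simp: scale_def)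
  note H = half[OF at i]
  have "half (dyadic f n 1) \<noteq> \<zero>"
  proof
    assume z: "half (dyadic f n 1) = \<zero>"
    then have "dominated (dyadic f n 1) \<zero>"
      using H(2) i by (simp add: equiv_def)
    then show False
      using Suc dominated_zero_right by blast
  qed
  then show ?case
    using i idem_leD(1)[OF H(1)] by simp
qed (use f in simp)

text \<open>A step of level \<open>n\<close> is two steps of level \<open>n + 1\<close>, so the
  counts divided by \<open>2 ^ n\<close> increase and converge. Superadditivity passes to the limit;
  in subadditivity the error 2 is divided by \<open>2 ^ n\<close> and disappears.\<close>

lemma atomless_rank_function:
  assumes at: atomless
  shows "\<exists>\<rho>. rank_function R \<rho>"
proof -
  define c where "c = dyadic \<one>"
  have sc: "scale (c n) (2 ^ n) (c n 1) \<one>" for n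
    unfolding c_def using dyadic_scale[OF at idem_one] .
  have nz: "c n 1 \<noteq> \<zero>" for n
    unfolding c_def using dyadic_nonzero[OF at idem_one one_nonzero] .
  have c0: "c n 0 = \<zero>" for n
    by (simp add: c_def)
  define N where "N n a = count (c n) (2 ^ n) a" for n a
  define F where "F a n = N n a / 2 ^ n" for a n
  have N_le: "N n a \<le> 2 ^ n" "dominated (c n (N n a)) a" 
    and N_max: "\<And>k. \<lbrakk>k \<le> 2 ^ n; dominated (c n k) a\<rbrakk> \<Longrightarrow> k \<le> N n a" if "a \<in> carrier R" for n a
    using count_props[OF sc that] unfolding N_def by blast+
  have F_bounds: "0 \<le> F a n" "F a n \<le> 1" if "a \<in> carrier R" for a n
  proof -
    have "real (N n a) \<le> 2 ^ n"
      using N_le(1)[OF that] by (metis of_nat_le_iff of_nat_numeral of_nat_power)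
    then show "0 \<le> F a n" "F a n \<le> 1"
      by (simp_all add: F_def)
  qed
  have F_inc: "incseq (F a)" if a: "a \<in> carrier R" for a
  proof (rule incseq_SucI)
    fix n
    have "2 * N n a \<le> N (Suc n) a"
      using N_max[OF a, of "2 * N n a" "Suc n"] N_le[OF a, of n] dyadic_double[of \<one> n "N n a"]
      by (simp add: c_def del: dyadic.simps)
    then show "F a n \<le> F a (Suc n)"
      by (simp add: F_def field_simps)
  qed
  have "convergent (F a)" if aR: "a \<in> carrier R" for a
  proof -
    obtain L where "F a \<longlonglongrightarrow> L"
      using incseq_convergent[OF F_inc[OF aR], of 1] F_bounds(2)[OF aR] by blast
    then show ?thesis by (rule convergentI)
  qed
  define \<rho> where "\<rho> a = lim (F a)" for a
  have lim: "F a \<longlonglongrightarrow> \<rho> a" if "a \<in> carrier R" for a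
    using \<open>\<And>a. a \<in> carrier R \<Longrightarrow> convergent (F a)\<close>[OF that] by (simp add: \<rho>_def convergent_LIMSEQ_iff)
  have F_mono: "F a n \<le> F b n" if "dominated a b" "a \<in> carrier R" "b \<in> carrier R" for a b n
    unfolding F_def N_def using count_mono[OF sc idem_one that] by (simp add: divide_right_mono)
  have "rank_function R \<rho>"
    unfolding rank_function_def
  proof (intro conjI ballI impI)
    show "\<rho> \<in> carrier R \<rightarrow> {0..1}"
    proof
      fix a assume a: "a \<in> carrier R"
      show "\<rho> a \<in> {0..1}"
        using LIMSEQ_le_const[OF lim[OF a], of 0] LIMSEQ_le_const2[OF lim[OF a], of 1] F_bounds[OF a] by auto
    qed
    have "F \<one> = (\<lambda>n. 1)"
      using count_one[OF sc] by (simp add: F_def N_def fun_eq_iff)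
    then show "\<rho> \<one> = 1"
      by (simp add: \<rho>_def)
  next
    fix a b assume ab: "a \<in> carrier R" "b \<in> carrier R"
    then have abc: "a \<otimes> b \<in> carrier R" by simp
    show "\<rho> (a \<otimes> b) \<le> min (\<rho> a) (\<rho> b)"
      using LIMSEQ_le[OF lim[OF abc] lim[OF ab(1)]] LIMSEQ_le[OF lim[OF abc] lim[OF ab(2)]]
        F_mono[OF dominated_mult(1)[OF ab] abc ab(1)] F_mono[OF dominated_mult(2)[OF ab] abc ab(2)]
      by auto
  next
    fix e f assume ef: "e \<in> carrier R" "f \<in> carrier R" and
      "e \<otimes> e = e \<and> f \<otimes> f = f \<and> e \<otimes> f = \<zero> \<and> f \<otimes> e = \<zero>"
    then have i: "idem e" "idem f" "orth e f"
      by (auto simp: orth_def intro: idemI)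
    have efc: "e \<oplus> f \<in> carrier R" using ef by simp
    have "F e n + F f n \<le> F (e \<oplus> f) n" for n
    proof -
      have "N n e + N n f \<le> N n (e \<oplus> f)"
        unfolding N_def using count_superadditive[OF sc nz i] .
      then show ?thesis
        unfolding F_def add_divide_distrib[symmetric] by (intro divide_right_mono) auto
    qed
    then have 1: "\<rho> e + \<rho> f \<le> \<rho> (e \<oplus> f)"
      by (intro LIMSEQ_le[OF tendsto_add[OF lim[OF ef(1)] lim[OF ef(2)]] lim[OF efc]]) auto
    have "F (e \<oplus> f) n \<le> F e n + F f n + 2 * (1 / 2) ^ n" for n
    proof -
      have "N n (e \<oplus> f) \<le> N n e + N n f + 2"
        unfolding N_def using count_subadditive[OF sc nz i] .
      then have "real (N n (e \<oplus> f)) / 2 ^ n \<le> (real (N n e) + real (N n f) + 2) / 2 ^ n"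
        by (intro divide_right_mono) auto
      then show ?thesis
        by (simp add: F_def add_divide_distrib power_divide)
    qed
    moreover have "(\<lambda>n. F e n + F f n + 2 * (1 / 2) ^ n) \<longlonglongrightarrow> \<rho> e + \<rho> f + 2 * 0"
      by (intro tendsto_intros lim ef LIMSEQ_realpow_zero) auto
    ultimately have "\<rho> (e \<oplus> f) \<le> \<rho> e + \<rho> f + 2 * 0"
      using LIMSEQ_le[OF lim[OF efc]] by blast
    with 1 show "\<rho> (e \<oplus> f) = \<rho> e + \<rho> f" by simp
  next
    fix a assume a: "a \<in> carrier R" "\<rho> a = 0"
    have "F a n \<le> 0" for n
      using incseq_le[OF F_inc[OF a(1)] lim[OF a(1)]] a(2) by simp
    then have N0: "N n a = 0" for n
      by (simp add: F_def field_simps)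
    obtain e b where e: "idem e" "b \<in> carrier R" "e = a \<otimes> b" "e \<otimes> a = a"
      using left_unit_idem[OF a(1)] by blast
    have ci: "idem (c n 1)" for n
      using sc by (auto simp: scale_def)
    \<comment> \<open>Rank zero means that not even one step of any level fits into
      \<open>a\<close>; by comparability \<open>e\<close> then embeds in the step of every
      level.\<close>
    have "dominated e (c n 1)" for n
    proof -
      have "\<not> dominated (c n 1) a"
        using N_max[OF a(1), of 1 n] N0[of n] by auto
      moreover have "dominated e a"
        using dominated_mult(1)[OF a(1) e(2)] e by simp
      ultimately have "\<not> dominated (c n 1) e"
        using dominated_trans a(1) by blast
      then show ?thesis
        using comparability[OF e(1) ci] by blast
    qed
    note dom = this
    have le: "idem_le (c (Suc n) 1) (c n 1)" and eqv: "equiv (c n 1 \<ominus> c (Suc n) 1) (c (Suc n) 1)" for n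
    proof -
      have "c n 1 = c (Suc n) (Suc 1)"
        using dyadic_double[of \<one> n 1] by (simp add: c_def numeral_2_eq_2)
      moreover have "(1::nat) < 2 ^ Suc n"
        by (rule one_less_power) auto
      ultimately show "idem_le (c (Suc n) 1) (c n 1)" "equiv (c n 1 \<ominus> c (Suc n) 1) (c (Suc n) 1)"
        using sc[of "Suc n"] unfolding scale_def by metis+
    qed
    have mono: "idem_le (c n 1) (c m 1)" if "m \<le> n" for m n
      using that
    proof (induction n)
      case (Suc n)
      then show ?case using le idem_le_trans ci idem_le_refl by (metis le_Suc_eq)
    qed (use ci in simp)
    \<comment> \<open>The differences of consecutive first marks are orthogonal and each is
      equivalent to the smaller mark, so they would be infinitely many orthogonal idempotents
      containing copies of \<open>e\<close>.\<close>
    have "e = \<zero>"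
    proof (rule no_infinite_orth[where g = "\<lambda>n. c n 1 \<ominus> c (Suc n) 1"])
      fix i j :: nat assume "i < j"
      then have "idem_le (c j 1) (c (Suc i) 1)"
        using mono by simp
      then show "orth (c i 1 \<ominus> c (Suc i) 1) (c j 1 \<ominus> c (Suc j) 1)"
        using orth_le[OF idem_le_minus(4)[OF le[of i]] idem_le_refl[OF idem_le_minus(1)[OF le[of i]]]
            idem_le_trans[OF idem_le_minus(2)[OF le[of j]]]] by blast
    next
      fix n show "dominated e (c n 1 \<ominus> c (Suc n) 1)"
        using dominated_trans[OF dom[of "Suc n"]] eqv[of n] idem_le_minus(1)[OF le[of n]]
        unfolding equiv_def by blast
    qed (use e idem_le_minus(1)[OF le] in auto)
    then show "a = \<zero>"
      using e(4) a by simp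
  qed
  then show ?thesis by blast
qed

text \<open>With or without atoms a rank function exists, so the choice in \<open>ring_rk\<close>
  succeeds.\<close>

theorem ring_rk_rank_function: "rank_function R (ring_rk R)"
  unfolding ring_rk_def
  using someI_ex atomless_rank_function atom_rank_function atomless_iff by metis

end

section \<open>The rank metric\<close>

context irreducible_cont_ring
begin

abbreviation "rk \<equiv> ring_rk R"

lemma rk_bounds: "a \<in> carrier R \<Longrightarrow> 0 \<le> rk a" "a \<in> carrier R \<Longrightarrow> rk a \<le> 1"
  using ring_rk_rank_function unfolding rank_function_def Pi_def by auto

lemma rk_one [simp]: "rk \<one> = 1"
  using ring_rk_rank_function unfolding rank_function_def by blast

lemma rk_mult:
  assumes "a \<in> carrier R" "b \<in> carrier R"
  shows "rk (a \<otimes> b) \<le> rk a" "rk (a \<otimes> b) \<le> rk b"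
proof -
  have "rk (a \<otimes> b) \<le> min (rk a) (rk b)"
    using ring_rk_rank_function assms unfolding rank_function_def by blast
  then show "rk (a \<otimes> b) \<le> rk a" "rk (a \<otimes> b) \<le> rk b" by auto
qed

lemma rk_orth:
  assumes "idem e" "idem f" "orth e f"
  shows "rk (e \<oplus> f) = rk e + rk f"
proof -
  have "e \<in> carrier R" "f \<in> carrier R" "e \<otimes> e = e" "f \<otimes> f = f" "e \<otimes> f = \<zero>" "f \<otimes> e = \<zero>"
    using assms by (auto simp: orth_def)
  then show ?thesis
    using ring_rk_rank_function unfolding rank_function_def by blast
qed

lemma rk_zero [simp]: "rk \<zero> = 0"
  using rk_orth[of \<zero> \<zero>] by (simp add: orth_def)

lemma rk_eq_zero: "\<lbrakk>a \<in> carrier R; rk a = 0\<rbrakk> \<Longrightarrow> a = \<zero>"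
  using ring_rk_rank_function unfolding rank_function_def by blast

lemma rk_dominated:
  assumes "dominated a b" "b \<in> carrier R"
  shows "rk a \<le> rk b"
proof -
  obtain x y where "x \<in> carrier R" "y \<in> carrier R" "a = x \<otimes> b \<otimes> y"
    using assms by (auto simp: dominated_def)
  then show ?thesis
    using rk_mult[of x b] rk_mult[of "x \<otimes> b" y] assms(2) by simp
qed

lemma rk_equiv: "\<lbrakk>equiv a b; a \<in> carrier R; b \<in> carrier R\<rbrakk> \<Longrightarrow> rk a = rk b"
  using rk_dominated by (simp add: equiv_def order_antisym)

lemma rk_minus:
  assumes "idem_le e f"
  shows "rk (f \<ominus> e) = rk f - rk e"
  using rk_orth[OF idem_leD(1)[OF assms] idem_le_minus(1,3)[OF assms]] idem_le_minus(5)[OF assms] by simp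

lemma rk_le: "idem_le e f \<Longrightarrow> rk e \<le> rk f"
  using rk_dominated[OF dominated_le] idem_leD(2) by blast

lemma rk_le_eq: "\<lbrakk>idem_le e f; rk e = rk f\<rbrakk> \<Longrightarrow> e = f"
  using rk_minus[of e f] rk_eq_zero[of "f \<ominus> e"] idem_leD(1,2)[of e f] by (auto simp: minus_zero_iff)

lemma rk_neg: "a \<in> carrier R \<Longrightarrow> rk (\<ominus> a) = rk a"
proof -
  assume a: "a \<in> carrier R"
  have "rk (\<ominus> b) \<le> rk b" if "b \<in> carrier R" for b
    using rk_mult(2)[of "\<ominus> \<one>" b] that by (simp add: l_minus)
  from this[OF a] this[of "\<ominus> a"] a show ?thesis by simp
qed

lemma rk_minus_commute: "\<lbrakk>a \<in> carrier R; b \<in> carrier R\<rbrakk> \<Longrightarrow> rk (a \<ominus> b) = rk (b \<ominus> a)"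
  using rk_neg[of "a \<ominus> b"] by (simp add: minus_eq minus_add a_comm)

lemma rk_ideal_sum:
  assumes "idem e" "b \<in> carrier R"
  obtains w where "idem w" "rideal e <+> (b <# carrier R) = rideal w" "rk w \<le> rk e + rk b"
proof -
  obtain g where g: "idem g" "orth e g" "rideal e <+> (b <# carrier R) = rideal (e \<oplus> g)" "dominated g b"
    using set_add_prin_idem[OF assms] by blast
  show thesis
    using that[OF orth_sum(1)[OF assms(1) g(1,2)] g(3)] rk_orth[OF assms(1) g(1,2)]
      rk_dominated[OF g(4) assms(2)] by simp
qed

text \<open>The axioms give additivity only for orthogonal idempotents. But \<open>a + b\<close>
  lies in \<open>aR + bR\<close>, which is generated by a sum of two orthogonal idempotents, one
  generating \<open>aR\<close> and one factoring through \<open>b\<close>.\<close>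

lemma rk_add:
  assumes a: "a \<in> carrier R" "b \<in> carrier R"
  shows "rk (a \<oplus> b) \<le> rk a + rk b"
proof -
  obtain e c where e: "idem e" "a <# carrier R = rideal e" "c \<in> carrier R" "e = a \<otimes> c" "e \<otimes> a = a"
    using prin_rideal[OF a(1)] by blast
  obtain w where w: "idem w" "rideal e <+> (b <# carrier R) = rideal w" "rk w \<le> rk e + rk b"
    using rk_ideal_sum[OF e(1) a(2)] by blast
  have "a \<oplus> b \<in> rideal e <+> (b <# carrier R)"
    unfolding set_add_iff using prin_self[OF a(1)] prin_self[OF a(2)] e(2) by blast
  then have "w \<otimes> (a \<oplus> b) = a \<oplus> b"
    using w by (simp add: rideal_iff)
  then have "rk (a \<oplus> b) \<le> rk w"
    using rk_mult(1)[of w "a \<oplus> b"] w(1) a by simp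
  moreover have "rk e \<le> rk a"
    unfolding e(4) using rk_mult(1) a e(3) by blast
  ultimately show ?thesis using w(3) by simp
qed

lemma rk_Units:
  assumes "u \<in> Units R" "a \<in> carrier R"
  shows "rk (u \<otimes> a) = rk a" "rk (a \<otimes> u) = rk a"
proof -
  have u: "u \<in> carrier R" "inv u \<in> carrier R"
    using assms by auto
  have "inv u \<otimes> (u \<otimes> a) = a" "(a \<otimes> u) \<otimes> inv u = a"
    using assms u by (simp_all flip: m_assoc, simp add: m_assoc)
  then show "rk (u \<otimes> a) = rk a" "rk (a \<otimes> u) = rk a"
    using rk_mult[of "inv u" "u \<otimes> a"] rk_mult[of u a] rk_mult[of "a \<otimes> u" "inv u"] rk_mult[of a u] u assms
    by simp_all
qed

lemma rank_dist_eq: "\<lbrakk>a \<in> carrier R; b \<in> carrier R\<rbrakk> \<Longrightarrow> rank_dist R a b = rk (a \<ominus> b)"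
  by (simp add: rank_dist_def)

sublocale M: Metric_space "carrier R" "rank_dist R"
proof
  fix x y
  show "0 \<le> rank_dist R x y"
    using rk_bounds by (simp add: rank_dist_def)
  show "rank_dist R x y = rank_dist R y x"
    using rk_minus_commute by (simp add: rank_dist_def)
next
  fix x y assume "x \<in> carrier R" "y \<in> carrier R"
  then show "rank_dist R x y = 0 \<longleftrightarrow> x = y"
    using rk_eq_zero[of "x \<ominus> y"] by (auto simp: rank_dist_eq minus_zero_iff)
next
  fix x y z assume c: "x \<in> carrier R" "y \<in> carrier R" "z \<in> carrier R"
  have "x \<ominus> z = (x \<ominus> y) \<oplus> (y \<ominus> z)"
    using c by (simp add: minus_eq a_assoc r_neg1)
  then show "rank_dist R x z \<le> rank_dist R x y + rank_dist R y z"
    using rk_add[of "x \<ominus> y" "y \<ominus> z"] c by (simp add: rank_dist_eq)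
qed

text \<open>Every nonzero principal right ideal contains a copy of the atom. Nonzero ranks are thus
  at least \<open>rk h\<close>, and balls of that radius are points.\<close>

lemma atom_discrete:
  assumes "atom h"
  shows "rank_topology R = discrete_topology (carrier R)"
proof -
  have h: "idem h" "h \<noteq> \<zero>" using assms by (auto simp: atom_def)
  have pos: "rk h > 0"
    using rk_bounds(1)[of h] rk_eq_zero[of h] h by (metis idem_carrier less_eq_real_def)
  have big: "rk h \<le> rk a" if a: "a \<in> carrier R" "a \<noteq> \<zero>" for a
  proof -
    obtain e b where e: "idem e" "b \<in> carrier R" "e = a \<otimes> b" "e \<otimes> a = a"
      using left_unit_idem[OF a(1)] by blast
    have "e \<noteq> \<zero>"
      using e(4) a by auto
    then have "rk h \<le> rk e"
      using rk_dominated[OF atom_dominated[OF assms e(1)]] e(1) by simp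
    also have "rk e \<le> rk a"
      unfolding e(3) using rk_mult(1) a e(2) by blast
    finally show ?thesis .
  qed
  have "openin M.mtopology S" if S: "S \<subseteq> carrier R" for S
    unfolding M.openin_mtopology
  proof (intro conjI allI impI S)
    fix x assume x: "x \<in> S"
    have "y = x" if "y \<in> carrier R" "rank_dist R x y < rk h" for y
    proof -
      have "x \<ominus> y = \<zero>"
        using big[of "x \<ominus> y"] that x S by (auto simp: rank_dist_eq subset_iff not_le[symmetric])
      then show ?thesis
        using x S that by (auto simp: minus_zero_iff)
    qed
    then have "M.mball x (rk h) \<subseteq> S"
      using x by (auto simp: M.mball_def)
    then show "\<exists>r>0. M.mball x r \<subseteq> S"
      using pos by blast
  qed
  then have "M.mtopology = discrete_topology (carrier R)"
    using openin_subset[of M.mtopology] by (auto simp: topology_eq openin_discrete_topology)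
  then show ?thesis
    by (simp add: rank_topology_def)
qed

lemma nondiscrete_atomless: "nondiscrete_ring R \<Longrightarrow> atomless"
  using atom_discrete atomless_iff by (auto simp: nondiscrete_ring_def)

end

section \<open>Chains of idempotents\<close>

context cont_ring
begin

text \<open>The supremum is the projection onto the join of the ranges along the intersection of the
  kernels. Upper continuity makes these ideals meet trivially, lower continuity makes them span the
  ring.\<close>

lemma idem_chain_sup:
  assumes id: "\<And>s. s \<in> S \<Longrightarrow> idem s" and "S \<noteq> {}"
    and total: "\<And>s t. \<lbrakk>s \<in> S; t \<in> S\<rbrakk> \<Longrightarrow> idem_le s t \<or> idem_le t s"
  obtains e where "idem e" "\<And>s. s \<in> S \<Longrightarrow> idem_le s e"
    "\<And>u. \<lbrakk>idem u; \<And>s. s \<in> S \<Longrightarrow> idem_le s u\<rbrakk> \<Longrightarrow> idem_le e u"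
proof -
  have incl: "rideal s \<subseteq> rideal t" "annih t \<subseteq> annih s" if "idem_le s t" for s t
    using idem_le_iff[OF idem_leD(1,2)[OF that]] that by auto
  let ?J = "psup (rideal ` S)" and ?A = "\<Inter>(annih ` S)"
  have cJ: "subset.chain PR (rideal ` S)"
    unfolding subset_chain_def using id total incl(1) by blast
  have cA: "subset.chain PR (annih ` S)"
    unfolding subset_chain_def using id total incl(2) idem_carrier by blast
  have J: "?J \<in> PR" and A: "?A \<in> PR"
    using chain_PR[OF cJ] chain_PR[OF cA] assms(2) by auto
  have "?A \<inter> ?J = {\<zero>}"
  proof (rule disjoint_psup[OF cJ A])
    fix I assume "I \<in> rideal ` S"
    then obtain s where s: "s \<in> S" "I = rideal s" by blast
    have "x = \<zero>" if "x \<in> annih s" "x \<in> rideal s" for x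
      using that by (simp add: annih_def rideal_iff)
    then have "?A \<inter> I \<subseteq> {\<zero>}"
      using s by blast
    then show "?A \<inter> I = {\<zero>}"
      using PR_zero[OF A] PR_zero[OF rideal_PR[OF id[OF s(1)]]] s(2) by blast
  qed
  then obtain e where e: "idem e" "rideal e = ?J" "\<And>a. a \<in> ?A \<Longrightarrow> e \<otimes> a = \<zero>"
    using disjoint_idem[OF J A] by (metis Int_commute)
  \<comment> \<open>So far \<open>e\<close> is only known to kill \<open>?A\<close>. Spanning shows
    that its kernel is no larger, which \<open>idem_le s e\<close> demands.\<close>
  have "carrier R \<subseteq> ?J <+> ?A"
  proof (rule subset_add_Inter[OF cA _ J carrier_PR])
    fix I assume "I \<in> annih ` S"
    then obtain s where s: "s \<in> S" "I = annih s" by blast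
    note si = id[OF s(1)]
    show "carrier R \<subseteq> ?J <+> I"
    proof
      fix x assume x: "x \<in> carrier R"
      have "s \<otimes> x \<in> rideal s" "x \<ominus> s \<otimes> x \<in> annih s"
        using x si by (simp_all add: rideal_iff annih_def r_distr_minus)
      moreover have "rideal s \<subseteq> ?J"
        using psup_upper[OF chain_PR[OF cJ]] s by blast
      moreover have "x = s \<otimes> x \<oplus> (x \<ominus> s \<otimes> x)"
        using x si by (simp add: add_minus_cancel)
      ultimately show "x \<in> ?J <+> I"
        unfolding set_add_iff s(2) by blast
    qed
  qed (use assms(2) in simp)
  then have ann: "annih e \<subseteq> ?A"
  proof (intro subsetI)
    fix x assume "carrier R \<subseteq> ?J <+> ?A" and x: "x \<in> annih e"
    then have "x \<in> ?J <+> ?A"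
      by (auto simp: annih_def)
    then obtain j a where ja: "j \<in> ?J" "a \<in> ?A" "x = j \<oplus> a"
      unfolding set_add_iff by blast
    have c: "j \<in> carrier R" "e \<otimes> j = j" "a \<in> carrier R"
      using ja(1) e(2) PR_carrier[OF A ja(2)] by (auto simp: rideal_iff)
    have "e \<otimes> x = j"
      unfolding ja(3) using c e(1) e(3)[OF ja(2)] by (simp add: r_distr)
    then have "j = \<zero>"
      using x by (simp add: annih_def)
    then show "x \<in> ?A"
      using ja c by simp
  qed
  show thesis
  proof (rule that[OF e(1)])
    fix s assume s: "s \<in> S"
    have "rideal s \<subseteq> rideal e"
      unfolding e(2) using psup_upper[OF chain_PR[OF cJ]] s by blast
    moreover have "annih e \<subseteq> annih s"
      using ann s by blast
    ultimately show "idem_le s e"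
      using idem_le_iff[OF id[OF s] e(1)] by blast
  next
    fix u assume u: "idem u" "\<And>s. s \<in> S \<Longrightarrow> idem_le s u"
    have "rideal e \<subseteq> rideal u"
      unfolding e(2) by (rule psup_least[OF chain_PR[OF cJ] rideal_PR[OF u(1)]]) (use incl(1)[OF u(2)] in blast)
    moreover have "annih u \<subseteq> ?A"
      using incl(2)[OF u(2)] by blast
    then have "annih u \<subseteq> annih e"
      using e(3) by (auto simp: annih_def)
    ultimately show "idem_le e u"
      using idem_le_iff[OF e(1) u(1)] by blast
  qed
qed

end

context irreducible_cont_ring
begin

lemma rk_scale:
  assumes c: "scale c M h f" "idem f" "k \<le> M"
  shows "rk (c k) = k * rk h"
  using c(3)
proof (induction k)
  case 0
  then show ?case using c by (simp add: scale_def)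
next
  case (Suc k)
  have le: "idem_le (c k) (c (Suc k))" and h: "equiv (c (Suc k) \<ominus> c k) h" "idem h"
    using Suc c by (auto simp: scale_def)
  have "rk (c (Suc k) \<ominus> c k) = rk h"
    using rk_equiv[OF h(1)] idem_le_minus(1)[OF le] h(2) by simp
  then have "rk (c (Suc k)) = rk (c k) + rk h"
    using rk_minus[OF le] by simp
  then show ?case using Suc by (simp add: algebra_simps)
qed

lemma rk_dyadic:
  assumes at: atomless and f: "idem f" and k: "k \<le> 2 ^ n"
  shows "rk (dyadic f n k) = k * rk f / 2 ^ n"
proof -
  note sc = dyadic_scale[OF at f, of n]
  have "rk f = 2 ^ n * rk (dyadic f n 1)"
    using rk_scale[OF sc f, of "2 ^ n"] by simp
  then show ?thesis
    using rk_scale[OF sc f k] by simp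
qed

lemma dyadic_refine_power: "dyadic f (n + m) (2 ^ m * k) = dyadic f n k"
proof (induction m)
  case (Suc m)
  have "dyadic f (Suc (n + m)) (2 * (2 ^ m * k)) = dyadic f (n + m) (2 ^ m * k)"
    by (rule dyadic_double)
  then show ?case
    using Suc by (simp add: mult.assoc del: dyadic.simps)
qed simp

text \<open>Marks of levels \<open>n\<close> and \<open>m\<close> both reappear at level
  \<open>n + m\<close>, where they can be compared.\<close>

lemma dyadic_le:
  assumes at: atomless and f: "idem f" and "k \<le> 2 ^ n" "l \<le> 2 ^ m" "2 ^ m * k \<le> 2 ^ n * l"
  shows "idem_le (dyadic f n k) (dyadic f m l)"
proof -
  have "idem_le (dyadic f (n + m) (2 ^ m * k)) (dyadic f (n + m) (2 ^ n * l))"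
    using scale_le[OF dyadic_scale[OF at f] f assms(5)] assms(4) by (simp add: power_add)
  then show ?thesis
    using dyadic_refine_power[of f n m k] dyadic_refine_power[of f m n l] by (simp add: add.commute)
qed

text \<open>Density of the dyadic ranks, and continuity of the lattice, fill in all intermediate ranks.\<close>

lemma rank_chain:
  assumes at: atomless and f: "idem f"
  obtains K where "\<And>x. x \<in> K \<Longrightarrow> idem_le x f"
    "\<And>x y. \<lbrakk>x \<in> K; y \<in> K\<rbrakk> \<Longrightarrow> idem_le x y \<or> idem_le y x" "rk ` K = {0..rk f}"
proof -
  define r where "r = rk f"
  have r: "0 \<le> r" using rk_bounds f by (simp add: r_def)
  \<comment> \<open>The marks of rank at most \<open>t\<close>; their supremum will be the member of
    rank \<open>t\<close>.\<close>
  define S where "S t = {dyadic f n k | n k. k \<le> 2 ^ n \<and> k * r / 2 ^ n \<le> t}" for t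
  have cmp: "idem_le (dyadic f n k) (dyadic f m l)"
    if "k \<le> 2 ^ n" "l \<le> 2 ^ m" "k * r / 2 ^ n \<le> l * r / 2 ^ m" "r > 0" for n m k l
  proof (rule dyadic_le[OF at f that(1,2)])
    have "real k / 2 ^ n \<le> real l / 2 ^ m"
      using that(3,4) by (simp add: field_simps)
    then have "real (2 ^ m * k) \<le> real (2 ^ n * l)"
      by (simp add: field_simps)
    then show "2 ^ m * k \<le> 2 ^ n * l"
      using of_nat_le_iff by blast
  qed
  show thesis
  proof (cases "r = 0")
    case True
    then show thesis
      using that[of "{f}"] f by (simp add: r_def)
  next
    case False
    then have rp: "r > 0" using r by simp
    have Sid: "idem_le s f" if s: "s \<in> S t" for s t
    proof -
      obtain n k where "k \<le> 2 ^ n" "s = dyadic f n k"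
        using s by (auto simp: S_def)
      then show ?thesis
        using dyadic_le[OF at f, of k n 1 0] by simp
    qed
    have "\<exists>e. idem e \<and> (\<forall>s\<in>S t. idem_le s e) \<and> (\<forall>u. idem u \<longrightarrow> (\<forall>s\<in>S t. idem_le s u) \<longrightarrow> idem_le e u)"
      if "t \<ge> 0" for t
    proof -
      have "\<zero> \<in> S t"
        unfolding S_def using that by (intro CollectI exI[of _ 0]) simp
      then have ne: "S t \<noteq> {}" by blast
      have tot: "idem_le s s' \<or> idem_le s' s" if "s \<in> S t" "s' \<in> S t" for s s'
        using that cmp rp unfolding S_def by (auto simp del: dyadic.simps) (meson linorder_le_cases)
      show ?thesis
        using idem_chain_sup[of "S t"] idem_leD(1)[OF Sid] ne tot by metis
    qed
    then obtain E where E: "\<And>t. t \<ge> 0 \<Longrightarrow> idem (E t)" "\<And>t s. \<lbrakk>t \<ge> 0; s \<in> S t\<rbrakk> \<Longrightarrow> idem_le s (E t)"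
      "\<And>t u. \<lbrakk>t \<ge> 0; idem u; \<And>s. s \<in> S t \<Longrightarrow> idem_le s u\<rbrakk> \<Longrightarrow> idem_le (E t) u"
      by metis
    have mono: "idem_le (E t) (E t')" if "0 \<le> t" "t \<le> t'" for t t'
    proof (rule E(3)[OF that(1) E(1)])
      fix s assume "s \<in> S t"
      then have "s \<in> S t'"
        using that(2) unfolding S_def by force
      then show "idem_le s (E t')"
        using E(2) that by simp
    qed (use that in simp)
    have rkE: "rk (E t) = t" if t: "0 \<le> t" "t \<le> r" for t
    proof -
      have "\<bar>rk (E t) - t\<bar> \<le> r * (1 / 2) ^ n" for n
      proof -
        \<comment> \<open>At level \<open>n\<close>, \<open>E t\<close> is squeezed between the
          marks \<open>k\<close> and \<open>Suc k\<close>. Comparing \<open>t\<close> with mark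
          \<open>Suc k\<close> rather than \<open>k\<close> lets this cover
          \<open>t = 0\<close>.\<close>
        define P where "P k \<longleftrightarrow> t \<le> real (Suc k) * r / 2 ^ n" for k
        define k where "k = (LEAST k. P k)"
        have P: "P (2 ^ n - 1)"
          using t by (simp add: P_def)
        then have k: "t \<le> real (Suc k) * r / 2 ^ n" "\<And>j. j < k \<Longrightarrow> \<not> t \<le> real (Suc j) * r / 2 ^ n"
          and k2: "k \<le> 2 ^ n - 1"
          using LeastI[of P] not_less_Least[of _ P] Least_le[of P] unfolding k_def P_def[symmetric] by blast+
        have k2': "Suc k \<le> 2 ^ n"
          using k2 by (metis Suc_pred' Suc_le_mono zero_less_numeral zero_less_power)
        have k3: "real k * r / 2 ^ n \<le> t"
          using k(2)[of "k - 1"] t by (cases k) auto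
        have "dyadic f n k \<in> S t"
          unfolding S_def using k3 k2' by (intro CollectI exI[of _ n] exI[of _ k]) simp
        then have "rk (dyadic f n k) \<le> rk (E t)"
          using rk_le E(2)[OF t(1)] by blast
        then have lo: "real k * r / 2 ^ n \<le> rk (E t)"
          using rk_dyadic[OF at f, of k n] k2' by (simp add: r_def)
        have "idem_le (E t) (dyadic f n (Suc k))"
        proof (rule E(3)[OF t(1)])
          show "idem (dyadic f n (Suc k))"
            using scale_idem[OF dyadic_scale[OF at f] f k2'] .
          fix s assume "s \<in> S t"
          then obtain m l where ml: "s = dyadic f m l" "l \<le> 2 ^ m" "l * r / 2 ^ m \<le> t"
            by (auto simp: S_def)
          show "idem_le s (dyadic f n (Suc k))"
            unfolding ml(1) by (rule cmp[OF ml(2) k2' order_trans[OF ml(3) k(1)] rp])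
        qed
        then have "rk (E t) \<le> real (Suc k) * r / 2 ^ n"
          using rk_le rk_dyadic[OF at f k2'] by (metis r_def)
        then show ?thesis
          using lo k(1) k3 by (simp add: abs_le_iff power_divide add_divide_distrib distrib_right)
      qed
      moreover have "(\<lambda>n. r * (1 / 2) ^ n) \<longlonglongrightarrow> r * 0"
        by (intro tendsto_intros LIMSEQ_realpow_zero) auto
      ultimately have "\<bar>rk (E t) - t\<bar> \<le> r * 0"
        by (intro LIMSEQ_le_const) auto
      then show ?thesis by simp
    qed
    show thesis
    proof (rule that[of "E ` {0..r}"])
      show "idem_le x f" if "x \<in> E ` {0..r}" for x
        using that E(3)[OF _ f Sid] by auto
      show "idem_le x y \<or> idem_le y x" if "x \<in> E ` {0..r}" "y \<in> E ` {0..r}" for x y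
        using that mono by (auto) (meson linorder_le_cases)
      show "rk ` E ` {0..r} = {0..rk f}"
        using rkE by (force simp: r_def image_image)
    qed
  qed
qed

end

section \<open>Geodesics in the unit group\<close>

context irreducible_cont_ring
begin

section \<open>Truncations that are units\<close>

lemma rk_rideal_mono:
  assumes "idem a" "idem b" "rideal a \<subseteq> rideal b"
  shows "rk a \<le> rk b"
proof -
  have "b \<otimes> a = a"
    using assms by (auto simp: rideal_iff subset_iff)
  then show ?thesis
    using rk_mult(1)[of b a] assms by simp
qed

text \<open>An element \<open>u\<close> annihilated by \<open>1 + f (g - 1)\<close> satisfies
  \<open>u = f u - f g u\<close>, so it lies in \<open>fR\<close>, and then
  \<open>f g u = 0\<close>. Injectivity suffices by direct finiteness.\<close>

lemma truncation_unit:
  assumes g: "g \<in> carrier R" and f: "idem f"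
    and inj: "\<And>q. \<lbrakk>q \<in> rideal f; f \<otimes> (g \<otimes> q) = \<zero>\<rbrakk> \<Longrightarrow> q = \<zero>"
  shows "\<one> \<oplus> f \<otimes> (g \<ominus> \<one>) \<in> Units R"
proof (rule injective_Units)
  fix u assume u: "u \<in> carrier R" "(\<one> \<oplus> f \<otimes> (g \<ominus> \<one>)) \<otimes> u = \<zero>"
  have fc: "f \<in> carrier R" using f by simp
  have "u \<oplus> (f \<otimes> (g \<otimes> u) \<ominus> f \<otimes> u) = \<zero>"
    using u fc g by (simp add: distr_simps)
  then have u_eq: "u = f \<otimes> u \<ominus> f \<otimes> (g \<otimes> u)"
    using u(1) fc g by (simp add: add_zero_iff minus_eq minus_add a_comm)
  have fu: "f \<otimes> (f \<otimes> u \<ominus> f \<otimes> (g \<otimes> u)) = f \<otimes> u \<ominus> f \<otimes> (g \<otimes> u)"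
    using u(1) f g by (simp add: r_distr_minus)
  then have fu': "f \<otimes> u = u"
    using u_eq by argo
  then have "u \<ominus> f \<otimes> (g \<otimes> u) = u"
    using u_eq by argo
  then have "f \<otimes> (g \<otimes> u) = \<zero>"
    using u(1) fc g by (metis add_minus_cancel m_closed minus_add_cancel minus_zero_iff r_distr_minus add_eq_iff a_comm minus_self)
  then show "u = \<zero>"
    using inj fu' u(1) by (simp add: rideal_iff)
qed (use g f in auto)

lemma image_PR_eq:
  assumes "idem p" "g \<in> carrier R"
  shows "(\<lambda>x. g \<otimes> x) ` rideal p = (g \<otimes> p) <# carrier R"
  unfolding rideal_prin[OF assms(1)] using assms by (auto simp: l_coset_def image_iff m_assoc)

text \<open>Zorn's lemma. The image of the join of a chain lies in the join of the images, because
  the preimage of the latter is principal and contains every member; upper continuity then separates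
  the two joins.\<close>

lemma maximal_displaced:
  assumes g: "g \<in> carrier R" and E: "E \<in> PR"
  obtains P where "P \<in> PR" "P \<subseteq> E" "P \<inter> (\<lambda>x. g \<otimes> x) ` P = {\<zero>}"
    "\<And>P'. \<lbrakk>P' \<in> PR; P' \<subseteq> E; P' \<inter> (\<lambda>x. g \<otimes> x) ` P' = {\<zero>}; P \<subseteq> P'\<rbrakk> \<Longrightarrow> P' = P"
proof -
  let ?g = "\<lambda>P. (\<lambda>x. g \<otimes> x) ` P"
  define A where "A = {P \<in> PR. P \<subseteq> E \<and> P \<inter> ?g P = {\<zero>}}"
  have "\<exists>M\<in>A. \<forall>X\<in>A. M \<subseteq> X \<longrightarrow> X = M"
  proof (rule subset_Zorn)
    fix C assume C: "subset.chain A C"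
    then have CA: "J \<in> A" if "J \<in> C" for J
      using that by (auto simp: subset_chain_def)
    have ch: "subset.chain PR C"
      using C by (auto simp: subset_chain_def A_def)
    have "?g J \<in> PR" if "J \<in> C" for J
      using PR_image[OF _ g] CA[OF that] by (simp add: A_def)
    moreover have "?g I \<subseteq> ?g J \<or> ?g J \<subseteq> ?g I" if "I \<in> C" "J \<in> C" for I J
      using C that by (meson image_mono subset_chain_def)
    ultimately have ch': "subset.chain PR (?g ` C)"
      unfolding subset_chain_def by blast
    let ?U = "psup C"
    have U: "?U \<in> PR"
      using chain_PR[OF ch] by blast
    have gC: "psup (?g ` C) \<in> PR"
      using chain_PR[OF ch'] by blast
    have "?U \<subseteq> {x \<in> carrier R. g \<otimes> x \<in> psup (?g ` C)}"
    proof (rule psup_least[OF chain_PR[OF ch] PR_vimage[OF gC g]])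
      fix J assume J: "J \<in> C"
      then have "?g J \<subseteq> psup (?g ` C)"
        using psup_upper[OF chain_PR[OF ch']] by blast
      then show "J \<subseteq> {x \<in> carrier R. g \<otimes> x \<in> psup (?g ` C)}"
        using PR_subset CA[OF J] by (auto simp: A_def)
    qed
    then have "?g ?U \<subseteq> psup (?g ` C)" by auto
    moreover have "?U \<inter> psup (?g ` C) = {\<zero>}"
    proof (rule disjoint_psup_psup[OF ch ch'])
      fix I J' assume I: "I \<in> C" and "J' \<in> ?g ` C"
      then obtain J where J: "J \<in> C" "J' = ?g J" by blast
      have "I \<subseteq> J \<or> J \<subseteq> I"
        using C I J(1) by (auto simp: subset_chain_def)
      then have "I \<inter> ?g J \<subseteq> I \<inter> ?g I \<or> I \<inter> ?g J \<subseteq> J \<inter> ?g J"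
        by blast
      moreover have IJ: "I \<in> PR" "J \<in> PR" "I \<inter> ?g I = {\<zero>}" "J \<inter> ?g J = {\<zero>}"
        using CA[OF I] CA[OF J(1)] unfolding A_def by simp_all
      ultimately have "I \<inter> ?g J \<subseteq> {\<zero>}" by argo
      moreover have "\<zero> \<in> I" "\<zero> \<in> ?g J"
        using PR_zero[OF IJ(1)] PR_zero[OF PR_image[OF IJ(2) g]] by simp_all
      ultimately show "I \<inter> J' = {\<zero>}" using J by blast
    qed
    ultimately have "?U \<inter> ?g ?U \<subseteq> {\<zero>}" by blast
    moreover have "\<zero> \<in> ?U" "\<zero> \<in> ?g ?U"
      using PR_zero[OF U] PR_zero[OF PR_image[OF U g]] by auto
    moreover have "?U \<subseteq> E"
      by (rule psup_least[OF chain_PR[OF ch] E]) (use CA in \<open>auto simp: A_def\<close>)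
    ultimately have "?U \<in> A"
      using U by (auto simp: A_def)
    then show "\<exists>U\<in>A. \<forall>X\<in>C. X \<subseteq> U"
      using psup_upper[OF chain_PR[OF ch]] by blast
  qed
  then obtain P where P: "P \<in> A" "\<And>X. \<lbrakk>X \<in> A; P \<subseteq> X\<rbrakk> \<Longrightarrow> X = P"
    by blast
  show thesis
    by (rule that[of P]) (use P in \<open>auto simp: A_def\<close>)
qed

text \<open>
  Take \<open>P\<close> maximal with \<open>P \<inter> g P = {0}\<close>. If \<open>P\<close> has large rank, then \<open>f\<close> projects onto \<open>P\<close> and
  kills \<open>(g - 1) P\<close>. Otherwise \<open>f\<close> projects onto a complement \<open>Q\<close> of
  \<open>P + g P + g\<^sup>-\<^sup>1 P\<close>: by maximality, \<open>g\<close> maps every cyclic submodule of \<open>Q\<close> into itself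
  modulo \<open>P + g P\<close>.
\<close>

lemma partial_truncation:
  assumes g: "g \<in> Units R" and e: "idem e" and ge: "e \<otimes> (g \<ominus> \<one>) = g \<ominus> \<one>"
  obtains f where "idem_le f e" "rk e / 4 \<le> rk f"
    "\<And>f'. idem_le f' f \<Longrightarrow> \<one> \<oplus> f' \<otimes> (g \<ominus> \<one>) \<in> Units R"
proof -
  have gc: "g \<in> carrier R" "inv g \<in> carrier R" using g by auto
  have ginv: "inv g \<otimes> (g \<otimes> y) = y" "g \<otimes> (inv g \<otimes> y) = y" if "y \<in> carrier R" for y
    using g that gc by (simp_all flip: m_assoc)
  define x where "x = g \<ominus> \<one>"
  have x: "x \<in> carrier R" "e \<otimes> x = x"
    using gc ge by (simp_all add: x_def)
  have gx: "g \<otimes> y = y \<oplus> x \<otimes> y" if "y \<in> carrier R" for y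
    using that gc by (simp add: x_def l_distr_minus add_minus_cancel)
  let ?E = "rideal e"
  have E: "?E \<in> PR" using e by simp
  have xE: "x \<otimes> y \<in> ?E" if "y \<in> carrier R" for y
    using that x e by (simp add: rideal_iff mult_absorb)
  have gE: "g \<otimes> y \<in> ?E" if "y \<in> ?E" for y
    unfolding gx[OF PR_carrier[OF E that]] using PR_add[OF E that xE[OF PR_carrier[OF E that]]] .
  have giE: "inv g \<otimes> y \<in> ?E" if y: "y \<in> ?E" for y
  proof -
    define z where "z = inv g \<otimes> y"
    have yc: "y \<in> carrier R" and z: "z \<in> carrier R"
      using PR_carrier[OF E y] gc by (auto simp: z_def)
    have "z \<oplus> x \<otimes> z = y"
      using gx[OF z] ginv(2)[OF yc] by (simp add: z_def)
    then have "z = y \<ominus> x \<otimes> z"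
      using z yc x by (simp add: add_eq_iff)
    then show ?thesis
      using PR_minus[OF E y xE[OF z]] by (simp add: z_def)
  qed
  obtain P where P: "P \<in> PR" "P \<subseteq> ?E" "P \<inter> (\<lambda>x. g \<otimes> x) ` P = {\<zero>}"
    and max: "\<And>P'. \<lbrakk>P' \<in> PR; P' \<subseteq> ?E; P' \<inter> (\<lambda>x. g \<otimes> x) ` P' = {\<zero>}; P \<subseteq> P'\<rbrakk> \<Longrightarrow> P' = P"
    using maximal_displaced[OF gc(1) E] by metis
  obtain p where p: "idem p" "P = rideal p"
    using PR_rideal[OF P(1)] .
  have pc: "p \<in> carrier R" using p by simp
  show thesis
  \<comment> \<open>The threshold balances the two cases: below it, \<open>P + g P + inv g P\<close>
    has rank at most \<open>3 * rk p\<close>, and its complement in \<open>eR\<close> has rank above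
    \<open>rk e / 4\<close>.\<close>
  proof (cases "rk e / 4 \<le> rk p")
    case True
    have xP: "(\<lambda>y. x \<otimes> y) ` P \<in> PR" "(\<lambda>y. x \<otimes> y) ` P \<subseteq> ?E"
      using PR_image[OF P(1) x(1)] xE PR_carrier[OF P(1)] by auto
    \<comment> \<open>If \<open>x z\<close> lies in \<open>P\<close>, so does
      \<open>g z = z + x z\<close>, and \<open>P \<inter> g P = 0\<close> gives
      \<open>z = 0\<close>. Hence there is a projection onto \<open>P\<close> that kills
      \<open>x P\<close>.\<close>
    have "y = \<zero>" if y: "y \<in> P" "y \<in> (\<lambda>y. x \<otimes> y) ` P" for y
    proof -
      obtain z where z: "z \<in> P" "y = x \<otimes> z" using y(2) by blast
      have zc: "z \<in> carrier R" using PR_carrier[OF P(1) z(1)] .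
      have "g \<otimes> z \<in> P"
        unfolding gx[OF zc] using PR_add[OF P(1) z(1)] y(1) z(2) by simp
      then have "g \<otimes> z = \<zero>"
        using P(3) z(1) by blast
      then have "z = \<zero>"
        using ginv(1)[OF zc] gc by simp
      then show ?thesis using z x by simp
    qed
    then have "P \<inter> (\<lambda>y. x \<otimes> y) ` P = {\<zero>}"
      using P xP by (subst PR_Int_zero_iff) auto
    then obtain f where f: "idem_le f e" "rideal f = P" "\<And>q. q \<in> (\<lambda>y. x \<otimes> y) ` P \<Longrightarrow> f \<otimes> q = \<zero>"
      using disjoint_idem_le[OF P(1) xP(1) _ e P(2) xP(2)] by metis
    have "rk p \<le> rk f"
      using rk_rideal_mono[OF p(1) idem_leD(1)[OF f(1)]] f(2) p(2) by simp
    then have "rk e / 4 \<le> rk f" using True by simp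
    \<comment> \<open>Any \<open>q\<close> in \<open>f'R\<close> lies in \<open>P\<close>, so
      \<open>f'\<close> kills \<open>x q\<close> and \<open>f' g q = f' q = q\<close>.\<close>
    moreover have "\<one> \<oplus> f' \<otimes> (g \<ominus> \<one>) \<in> Units R" if f': "idem_le f' f" for f'
    proof (rule truncation_unit[OF gc(1) idem_leD(1)[OF f']])
      fix q assume q: "q \<in> rideal f'" "f' \<otimes> (g \<otimes> q) = \<zero>"
      have c: "q \<in> carrier R" "f' \<otimes> q = q" "f' \<in> carrier R" "f \<in> carrier R" "f' \<otimes> f = f'"
        using q idem_leD[OF f'] by (auto simp: rideal_iff)
      have "q \<in> P"
        using idem_le_iff[OF idem_leD(1,2)[OF f']] f' q(1) f(2) by blast
      then have "f \<otimes> (x \<otimes> q) = \<zero>"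
        using f(3) by blast
      then have "f' \<otimes> (f \<otimes> (x \<otimes> q)) = \<zero>"
        using c(3) by simp
      then have "f' \<otimes> (x \<otimes> q) = \<zero>"
        using mult_absorb[OF c(5,3,4), of "x \<otimes> q"] x(1) c(1) by simp
      then show "q = \<zero>"
        using q(2) gx[OF c(1)] c x(1) by (simp add: r_distr)
    qed
    ultimately show thesis
      using that[OF f(1)] by blast
  next
    case False
    let ?gP = "(g \<otimes> p) <# carrier R" and ?hP = "(inv g \<otimes> p) <# carrier R"
    have gP: "(\<lambda>x. g \<otimes> x) ` P = ?gP" "(\<lambda>x. inv g \<otimes> x) ` P = ?hP"
      using image_PR_eq[OF p(1)] gc p(2) by auto
    have gPR: "?gP \<in> PR" "?hP \<in> PR"
      using gc pc by auto
    have gp: "g \<otimes> p \<in> carrier R" "inv g \<otimes> p \<in> carrier R"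
      using gc pc by auto
    obtain w1 where w1: "idem w1" "P <+> ?gP = rideal w1" "rk w1 \<le> rk p + rk (g \<otimes> p)"
      using rk_ideal_sum[OF p(1) gp(1)] p(2) by blast
    obtain w where w: "idem w" "rideal w1 <+> ?hP = rideal w" "rk w \<le> rk w1 + rk (inv g \<otimes> p)"
      using rk_ideal_sum[OF w1(1) gp(2)] by blast
    have rkw: "rk w \<le> 3 * rk p"
      using w(3) w1(3) rk_Units(1)[OF g pc] rk_Units(1)[OF Units_inv_Units[OF g] pc] by simp
    let ?W = "rideal w" and ?V = "rideal w1"
    have W: "?W \<in> PR" and V: "?V \<in> PR" using w w1 by auto
    have PV: "P \<subseteq> ?V" "?gP \<subseteq> ?V" "?V \<subseteq> ?W" "?hP \<subseteq> ?W"
      using set_add_left[OF P(1) gPR(1)] set_add_right[OF P(1) gPR(1)]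
        set_add_left[OF V gPR(2)] set_add_right[OF V gPR(2)] w1(2) w(2) by auto
    have "?gP \<subseteq> ?E" "?hP \<subseteq> ?E"
      using gE giE P(2) unfolding gP[symmetric] by blast+
    then have WE: "?W \<subseteq> ?E"
      using set_add_least[OF P(2) _ E] set_add_least[OF _ _ E] w1(2) w(2) by metis
    obtain Q where Q: "Q \<in> PR" "Q \<subseteq> ?E" "?W \<inter> Q = {\<zero>}" "?W <+> Q = ?E"
      using relative_complement[OF W E WE] by blast
    have "Q \<inter> ?W = {\<zero>}" using Q(3) by blast
    then obtain f where f: "idem_le f e" "rideal f = Q" "\<And>q. q \<in> ?W \<Longrightarrow> f \<otimes> q = \<zero>"
      using disjoint_idem_le[OF Q(1) W _ e Q(2) WE] by metis
    note D = idem_leD[OF f(1)] idem_le_minus[OF f(1)]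
    have "rk e - rk f \<le> rk w"
    proof -
      have "e \<in> ?W <+> Q"
        using Q(4) e by (simp add: rideal_iff)
      then obtain a q where aq: "a \<in> ?W" "q \<in> Q" "e = a \<oplus> q"
        unfolding set_add_iff by blast
      have c: "a \<in> carrier R" "q \<in> carrier R" "e \<otimes> a = a" "e \<otimes> q = q" "f \<otimes> q = q" "f \<otimes> a = \<zero>"
        using aq WE Q(2) f by (auto simp: rideal_iff)
      have "f \<otimes> (a \<oplus> q) = q"
        using c D(1) by (simp add: r_distr)
      then have "q = f"
        using aq(3) D(3) by simp
      then have "e \<ominus> f = a"
        using aq(3) c(1,2) by (metis a_comm add_eq_iff e idem_carrier)
      then have "w \<otimes> (e \<ominus> f) = e \<ominus> f"
        using aq(1) by (simp add: rideal_iff)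
      then have "rk (e \<ominus> f) \<le> rk w"
        using rk_mult(1)[of w "e \<ominus> f"] w(1) D(1,2) by simp
      then show ?thesis
        using rk_minus[OF f(1)] by simp
    qed
    then have "rk e / 4 \<le> rk f"
      using rkw False by simp
    moreover have "\<one> \<oplus> f' \<otimes> (g \<ominus> \<one>) \<in> Units R" if f': "idem_le f' f" for f'
    proof (rule truncation_unit[OF gc(1) idem_leD(1)[OF f']])
      fix q assume q: "q \<in> rideal f'" "f' \<otimes> (g \<otimes> q) = \<zero>"
      have c: "q \<in> carrier R" "f' \<otimes> q = q" "f' \<in> carrier R" "f \<in> carrier R" "f' \<otimes> f = f'"
        using q idem_leD[OF f'] by (auto simp: rideal_iff)
      have qQ: "q \<in> Q"
        using idem_le_iff[OF idem_leD(1,2)[OF f']] f' q(1) f(2) by blast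
      let ?q = "q <# carrier R"
      have qV: "?q <+> ?V \<in> PR" using c(1) V by simp
      \<comment> \<open>Maximality, tested on \<open>P + zR\<close>, controls only some nonzero
        multiple of each nonzero \<open>z\<close> in \<open>qR\<close>; \<open>essential_PR\<close>
        carries the conclusion over to \<open>q\<close> itself.\<close>
      have "?q \<subseteq> {z \<in> carrier R. g \<otimes> z \<in> ?q <+> ?V}"
      proof (rule essential_PR[OF PR_vimage[OF qV gc(1)] prin_PR[OF c(1)]])
        fix z assume z: "z \<in> ?q" "z \<noteq> \<zero>"
        have zQ: "z \<in> Q"
          using PR_prin_subset[OF Q(1) qQ] z by blast
        have zc: "z \<in> carrier R" using PR_carrier[OF Q(1) zQ] .
        have zz: "z <# carrier R \<in> PR" using zc by simp
        let ?P' = "P <+> (z <# carrier R)"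
        have P': "?P' \<in> PR" "?P' \<subseteq> ?E" "P \<subseteq> ?P'"
          using P(1) zz set_add_least[OF P(2) PR_prin_subset[OF E] E, of z] zQ Q(2)
            set_add_left[OF P(1) zz] by auto
        have "?P' \<noteq> P"
        proof
          assume "?P' = P"
          then have "z \<in> P"
            using set_add_right[OF P(1) zz prin_self[OF zc]] by simp
          then show False
            using PV(1,3) zQ Q(3) z(2) by blast
        qed
        then have "?P' \<inter> (\<lambda>x. g \<otimes> x) ` ?P' \<noteq> {\<zero>}"
          using max[OF P'(1,2)] P'(3) by blast
        then obtain y y' where y: "y \<in> ?P'" "y' \<in> ?P'" "y = g \<otimes> y'" "y \<noteq> \<zero>"
          using PR_zero[OF P'(1)] PR_zero[OF PR_image[OF P'(1) gc(1)]] by blast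
        obtain a r where a: "a \<in> P" "r \<in> carrier R" "y = a \<oplus> z \<otimes> r"
          using y(1) zc by (auto simp: set_add_iff prin_iff)
        obtain b s where b: "b \<in> P" "s \<in> carrier R" "y' = b \<oplus> z \<otimes> s"
          using y(2) zc by (auto simp: set_add_iff prin_iff)
        have ab: "a \<in> carrier R" "b \<in> carrier R" "y \<in> carrier R"
          using PR_carrier[OF P(1)] a(1) b(1) PR_carrier[OF P'(1) y(1)] by auto
        have aV: "a \<in> ?V" "g \<otimes> b \<in> ?V"
          using PV(1,2) a(1) b(1) gP(1) by blast+
        \<comment> \<open>Otherwise \<open>y = g b\<close> lies in \<open>g P\<close>, so
          \<open>z r\<close> lies in \<open>P + g P\<close> as well as in \<open>Q\<close> and
          vanishes. Then \<open>y = a\<close> lies in \<open>P\<close>, against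
          \<open>P \<inter> g P = 0\<close>.\<close>
        have zs: "z \<otimes> s \<noteq> \<zero>"
        proof
          assume "z \<otimes> s = \<zero>"
          then have yb: "y = g \<otimes> b"
            using y(3) b(3) ab by simp
          have "z \<otimes> r = y \<ominus> a"
            using a(3) ab zc a(2) by (metis a_comm add_eq_iff m_closed)
          then have "z \<otimes> r \<in> ?V"
            using PR_minus[OF V] aV yb by simp
          moreover have "z \<otimes> r \<in> Q"
            using PR_mult[OF Q(1) zQ a(2)] .
          ultimately have "z \<otimes> r = \<zero>"
            using PV(3) Q(3) by blast
          then have "y = a"
            using a(3) ab by simp
          then show False
            using y(4) a(1) yb b(1) P(3) by blast
        qed
        have "g \<otimes> (z \<otimes> s) = (z \<otimes> r) \<oplus> (a \<ominus> g \<otimes> b)"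
        proof -
          have "a \<oplus> z \<otimes> r = g \<otimes> (z \<otimes> s) \<oplus> g \<otimes> b"
            using y(3) a(3) b(3) ab zc gc b(2) by (simp add: r_distr a_comm)
          then have "g \<otimes> (z \<otimes> s) = (a \<oplus> z \<otimes> r) \<ominus> g \<otimes> b"
            using ab zc gc b(2) a(2) by (metis a_closed add_eq_iff m_closed)
          then show ?thesis
            using ab zc gc a(2) by (simp add: minus_eq a_ac)
        qed
        moreover have "z \<otimes> r \<in> ?q"
          using PR_mult[OF prin_PR[OF c(1)] z(1) a(2)] .
        moreover have "a \<ominus> g \<otimes> b \<in> ?V"
          using PR_minus[OF V aV] .
        ultimately have "g \<otimes> (z \<otimes> s) \<in> ?q <+> ?V"
          unfolding set_add_iff by blast
        then show "\<exists>s\<in>carrier R. z \<otimes> s \<noteq> \<zero> \<and> z \<otimes> s \<in> {z \<in> carrier R. g \<otimes> z \<in> ?q <+> ?V}"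
          using zs b(2) zc by auto
      qed
      then have "g \<otimes> q \<in> ?q <+> ?V"
        using prin_self[OF c(1)] by blast
      then obtain r v where rv: "r \<in> carrier R" "v \<in> ?V" "g \<otimes> q = q \<otimes> r \<oplus> v"
        using c(1) by (auto simp: set_add_iff prin_iff)
      have vc: "v \<in> carrier R" using PR_carrier[OF V rv(2)] .
      have "f \<otimes> v = \<zero>"
        using f(3) rv(2) PV(3) by blast
      then have "f' \<otimes> (f \<otimes> v) = \<zero>"
        using c(3) by simp
      then have "f' \<otimes> v = \<zero>"
        using mult_absorb[OF c(5,3,4) vc] by simp
      moreover have "f' \<otimes> (q \<otimes> r) = q \<otimes> r"
        using mult_absorb[OF c(2,3,1) rv(1)] .
      \<comment> \<open>\<open>f'\<close> fixes \<open>q r\<close> and kills \<open>v\<close>, so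
        \<open>f' g q = 0\<close> reads \<open>q r = 0\<close>. Then \<open>g q\<close> lies in
        \<open>P + g P\<close> and \<open>q\<close> in \<open>inv g P + P\<close>, which is the
        reason for including \<open>inv g P\<close> in \<open>?W\<close>.\<close>
      ultimately have "q \<otimes> r = \<zero>"
        using q(2) rv(1) vc c(1,3) unfolding rv(3) by (simp add: r_distr)
      then have gqV: "g \<otimes> q \<in> ?V"
        using rv vc by simp
      then obtain a b where ab: "a \<in> P" "b \<in> ?gP" "g \<otimes> q = a \<oplus> b"
        using w1(2) unfolding set_add_iff[symmetric] by (metis set_add_iff)
      obtain b' where b': "b' \<in> P" "b = g \<otimes> b'"
        using ab(2) gP(1) by blast
      have abc: "a \<in> carrier R" "b' \<in> carrier R"
        using PR_carrier[OF P(1)] ab(1) b'(1) by auto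
      have "q = inv g \<otimes> (a \<oplus> g \<otimes> b')"
        using ginv(1)[OF c(1)] ab(3) b'(2) by simp
      also have "\<dots> = inv g \<otimes> a \<oplus> b'"
        using ginv(1)[OF abc(2)] abc gc by (simp add: r_distr)
      also have "\<dots> \<in> ?W"
      proof (rule PR_add[OF W])
        show "inv g \<otimes> a \<in> ?W" using PV(4) gP(2) ab(1) by blast
        show "b' \<in> ?W" using PV(1,3) b'(1) by blast
      qed
      finally show "q = \<zero>"
        using qQ Q(3) by blast
    qed
    ultimately show thesis
      using that[OF f(1)] by blast
  qed
qed

text \<open>With the unit \<open>k = 1 + F x\<close>, \<open>g' = g k^{-1}\<close> satisfies
  \<open>g' - 1 = (e - F) x k^{-1}\<close>, so \<open>partial_truncation\<close> applies to it
  inside \<open>e - F\<close>. For \<open>y\<close> below \<open>e - F\<close>, multiplying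
  \<open>1 + y (g' - 1)\<close> by \<open>k\<close> gives \<open>1 + (F + y) x\<close>. A quarter of
  the remaining rank is gained, hence the factor 3/4.\<close>

lemma truncation_step:
  assumes g: "g \<in> Units R" and e: "idem e" and ge: "e \<otimes> (g \<ominus> \<one>) = g \<ominus> \<one>"
    and F: "idem_le F e" "\<one> \<oplus> F \<otimes> (g \<ominus> \<one>) \<in> Units R"
  obtains F' where "idem_le F F'" "idem_le F' e" "rk e - rk F' \<le> 3 / 4 * (rk e - rk F)"
    "\<And>y. idem_le y (F' \<ominus> F) \<Longrightarrow> \<one> \<oplus> (F \<oplus> y) \<otimes> (g \<ominus> \<one>) \<in> Units R"
proof -
  define x where "x = g \<ominus> \<one>"
  have gc: "g \<in> carrier R" using g by auto
  have x: "x \<in> carrier R" "e \<otimes> x = x"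
    using gc ge by (simp_all add: x_def)
  note D = idem_leD[OF F(1)] idem_le_minus[OF F(1)]
  define k where "k = \<one> \<oplus> F \<otimes> x"
  define e' where "e' = e \<ominus> F"
  have k: "k \<in> Units R" "k \<in> carrier R" "inv k \<in> carrier R"
    using F(2) by (auto simp: k_def x_def)
  have e': "idem e'" "idem_le e' e" "orth F e'" "F \<oplus> e' = e" "e' \<in> carrier R"
    using D by (simp_all add: e'_def)
  define g' where "g' = g \<otimes> inv k"
  have g': "g' \<in> Units R" "g' \<in> carrier R"
    using g k Units_m_closed Units_inv_Units by (auto simp: g'_def)
  have "g = \<one> \<oplus> x"
    using gc by (simp add: x_def add_minus_cancel)
  also have "\<dots> = \<one> \<oplus> e \<otimes> x"
    using x by simp
  also have "\<dots> = k \<oplus> e' \<otimes> x"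
    using D(1) e'(5) x(1) by (simp add: k_def e'(4)[symmetric] l_distr a_assoc)
  finally have gk: "g = k \<oplus> e' \<otimes> x" .
  have g'1: "g' \<ominus> \<one> = e' \<otimes> x \<otimes> inv k"
  proof -
    have "g' = k \<otimes> inv k \<oplus> e' \<otimes> x \<otimes> inv k"
      unfolding g'_def using k x(1) e'(5) gk by (simp add: l_distr)
    then have "g' = e' \<otimes> x \<otimes> inv k \<oplus> \<one>"
      using k(1) k(3) x(1) e'(5) by (simp add: a_comm)
    then show ?thesis
      using k(3) x(1) e'(5) by (simp add: minus_eq a_assoc r_neg)
  qed
  have "e' \<otimes> (g' \<ominus> \<one>) = g' \<ominus> \<one>"
    unfolding g'1 using e'(1) x(1) k(3) by (simp add: m_assoc)
  then obtain f where f: "idem_le f e'" "rk e' / 4 \<le> rk f"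
    "\<And>f'. idem_le f' f \<Longrightarrow> \<one> \<oplus> f' \<otimes> (g' \<ominus> \<one>) \<in> Units R"
    using partial_truncation[OF g'(1) e'(1)] by blast
  note f_id = idem_leD(1)[OF f(1)]
  have Ff: "orth F f"
    using orth_le[OF e'(3) idem_le_refl[OF D(1)] f(1)] .
  have minus: "(F \<oplus> f) \<ominus> F = f"
    using D(1) f_id by (metis a_comm add_eq_iff a_closed idem_carrier)
  show thesis
  proof (rule that[of "F \<oplus> f"])
    show "idem_le F (F \<oplus> f)"
      using orth_sum(2)[OF D(1) f_id Ff] .
    show "idem_le (F \<oplus> f) e"
      using orth_sum_le[OF Ff F(1) idem_le_trans[OF f(1) e'(2)]] .
    have "rk e' = rk e - rk F"
      using rk_minus[OF F(1)] by (simp add: e'_def)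
    then show "rk e - rk (F \<oplus> f) \<le> 3 / 4 * (rk e - rk F)"
      using rk_orth[OF D(1) f_id Ff] f(2) by simp
    fix y assume "idem_le y ((F \<oplus> f) \<ominus> F)"
    then have y: "idem_le y f" by (simp add: minus)
    have yc: "y \<in> carrier R" "y \<otimes> e' = y"
      using idem_leD(1,3)[OF idem_le_trans[OF y f(1)]] by auto
    have "(\<one> \<oplus> y \<otimes> (g' \<ominus> \<one>)) \<otimes> k = k \<oplus> y \<otimes> (e' \<otimes> x \<otimes> (inv k \<otimes> k))"
      unfolding g'1 using yc(1) k x(1) e'(5) by (simp add: l_distr m_assoc)
    also have "\<dots> = k \<oplus> y \<otimes> x"
      using yc k x(1) e'(5) mult_absorb[OF yc(2,1) e'(5) x(1)] by simp
    also have "\<dots> = \<one> \<oplus> (F \<oplus> y) \<otimes> x"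
      using D(1) yc(1) x(1) by (simp add: k_def l_distr a_assoc)
    finally show "\<one> \<oplus> (F \<oplus> y) \<otimes> (g \<ominus> \<one>) \<in> Units R"
      using Units_m_closed[OF f(3)[OF y] k(1)] by (simp add: x_def)
  qed
qed

section \<open>Assembling the chain and the geodesic\<close>

lemma orth_sum_between:
  assumes "idem_le F G" "idem_le y (G \<ominus> F)"
  shows "idem_le F (F \<oplus> y)" "idem_le (F \<oplus> y) G" "rk (F \<oplus> y) = rk F + rk y"
    "\<And>z. idem_le y z \<Longrightarrow> idem_le z (G \<ominus> F) \<Longrightarrow> idem_le (F \<oplus> y) (F \<oplus> z)"
proof -
  note D = idem_leD[OF assms(1)] idem_le_minus[OF assms(1)]
  have o: "orth F z" if "idem_le z (G \<ominus> F)" for z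
    using orth_le[OF D(7) idem_le_refl[OF D(1)] that] .
  note y = idem_leD(1)[OF assms(2)]
  show "idem_le F (F \<oplus> y)"
    using orth_sum(2)[OF D(1) y o[OF assms(2)]] .
  show "idem_le (F \<oplus> y) G"
    using orth_sum_le[OF o[OF assms(2)] assms(1) idem_le_trans[OF assms(2) D(6)]] .
  show "rk (F \<oplus> y) = rk F + rk y"
    using rk_orth[OF D(1) y o[OF assms(2)]] .
  fix z assume z: "idem_le y z" "idem_le z (G \<ominus> F)"
  note zi = idem_leD(1)[OF z(2)]
  show "idem_le (F \<oplus> y) (F \<oplus> z)"
    using orth_sum_le[OF o[OF assms(2)] orth_sum(2)[OF D(1) zi o[OF z(2)]]
        idem_le_trans[OF z(1) orth_sum(3)[OF D(1) zi o[OF z(2)]]]] .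
qed

text \<open>The gaps between consecutive \<open>F n\<close> are filled by the chains of
  \<open>rank_chain\<close>, shifted by \<open>F n\<close>. The ranks of the \<open>F n\<close> tend
  to \<open>rk e\<close> but may never reach it, so \<open>e\<close> is inserted separately; its
  truncation is \<open>g\<close>.\<close>

lemma truncation_chain:
  assumes at: atomless and g: "g \<in> Units R" and e: "idem e" and ge: "e \<otimes> (g \<ominus> \<one>) = g \<ominus> \<one>"
  obtains K where "\<And>x. x \<in> K \<Longrightarrow> idem_le x e" "\<And>x y. \<lbrakk>x \<in> K; y \<in> K\<rbrakk> \<Longrightarrow> idem_le x y \<or> idem_le y x"
    "rk ` K = {0..rk e}" "\<And>x. x \<in> K \<Longrightarrow> \<one> \<oplus> x \<otimes> (g \<ominus> \<one>) \<in> Units R"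
proof -
  have gc: "g \<in> carrier R" using g by auto
  let ?u = "\<lambda>x. \<one> \<oplus> x \<otimes> (g \<ominus> \<one>)"
  have "\<exists>F. \<forall>n. (idem_le (F n) e \<and> ?u (F n) \<in> Units R \<and> (n = 0 \<longrightarrow> F n = \<zero>)) \<and>
      (idem_le (F n) (F (Suc n)) \<and> rk e - rk (F (Suc n)) \<le> 3 / 4 * (rk e - rk (F n)) \<and>
       (\<forall>y. idem_le y (F (Suc n) \<ominus> F n) \<longrightarrow> ?u (F n \<oplus> y) \<in> Units R))"
  proof (rule dependent_nat_choice)
    show "\<exists>x. idem_le x e \<and> ?u x \<in> Units R \<and> ((0::nat) = 0 \<longrightarrow> x = \<zero>)"
      using e gc by (intro exI[of _ \<zero>]) auto
    fix F and n :: nat assume F: "idem_le F e \<and> ?u F \<in> Units R \<and> (n = 0 \<longrightarrow> F = \<zero>)"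
    obtain F' where F': "idem_le F F'" "idem_le F' e" "rk e - rk F' \<le> 3 / 4 * (rk e - rk F)"
      "\<And>y. idem_le y (F' \<ominus> F) \<Longrightarrow> ?u (F \<oplus> y) \<in> Units R"
      using truncation_step[OF g e ge, of F] F by blast
    have "?u F' \<in> Units R"
      using F'(4)[of "F' \<ominus> F"] idem_le_minus[OF F'(1)] by simp
    then show "\<exists>F'. (idem_le F' e \<and> ?u F' \<in> Units R \<and> (Suc n = 0 \<longrightarrow> F' = \<zero>)) \<and>
      idem_le F F' \<and> rk e - rk F' \<le> 3 / 4 * (rk e - rk F) \<and>
       (\<forall>y. idem_le y (F' \<ominus> F) \<longrightarrow> ?u (F \<oplus> y) \<in> Units R)"
      using F' by blast
  qed
  then obtain F where F: "\<And>n. idem_le (F n) e" "F 0 = \<zero>" "\<And>n. idem_le (F n) (F (Suc n))"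
    "\<And>n. rk e - rk (F (Suc n)) \<le> 3 / 4 * (rk e - rk (F n))"
    "\<And>n y. idem_le y (F (Suc n) \<ominus> F n) \<Longrightarrow> ?u (F n \<oplus> y) \<in> Units R"
    by metis
  have Fmono: "idem_le (F m) (F n)" if "m \<le> n" for m n
    using that
  proof (induction n)
    case 0
    then show ?case using idem_le_refl[OF idem_leD(1)[OF F(1)]] by simp
  next
    case (Suc n)
    then show ?case
      using idem_le_trans[OF _ F(3)] idem_le_refl[OF idem_leD(1)[OF F(1)]] by (metis le_Suc_eq)
  qed
  have conv: "rk e - rk (F n) \<le> (3 / 4) ^ n * rk e" for n
  proof (induction n)
    case (Suc n)
    then show ?case using F(4)[of n] by simp
  qed (use F(2) in simp)
  have "\<exists>K. (\<forall>x\<in>K. idem_le x (F (Suc n) \<ominus> F n)) \<and> (\<forall>x\<in>K. \<forall>y\<in>K. idem_le x y \<or> idem_le y x) \<and>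
      rk ` K = {0..rk (F (Suc n) \<ominus> F n)}" for n
    using rank_chain[OF at idem_le_minus(1)[OF F(3)[of n]]] by metis
  then obtain K where K: "\<And>n x. x \<in> K n \<Longrightarrow> idem_le x (F (Suc n) \<ominus> F n)"
    "\<And>n x y. \<lbrakk>x \<in> K n; y \<in> K n\<rbrakk> \<Longrightarrow> idem_le x y \<or> idem_le y x"
    "\<And>n. rk ` K n = {0..rk (F (Suc n) \<ominus> F n)}"
    by metis
  note B = orth_sum_between[OF F(3) K(1)]
  define L where "L = insert e {F n \<oplus> y | n y. y \<in> K n}"
  have Le: "idem_le x e" if "x \<in> L" for x
    using that idem_le_refl[OF e] idem_le_trans[OF B(2) F(1)] by (auto simp: L_def)
  show thesis
  proof (rule that[of L])
    show "idem_le x e" if "x \<in> L" for x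
      using Le[OF that] .
    have lt: "idem_le (F n \<oplus> y) (F m \<oplus> z)" if "y \<in> K n" "z \<in> K m" "n < m" for n m y z
      using idem_le_trans[OF B(2)[OF that(1)] idem_le_trans[OF Fmono B(1)[OF that(2)]]] that(3) by simp
    have cmp: "idem_le (F n \<oplus> y) (F m \<oplus> z) \<or> idem_le (F m \<oplus> z) (F n \<oplus> y)"
      if "y \<in> K n" "z \<in> K m" for n m y z
    proof (cases n m rule: linorder_cases)
      case equal
      then have z: "z \<in> K n" using that by simp
      show ?thesis
        using K(2)[OF that(1) z] B(4)[OF that(1) _ K(1)[OF z]] B(4)[OF z _ K(1)[OF that(1)]] equal by blast
    qed (use lt that in blast)+
    show "idem_le x y \<or> idem_le y x" if "x \<in> L" "y \<in> L" for x y
      using that Le cmp unfolding L_def by blast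
    show "?u x \<in> Units R" if x: "x \<in> L" for x
    proof (cases "x = e")
      case True
      then show ?thesis using ge gc g by (simp add: add_minus_cancel)
    next
      case False
      then show ?thesis using x F(5)[OF K(1)] by (auto simp: L_def)
    qed
    show "rk ` L = {0..rk e}"
    proof (intro equalityI subsetI)
      fix t assume "t \<in> rk ` L"
      then obtain x where x: "x \<in> L" "t = rk x" by blast
      show "t \<in> {0..rk e}"
        using rk_le[OF Le[OF x(1)]] rk_bounds(1)[OF idem_carrier[OF idem_leD(1)[OF Le[OF x(1)]]]] x(2) by simp
    next
      fix t assume t: "t \<in> {0..rk e}"
      show "t \<in> rk ` L"
      proof (cases "t = rk e")
        case True
        then show ?thesis by (simp add: L_def)
      next
        case False
        then have lt: "0 < rk e - t" using t by simp
        have "(\<lambda>n. (3 / 4) ^ n * rk e) \<longlonglongrightarrow> 0 * rk e"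
          by (intro tendsto_intros LIMSEQ_realpow_zero) auto
        then have "\<forall>\<^sub>F n in sequentially. (3 / 4) ^ n * rk e < rk e - t"
          using lt by (intro order_tendstoD(2)) auto
        then obtain N where "(3 / 4) ^ N * rk e < rk e - t"
          by (auto simp: eventually_sequentially)
        then have "t < rk (F N)"
          using conv[of N] by simp
        \<comment> \<open>The first \<open>F m\<close> of rank above \<open>t\<close> closes the gap
          whose chain has a member of the right rank; \<open>m > 0\<close> because
          \<open>F 0 = \<zero>\<close>.\<close>
        then obtain m where m: "t < rk (F m)" "\<And>i. i < m \<Longrightarrow> \<not> t < rk (F i)"
          using exists_least_iff[of "\<lambda>n. t < rk (F n)"] by blast
        then obtain n where n: "m = Suc n"
          using t F(2) by (cases m) auto
        have "t - rk (F n) \<in> {0..rk (F (Suc n) \<ominus> F n)}"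
          using m(1) m(2)[of n] rk_minus[OF F(3)[of n]] by (simp add: n)
        then obtain y where y: "y \<in> K n" "rk y = t - rk (F n)"
          using K(3)[of n] by (metis imageE)
        then have "rk (F n \<oplus> y) = t"
          using B(3)[OF y(1)] by simp
        moreover have "F n \<oplus> y \<in> L"
          using y(1) by (auto simp: L_def)
        ultimately show ?thesis by blast
      qed
    qed
  qed
qed

text \<open>The chain is parametrised by rank, over the right interval since \<open>e\<close> and
  \<open>x\<close> generate the same ideal. Two points of the path differ by
  \<open>(\<phi> t - \<phi> s) x\<close>, of rank at most \<open>t - s\<close>.\<close>

theorem unit_geodesic:
  assumes at: atomless and g: "g \<in> Units R"
  obtains \<gamma> where "\<And>t. t \<in> {0..rk (g \<ominus> \<one>)} \<Longrightarrow> \<gamma> t \<in> Units R" "\<gamma> 0 = \<one>" "\<gamma> (rk (g \<ominus> \<one>)) = g"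
    "\<And>s t. \<lbrakk>s \<in> {0..rk (g \<ominus> \<one>)}; t \<in> {0..rk (g \<ominus> \<one>)}\<rbrakk> \<Longrightarrow> rk (\<gamma> s \<ominus> \<gamma> t) \<le> \<bar>s - t\<bar>"
proof -
  define x where "x = g \<ominus> \<one>"
  have gc: "g \<in> carrier R" using g by auto
  have x: "x \<in> carrier R" using gc by (simp add: x_def)
  obtain e b where e: "idem e" "b \<in> carrier R" "e = x \<otimes> b" "e \<otimes> x = x"
    using left_unit_idem[OF x] by blast
  have "rk (x \<otimes> b) \<le> rk x" "rk (e \<otimes> x) \<le> rk e"
    using rk_mult e(1,2) x by blast+
  then have rke: "rk e = rk x"
    using e by simp
  obtain K where K: "\<And>y. y \<in> K \<Longrightarrow> idem_le y e" "\<And>y z. \<lbrakk>y \<in> K; z \<in> K\<rbrakk> \<Longrightarrow> idem_le y z \<or> idem_le z y"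
    "rk ` K = {0..rk e}" "\<And>y. y \<in> K \<Longrightarrow> \<one> \<oplus> y \<otimes> (g \<ominus> \<one>) \<in> Units R"
    using truncation_chain[OF at g e(1)] e(4) unfolding x_def by blast
  define \<phi> where "\<phi> t = (SOME y. y \<in> K \<and> rk y = t)" for t
  have \<phi>: "\<phi> t \<in> K" "rk (\<phi> t) = t" if t: "t \<in> {0..rk x}" for t
  proof -
    have "\<exists>y. y \<in> K \<and> rk y = t"
      using t K(3) rke by (metis imageE)
    then have "\<phi> t \<in> K \<and> rk (\<phi> t) = t"
      unfolding \<phi>_def by (rule someI_ex)
    then show "\<phi> t \<in> K" "rk (\<phi> t) = t" by auto
  qed
  have \<phi>c: "\<phi> t \<in> carrier R" if "t \<in> {0..rk x}" for t
    using idem_leD(1)[OF K(1)[OF \<phi>(1)[OF that]]] by blast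
  have r: "0 \<le> rk x" using rk_bounds(1)[OF x] .
  have le: "rk ((\<one> \<oplus> \<phi> s \<otimes> x) \<ominus> (\<one> \<oplus> \<phi> t \<otimes> x)) \<le> \<bar>s - t\<bar>"
    if "s \<in> {0..rk x}" "t \<in> {0..rk x}" "idem_le (\<phi> s) (\<phi> t)" for s t
  proof -
    have "(\<one> \<oplus> \<phi> t \<otimes> x) \<ominus> (\<one> \<oplus> \<phi> s \<otimes> x) = (\<phi> t \<ominus> \<phi> s) \<otimes> x"
      using \<phi>c[OF that(1)] \<phi>c[OF that(2)] x by algebra
    then have "rk ((\<one> \<oplus> \<phi> t \<otimes> x) \<ominus> (\<one> \<oplus> \<phi> s \<otimes> x)) \<le> rk (\<phi> t \<ominus> \<phi> s)"
      using rk_mult(1)[of "\<phi> t \<ominus> \<phi> s" x] \<phi>c that x by simp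
    also have "\<dots> = t - s"
      using rk_minus[OF that(3)] \<phi>(2) that by simp
    finally show ?thesis
      using rk_minus_commute[of "\<one> \<oplus> \<phi> t \<otimes> x" "\<one> \<oplus> \<phi> s \<otimes> x"] \<phi>c that x by simp
  qed
  show thesis
  proof (rule that[of "\<lambda>t. \<one> \<oplus> \<phi> t \<otimes> x"], unfold x_def[symmetric])
    show "\<one> \<oplus> \<phi> t \<otimes> x \<in> Units R" if "t \<in> {0..rk x}" for t
      using K(4)[OF \<phi>(1)[OF that]] by (simp add: x_def)
    have "\<phi> 0 = \<zero>"
      using rk_eq_zero[OF \<phi>c \<phi>(2)] r by simp
    then show "\<one> \<oplus> \<phi> 0 \<otimes> x = \<one>" using x by simp
    have "\<phi> (rk x) = e"
      by (rule rk_le_eq) (use K(1) \<phi>[of "rk x"] r rke in auto)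
    then show "\<one> \<oplus> \<phi> (rk x) \<otimes> x = g"
      using e(4) gc by (simp add: x_def add_minus_cancel)
    fix s t assume st: "s \<in> {0..rk x}" "t \<in> {0..rk x}"
    show "rk ((\<one> \<oplus> \<phi> s \<otimes> x) \<ominus> (\<one> \<oplus> \<phi> t \<otimes> x)) \<le> \<bar>s - t\<bar>"
      using K(2)[OF \<phi>(1)[OF st(1)] \<phi>(1)[OF st(2)]] le[OF st] le[OF st(2,1)]
        rk_minus_commute[of "\<one> \<oplus> \<phi> s \<otimes> x" "\<one> \<oplus> \<phi> t \<otimes> x"] \<phi>c[OF st(1)] \<phi>c[OF st(2)] x
      by (auto simp: abs_minus_commute)
  qed
qed

end

section \<open>Geodesic spaces\<close>

context Metric_space
begin

text \<open>Only a Lipschitz bound is demanded. For \<open>r = d x y\<close>, the case used for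
  length spaces, the triangle inequality turns it into equality.\<close>

definition geodesic_on :: "real \<Rightarrow> 'a \<Rightarrow> 'a \<Rightarrow> (real \<Rightarrow> 'a) \<Rightarrow> bool"
  where "geodesic_on r x y \<gamma> \<longleftrightarrow> \<gamma> \<in> {0..r} \<rightarrow> M \<and> \<gamma> 0 = x \<and> \<gamma> r = y \<and>
    (\<forall>s\<in>{0..r}. \<forall>t\<in>{0..r}. d (\<gamma> s) (\<gamma> t) \<le> \<bar>s - t\<bar>)"

lemma lipschitz_continuous_map:
  assumes "\<gamma> \<in> {0..r} \<rightarrow> M" "\<And>s t. \<lbrakk>s \<in> {0..r}; t \<in> {0..r}\<rbrakk> \<Longrightarrow> d (\<gamma> s) (\<gamma> t) \<le> L * \<bar>s - t\<bar>"
    and "L \<ge> 0"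
  shows "continuous_map (top_of_set {0..r}) mtopology \<gamma>"
  unfolding continuous_map_to_metric
proof (intro ballI allI impI)
  fix s \<epsilon> :: real assume s: "s \<in> topspace (top_of_set {0..r})" and \<epsilon>: "0 < \<epsilon>"
  \<comment> \<open>\<open>L + 1\<close> instead of \<open>L\<close>, since \<open>L\<close> may be
    zero.\<close>
  let ?U = "{0..r} \<inter> ball s (\<epsilon> / (L + 1))"
  have "\<gamma> t \<in> mball (\<gamma> s) \<epsilon>" if t: "t \<in> ?U" for t
  proof -
    have "L * \<bar>s - t\<bar> \<le> (L + 1) * \<bar>s - t\<bar>"
      by (intro mult_right_mono) auto
    also have "\<dots> < \<epsilon>"
      using t assms(3) by (simp add: dist_real_def field_simps)
    finally have "d (\<gamma> s) (\<gamma> t) < \<epsilon>"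
      using assms(2)[of s t] s t by simp
    then show ?thesis
      using assms(1) s t by auto
  qed
  moreover have "openin (top_of_set {0..r}) ?U"
    by (simp add: openin_open_Int)
  moreover have "s \<in> ?U"
    using s \<epsilon> assms(3) by simp
  ultimately show "\<exists>U. openin (top_of_set {0..r}) U \<and> s \<in> U \<and> (\<forall>t\<in>U. \<gamma> t \<in> mball (\<gamma> s) \<epsilon>)"
    by blast
qed

lemma geodesic_length:
  assumes "geodesic_on r x y \<gamma>"
  shows "metric_path_length d r \<gamma> \<le> ereal r"
  unfolding metric_path_length_def
proof (rule Sup_least, safe)
  fix n :: nat and s :: "nat \<Rightarrow> real"
  assume s: "0 < n" "s 0 = 0" "r = s n" "\<forall>i<n. s i \<le> s (Suc i)"
  have mono: "s i \<le> s j" if "i \<le> j" "j \<le> n" for i j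
    using that
  proof (induction j)
    case (Suc j)
    then show ?case using s(4) by (metis Suc_leD Suc_le_lessD le_Suc_eq order.refl order_trans)
  qed simp
  have "d (\<gamma> (s i)) (\<gamma> (s (Suc i))) \<le> s (Suc i) - s i" if i: "i < n" for i
  proof -
    have "s i \<in> {0..r}" "s (Suc i) \<in> {0..r}"
      using mono[of 0 i] mono[of i n] mono[of 0 "Suc i"] mono[of "Suc i" n] i s by auto
    then have "d (\<gamma> (s i)) (\<gamma> (s (Suc i))) \<le> \<bar>s i - s (Suc i)\<bar>"
      using assms unfolding geodesic_on_def by blast
    moreover have "s i \<le> s (Suc i)"
      using s(4) i by blast
    ultimately show ?thesis by simp
  qed
  then have "(\<Sum>i<n. d (\<gamma> (s i)) (\<gamma> (s (Suc i)))) \<le> (\<Sum>i<n. s (Suc i) - s i)"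
    by (intro sum_mono) auto
  also have "\<dots> = s n"
    using s(2) by (simp add: sum_lessThan_telescope)
  finally show "ereal (\<Sum>i<n. d (\<gamma> (s i)) (\<gamma> (s (Suc i)))) \<le> ereal (s n)" by simp
qed

text \<open>Rescaling to the unit interval gives Lipschitz constant \<open>r\<close>, which is zero
  for a constant path.\<close>

lemma geodesic_path_component:
  assumes \<gamma>: "geodesic_on r x y \<gamma>" and "0 \<le> r" and S: "\<gamma> ` {0..r} \<subseteq> S"
  shows "path_component_of (subtopology mtopology S) x y"
  unfolding path_component_of_def pathin_def
proof (intro exI conjI)
  let ?p = "\<lambda>t. \<gamma> (r * t)"
  have range: "r * t \<in> {0..r}" if "t \<in> {0..1}" for t
    using that assms(2) by (auto simp: mult_left_le)
  have "continuous_map (top_of_set {0..1}) mtopology ?p"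
  proof (rule lipschitz_continuous_map)
    show "?p \<in> {0..1} \<rightarrow> M"
      using \<gamma> range unfolding geodesic_on_def by blast
    fix s t :: real assume st: "s \<in> {0..1}" "t \<in> {0..1}"
    have "d (?p s) (?p t) \<le> \<bar>r * s - r * t\<bar>"
      using \<gamma> range[OF st(1)] range[OF st(2)] unfolding geodesic_on_def by blast
    also have "\<dots> = r * \<bar>s - t\<bar>"
      using assms(2) by (simp add: abs_mult flip: right_diff_distrib)
    finally show "d (?p s) (?p t) \<le> r * \<bar>s - t\<bar>" .
  qed (use assms(2) in simp)
  moreover have "?p \<in> {0..1} \<rightarrow> S"
    using range S by blast
  ultimately show "continuous_map (top_of_set {0..1}) (subtopology mtopology S) ?p"
    by (simp add: continuous_map_in_subtopology)
  show "\<gamma> (r * 0) = x" "\<gamma> (r * 1) = y"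
    using \<gamma> by (auto simp: geodesic_on_def)
qed

text \<open>A geodesic from the centre of a ball stays within the distance of its endpoint, so balls
  are path-connected, which gives the local statement. One geodesic serves every
  \<open>\<epsilon>\<close>.\<close>

lemma geodesic_length_space:
  assumes geo: "\<And>x y. \<lbrakk>x \<in> M; y \<in> M\<rbrakk> \<Longrightarrow> \<exists>\<gamma>. geodesic_on (d x y) x y \<gamma>"
  shows "length_space M d" "path_connected_space mtopology" "locally_path_connected_space mtopology"
proof -
  show "length_space M d"
    unfolding length_space_def
  proof (intro conjI ballI allI impI)
    show "Metric_space M d"
      by (rule Metric_space_axioms)
    fix x y and \<epsilon> :: real assume xy: "x \<in> M" "y \<in> M" "0 < \<epsilon>"
    obtain \<gamma> where \<gamma>: "geodesic_on (d x y) x y \<gamma>"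
      using geo xy by blast
    have "metric_path M d (d x y) \<gamma>"
      unfolding metric_path_def
      using \<gamma> by (auto intro!: lipschitz_continuous_map[where L = 1] simp: geodesic_on_def)
    moreover have "metric_path_length d (d x y) \<gamma> \<le> ereal (d x y + \<epsilon>)"
      using geodesic_length[OF \<gamma>] by (rule order_trans) (use xy in simp)
    ultimately show "\<exists>t \<gamma>. metric_path M d t \<gamma> \<and> \<gamma> 0 = x \<and> \<gamma> t = y \<and>
        metric_path_length d t \<gamma> \<le> ereal (d x y + \<epsilon>)"
      using \<gamma> unfolding geodesic_on_def by blast
  qed
  have "path_component_of (subtopology mtopology M) x y" if xy: "x \<in> M" "y \<in> M" for x y
  proof -
    obtain \<gamma> where \<gamma>: "geodesic_on (d x y) x y \<gamma>"
      using geo[OF xy] by blast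
    then have "\<gamma> ` {0..d x y} \<subseteq> M"
      by (auto simp: geodesic_on_def)
    then show ?thesis
      using geodesic_path_component[OF \<gamma> nonneg] by blast
  qed
  moreover have "subtopology mtopology M = mtopology"
    by (metis subtopology_topspace topspace_mtopology)
  ultimately show "path_connected_space mtopology"
    by (simp add: path_connected_space_iff_path_component)
  have ball: "path_connectedin mtopology (mball x \<delta>)" if x: "x \<in> M" for x \<delta>
  proof -
    let ?T = "subtopology mtopology (mball x \<delta>)"
    have "path_component_of ?T x y" if y: "y \<in> mball x \<delta>" for y
    proof -
      obtain \<gamma> where \<gamma>: "geodesic_on (d x y) x y \<gamma>"
        using geo x y by auto
      have "\<gamma> t \<in> mball x \<delta>" if t: "t \<in> {0..d x y}" for t
      proof -
        have "d (\<gamma> 0) (\<gamma> t) \<le> \<bar>0 - t\<bar>"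
          using \<gamma> t unfolding geodesic_on_def by (metis atLeastAtMost_iff nonneg order_refl)
        then have "d x (\<gamma> t) < \<delta>"
          using \<gamma> t y by (auto simp: geodesic_on_def)
        then show ?thesis
          using \<gamma> t x by (auto simp: geodesic_on_def)
      qed
      then show ?thesis
        using geodesic_path_component[OF \<gamma> nonneg] by blast
    qed
    then have "path_connected_space ?T"
      unfolding path_connected_space_iff_path_component
      by (metis IntD2 path_component_of_sym path_component_of_trans topspace_subtopology)
    then show ?thesis
      by (auto simp: path_connectedin_def)
  qed
  show "locally_path_connected_space mtopology"
    unfolding locally_path_connected_space_def neighbourhood_base_of
  proof (intro allI impI)
    fix W x assume W: "openin mtopology W \<and> x \<in> W"
    then obtain \<delta> where \<delta>: "\<delta> > 0" "mball x \<delta> \<subseteq> W" "x \<in> M"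
      unfolding openin_mtopology by blast
    show "\<exists>U V. openin mtopology U \<and> path_connectedin mtopology V \<and> x \<in> U \<and> U \<subseteq> V \<and> V \<subseteq> W"
      using ball[OF \<delta>(3), of \<delta>] \<delta>
      by (intro exI[of _ "mball x \<delta>"] conjI) auto
  qed
qed

end

section \<open>The unit group\<close>

theorem (in irreducible_cont_ring) Units_length_space:
  assumes at: atomless
  shows "length_space (Units R) (rank_dist R)"
    "path_connected_space (subtopology (rank_topology R) (Units R))"
    "locally_path_connected_space (subtopology (rank_topology R) (Units R))"
proof -
  interpret S: Submetric "carrier R" "rank_dist R" "Units R"
    by unfold_locales auto
  have "\<exists>\<gamma>. S.sub.geodesic_on (rank_dist R a b) a b \<gamma>" if ab: "a \<in> Units R" "b \<in> Units R" for a b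
  proof -
    have c: "a \<in> carrier R" "b \<in> carrier R" "inv a \<in> carrier R"
      using ab by auto
    define g where "g = inv a \<otimes> b"
    have g: "g \<in> Units R" "g \<in> carrier R"
      using ab by (auto simp: g_def)
    have ag: "a \<otimes> g = b"
      using ab c by (simp add: g_def flip: m_assoc)
    \<comment> \<open>Left multiplication by a unit is an isometry, so a geodesic from
      \<open>\<one>\<close> to \<open>inv a \<otimes> b\<close> becomes one from \<open>a\<close> to
      \<open>b\<close>.\<close>
    have left: "rk (a \<otimes> u \<ominus> a \<otimes> v) = rk (u \<ominus> v)" if "u \<in> carrier R" "v \<in> carrier R" for u v
      using rk_Units(1)[OF ab(1), of "u \<ominus> v"] that c by (simp add: r_distr_minus)
    have dist: "rank_dist R a b = rk (g \<ominus> \<one>)"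
      using left[of g \<one>] ag g c rk_minus_commute[of a b] by (simp add: rank_dist_eq)
    obtain \<gamma> where \<gamma>: "\<And>t. t \<in> {0..rk (g \<ominus> \<one>)} \<Longrightarrow> \<gamma> t \<in> Units R" "\<gamma> 0 = \<one>" "\<gamma> (rk (g \<ominus> \<one>)) = g"
      "\<And>s t. \<lbrakk>s \<in> {0..rk (g \<ominus> \<one>)}; t \<in> {0..rk (g \<ominus> \<one>)}\<rbrakk> \<Longrightarrow> rk (\<gamma> s \<ominus> \<gamma> t) \<le> \<bar>s - t\<bar>"
      using unit_geodesic[OF at g(1)] by blast
    have "S.sub.geodesic_on (rk (g \<ominus> \<one>)) a b (\<lambda>t. a \<otimes> \<gamma> t)"
      unfolding S.sub.geodesic_on_def
    proof (intro conjI ballI)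
      show "(\<lambda>t. a \<otimes> \<gamma> t) \<in> {0..rk (g \<ominus> \<one>)} \<rightarrow> Units R"
        using \<gamma>(1) ab by blast
      fix s t assume st: "s \<in> {0..rk (g \<ominus> \<one>)}" "t \<in> {0..rk (g \<ominus> \<one>)}"
      have "\<gamma> s \<in> carrier R" "\<gamma> t \<in> carrier R"
        using \<gamma>(1) st by blast+
      then show "rank_dist R (a \<otimes> \<gamma> s) (a \<otimes> \<gamma> t) \<le> \<bar>s - t\<bar>"
        using left \<gamma>(4)[OF st] c by (simp add: rank_dist_eq)
    qed (use \<gamma> ag c in auto)
    then show ?thesis
      using dist by auto
  qed
  from S.sub.geodesic_length_space[OF this]
  show "length_space (Units R) (rank_dist R)"
    "path_connected_space (subtopology (rank_topology R) (Units R))"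
    "locally_path_connected_space (subtopology (rank_topology R) (Units R))"
    by (simp_all add: S.mtopology_submetric rank_topology_def)
qed

theorem corollaryB:
  fixes R :: "('a, 'm) ring_scheme"
  assumes "irreducible_ring R"
    and "continuous_ring R"
    and "nondiscrete_ring R"
  shows "length_space (Units R) (rank_dist R)
    \<and> path_connected_space (subtopology (rank_topology R) (Units R))
    \<and> locally_path_connected_space (subtopology (rank_topology R) (Units R))"
proof -
  have "regular_ring R" using assms(2) by (simp add: continuous_ring_def)
  then interpret irreducible_cont_ring R
    unfolding irreducible_cont_ring_def cont_ring_def vn_regular_ring_def
      vn_regular_ring_axioms_def cont_ring_axioms_def irreducible_cont_ring_axioms_def
    using assms by (simp add: regular_ring_def)
  show ?thesis
    using Units_length_space[OF nondiscrete_atomless[OF assms(3)]] by blast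
qed

end
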